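(* Let $\mu\le\lambda$ in $\mathbb{SY}_n$. The map $$\{H_0\mid H\in X_\mu\cap X'_{\lambda^c}\}\times\prod_{d}\{H_d\mid H\in X_\mu\cap X'_{\lambda^c}\}\longrightarrow X_\mu\cap X'_{\lambda^c},$$ where the product is over the components $d$ of $\lambda/\mu$ which do not meet the first column, defined by $$(H_0,\ldots,H_d,\ldots)\longmapsto\langle H_\varphi,H_0,\ldots,H_d,\ldots\rangle,$$ is an isomorphism (of algebraic varieties), where $H_\varphi=\langle e_{\mu_j}\mid \mu_j=\lambda_j\rangle$.
   Context: $V$ is a complex vector space with basis $e_{-n},\ldots,e_n$ and symmetric bilinear form $\beta$ with $\beta(e_i,e_j)=1$ if $i=-j$ and $0$ otherwise. A subspace is isotropic if $\beta$ restricted to it is identically zero; $B_n$ is the projective variety of $n$-dimensional (maximal) isotropic subspaces of $V$. Angle brackets denote linear span. $\mathbb{SY}_n$ is the set of integer sequences $\lambda: n\ge\lambda_1>\cdots>\lambda_n\ge -n$ with $\{|\lambda_1|,\ldots,|\lambda_n|\}=\{1,\ldots,n\}$; $\mu\le\lambda$ means $\mu_j\le\lambda_j$ for all $j$. Set $X_\mu=\{H\in B_n\mid\dim H\cap\langle e_{\mu_j},\ldots,e_n\rangle\ge j,\ 1\le j\le n\}$ and $X'_{\lambda^c}=\{H\in B_n\mid\dim H\cap\langle e_{-n},\ldots,e_{\lambda_j}\rangle\ge n+1-j,\ 1\le j\le n\}$. The diagram of $\lambda$ is the left-justified array with $\lambda_j$ boxes in row $j$ whenever $\lambda_j>0$;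 for $\mu\le\lambda$, $\lambda/\mu$ is the set-theoretic difference of diagrams. Two boxes are connected if they share a vertex or an edge; this generates the components of $\lambda/\mu$. A component meets the first column if it contains a box in the first column. At most one component meets the first column; call it $d_0$ if it exists. For a component $d$, $\mathrm{col}(d)$ is the set of (indices of) columns containing a box of $d$ together with the column just to the left of $d$ (which is $0$ if $d$ meets the first column). Set $V_\varphi:=\langle e_{\mu_j},e_{-\mu_j}\mid\mu_j=\lambda_j\rangle$, $V_0:=\langle e_0,e_k,e_{-k}\mid k\in\mathrm{col}(d_0)\rangle$ (so $V_0=\langle e_0\rangle$ if there is no component meeting the first column), and for a component $d$ not meeting the first column $V_d^+:=\langle e_k\mid k\in\mathrm{col}(d)\rangle$, $V_d^-:=\langle e_{-k}\mid k\in\mathrm{col}(d)\rangle$, $V_d:=V_d^+\oplus V_d^-$. Then $V=V_\varphi\oplus V_0\oplus\bigoplus_{d\ne d_0}V_d$ orthogonally. For $H\in X_\mu\cap X'_{\lambda^c}$ set $H_\varphi:=H\cap V_\varphi$ (which always equals $\langle e_{\mu_j}\mid\mu_j=\lambda_j\rangle$), $H_0:=H\cap V_0$, and $H_d:=(H\cap V_d^+)\oplus(H\cap V_d^-)$. The sets $\{H_0\}$ and $\{H_d\}$ are regarded as (reduced) subvarieties of the varieties of maximal isotropic subspaces of $V_0$ and of $V_d$, respectively; $\{H_0\}$ is the single point $\{0\}$ if no component meets the first column. *)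

theory Defs
  imports "HOL-Library.Function_Algebras" "HOL-Library.FuncSet" "Jordan_Normal_Form.Determinant"
begin

section \<open>The orthogonal space\<close>

text \<open>
  Everything takes place inside the complex vector space of all functions from the integers to
  the complex numbers, so that the rank \<open>n\<close> can be an ordinary variable. The
  \<open>(2n+1)\<close>-dimensional space of the theory is its subspace \<open>V n\<close>.
\<close>

type_synonym cvec = "int \<Rightarrow> complex"

definition cscale :: "complex \<Rightarrow> cvec \<Rightarrow> cvec" where
  "cscale c v = (\<lambda>i. c * v i)"

global_interpretation cv: vector_space cscale
  by unfold_locales (auto simp: cscale_def fun_eq_iff algebra_simps)

definition e :: "int \<Rightarrow> cvec" where
  "e k = (\<lambda>i. if i = k then 1 else 0)"

definition V :: "nat \<Rightarrow> cvec set" where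
  "V n = cv.span (e ` {-int n..int n})"

definition beta :: "nat \<Rightarrow> cvec \<Rightarrow> cvec \<Rightarrow> complex" where
  "beta n u v = (\<Sum>i = -int n..int n. u i * v (-i))"

lemma beta_basis:
  assumes "i \<in> {-int n..int n}" "j \<in> {-int n..int n}"
  shows "beta n (e i) (e j) = (if i = -j then 1 else 0)"
proof -
  have "beta n (e i) (e j) = (\<Sum>k = -int n..int n. if k = i then (if i = -j then 1 else 0) else 0)"
    unfolding beta_def e_def by (rule sum.cong) auto
  then show ?thesis using assms by (simp add: sum.delta)
qed

definition isotropic :: "nat \<Rightarrow> cvec set \<Rightarrow> bool" where
  "isotropic n H \<longleftrightarrow> (\<forall>u\<in>H. \<forall>v\<in>H. beta n u v = 0)"

definition Bn :: "nat \<Rightarrow> cvec set set" where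
  "Bn n = {H. cv.subspace H \<and> H \<subseteq> V n \<and> isotropic n H \<and> cv.dim H = n}"

definition max_isotropic :: "nat \<Rightarrow> cvec set \<Rightarrow> cvec set set" where
  "max_isotropic n W = {H. cv.subspace H \<and> H \<subseteq> W \<and> isotropic n H \<and>
     (\<forall>H'. cv.subspace H' \<and> H' \<subseteq> W \<and> isotropic n H' \<and> H \<subseteq> H' \<longrightarrow> H' = H)}"

section \<open>Subvarieties of products of projective spaces\<close>

text \<open>
  A value of the following record type describes a set of points together with an embedding
  into a product of projective spaces. There is one projective space for each element of
  \<open>factors\<close>, and the projective space of the factor \<open>i\<close> has homogeneous coordinates indexed by
  \<open>indices i\<close>. The set \<open>hom_coords p\<close> contains all choices of homogeneous coordinates for
  the point \<open>p\<close>, each factor being scaled independently. Coordinates outside the index sets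
  carry no information.
\<close>

record ('p, 'i, 'k) multiproj =
  points :: "'p set"
  factors :: "'i set"
  indices :: "'i \<Rightarrow> 'k set"
  hom_coords :: "'p \<Rightarrow> ('i \<Rightarrow> 'k \<Rightarrow> complex) set"

text \<open>
  \<open>multiform I K m F\<close>: the function \<open>F\<close> is given by a multihomogeneous polynomial of
  multidegree \<open>m\<close> in the variables \<open>x i k\<close> for \<open>i \<in> I\<close> and \<open>k \<in> K i\<close>.
\<close>

inductive multiform ::
  "'i set \<Rightarrow> ('i \<Rightarrow> 'k set) \<Rightarrow> ('i \<Rightarrow> nat) \<Rightarrow> (('i \<Rightarrow> 'k \<Rightarrow> complex) \<Rightarrow> complex) \<Rightarrow> bool"
  for I :: "'i set" and K :: "'i \<Rightarrow> 'k set" where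
  const: "multiform I K (\<lambda>_. 0) (\<lambda>_. c)"
| var: "i \<in> I \<Longrightarrow> k \<in> K i \<Longrightarrow> multiform I K (\<lambda>j. if j = i then 1 else 0) (\<lambda>x. x i k)"
| add: "multiform I K m F \<Longrightarrow> multiform I K m G \<Longrightarrow> multiform I K m (\<lambda>x. F x + G x)"
| mult: "multiform I K m F \<Longrightarrow> multiform I K m' G \<Longrightarrow>
    multiform I K (\<lambda>j. m j + m' j) (\<lambda>x. F x * G x)"

abbreviation form_on ::
  "('p, 'i, 'k) multiproj \<Rightarrow> ('i \<Rightarrow> nat) \<Rightarrow> (('i \<Rightarrow> 'k \<Rightarrow> complex) \<Rightarrow> complex) \<Rightarrow> bool" where
  "form_on A \<equiv> multiform (factors A) (indices A)"

definition closed_subvariety :: "('p, 'i, 'k) multiproj \<Rightarrow> 'p set \<Rightarrow> bool" where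
  "closed_subvariety A X \<longleftrightarrow>
     (\<exists>\<Phi>. (\<forall>F\<in>\<Phi>. \<exists>m. form_on A m F) \<and>
          X = {p \<in> points A. \<forall>F\<in>\<Phi>. \<forall>x\<in>hom_coords A p. F x = 0})"

text \<open>
  Regular maps between reduced subvarieties: near every point of the source, each component of
  the map is given by forms of one common multidegree that do not all vanish at that point. The
  neighbourhood is the open set where the forms do not all vanish. This is no restriction,
  because all forms may be multiplied by one further form that vanishes outside a smaller
  neighbourhood.
\<close>

definition regular_map ::
  "('p, 'i, 'k) multiproj \<Rightarrow> 'p set \<Rightarrow> ('q, 'j, 'l) multiproj \<Rightarrow> 'q set \<Rightarrow> ('p \<Rightarrow> 'q) \<Rightarrow> bool" where
  "regular_map A X B Y f \<longleftrightarrow> f ` X \<subseteq> Y \<and>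
     (\<forall>p\<in>X. \<forall>j\<in>factors B. \<exists>m F.
        (\<forall>k\<in>indices B j. form_on A m (F k)) \<and>
        (\<forall>x\<in>hom_coords A p. \<exists>k\<in>indices B j. F k x \<noteq> 0) \<and>
        (\<forall>q\<in>X. \<forall>x\<in>hom_coords A q. (\<exists>k\<in>indices B j. F k x \<noteq> 0) \<longrightarrow>
           (\<exists>y\<in>hom_coords B (f q). \<forall>k\<in>indices B j. y j k = F k x)))"

definition variety_isomorphism ::
  "('p, 'i, 'k) multiproj \<Rightarrow> 'p set \<Rightarrow> ('q, 'j, 'l) multiproj \<Rightarrow> 'q set \<Rightarrow> ('p \<Rightarrow> 'q) \<Rightarrow> bool" where
  "variety_isomorphism A X B Y f \<longleftrightarrow>
     closed_subvariety A X \<and> closed_subvariety B Y \<and> bij_betw f X Y \<and>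
     regular_map A X B Y f \<and> regular_map B Y A X (inv_into X f)"

definition mp_prod ::
  "('p, 'i, 'k) multiproj \<Rightarrow> ('q, 'j, 'k) multiproj \<Rightarrow> ('p \<times> 'q, 'i + 'j, 'k) multiproj" where
  "mp_prod A B = \<lparr>
     points = points A \<times> points B,
     factors = factors A <+> factors B,
     indices = case_sum (indices A) (indices B),
     hom_coords = (\<lambda>(p, q). {case_sum x y | x y. x \<in> hom_coords A p \<and> y \<in> hom_coords B q}) \<rparr>"

definition mp_Pi ::
  "'d set \<Rightarrow> ('d \<Rightarrow> ('p, 'i, 'k) multiproj) \<Rightarrow> ('d \<Rightarrow> 'p, 'd \<times> 'i, 'k) multiproj" where
  "mp_Pi D A = \<lparr>
     points = Pi\<^sub>E D (\<lambda>d. points (A d)),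
     factors = Sigma D (\<lambda>d. factors (A d)),
     indices = (\<lambda>(d, i). indices (A d) i),
     hom_coords = (\<lambda>p. {(\<lambda>(d, i). x d i) | x. \<forall>d\<in>D. x d \<in> hom_coords (A d) (p d)}) \<rparr>"

section \<open>The Pluecker embedding\<close>

text \<open>
  The Pluecker coordinates of the span of \<open>vs\<close> are the maximal minors of the matrix with
  rows \<open>vs\<close>. They are indexed by the sets \<open>K\<close> of columns, in increasing order. All finite sets
  are allowed as indices, with value \<open>0\<close> if the cardinality is wrong: this embeds the disjoint
  union of the Grassmannians of all dimensions into the projective space of the exterior
  algebra, and there is no need to carry the dimension around.
\<close>

definition minor_at :: "cvec list \<Rightarrow> int set \<Rightarrow> complex" where
  "minor_at vs K =
     (if card K = length vs
      then det (mat (length vs) (length vs) (\<lambda>(a, b). (vs ! a) (sorted_list_of_set K ! b)))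
      else 0)"

definition pluecker_coords :: "cvec set \<Rightarrow> (int set \<Rightarrow> complex) set" where
  "pluecker_coords H = {(\<lambda>K. c * minor_at vs K) | c vs.
     c \<noteq> 0 \<and> distinct vs \<and> cv.independent (set vs) \<and> cv.span (set vs) = H}"

definition pluecker :: "nat \<Rightarrow> cvec set set \<Rightarrow> (cvec set, unit, int set) multiproj" where
  "pluecker n S = \<lparr>
     points = S,
     factors = UNIV,
     indices = (\<lambda>_. Pow {-int n..int n}),
     hom_coords = (\<lambda>H. {(\<lambda>_. x) | x. x \<in> pluecker_coords H}) \<rparr>"

section \<open>Schubert varieties\<close>

definition SY :: "nat \<Rightarrow> (nat \<Rightarrow> int) set" where
  "SY n = {la \<in> {1..n} \<rightarrow>\<^sub>E {-int n..int n}.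
     (\<forall>i\<in>{1..n}. \<forall>j\<in>{1..n}. i < j \<longrightarrow> la j < la i) \<and> (\<lambda>j. \<bar>la j\<bar>) ` {1..n} = {1..int n}}"

definition SY_le :: "nat \<Rightarrow> (nat \<Rightarrow> int) \<Rightarrow> (nat \<Rightarrow> int) \<Rightarrow> bool" where
  "SY_le n mu la \<longleftrightarrow> (\<forall>j\<in>{1..n}. mu j \<le> la j)"

definition Xs :: "nat \<Rightarrow> (nat \<Rightarrow> int) \<Rightarrow> cvec set set" where
  "Xs n mu = {H \<in> Bn n. \<forall>j\<in>{1..n}. j \<le> cv.dim (H \<inter> cv.span (e ` {mu j..int n}))}"

text \<open>\<open>Xs' n la\<close> is the variety usually indexed by the complementary sequence of \<open>la\<close>.\<close>

definition Xs' :: "nat \<Rightarrow> (nat \<Rightarrow> int) \<Rightarrow> cvec set set" where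
  "Xs' n la = {H \<in> Bn n. \<forall>j\<in>{1..n}. n + 1 - j \<le> cv.dim (H \<inter> cv.span (e ` {-int n..la j}))}"

section \<open>Components of a skew diagram\<close>

text \<open>A box is the pair of its row and its column.\<close>

definition diagram :: "nat \<Rightarrow> (nat \<Rightarrow> int) \<Rightarrow> (nat \<times> int) set" where
  "diagram n la = {(j, k). j \<in> {1..n} \<and> 1 \<le> k \<and> k \<le> la j}"

definition skew :: "nat \<Rightarrow> (nat \<Rightarrow> int) \<Rightarrow> (nat \<Rightarrow> int) \<Rightarrow> (nat \<times> int) set" where
  "skew n la mu = diagram n la - diagram n mu"

definition touching :: "(nat \<times> int) set \<Rightarrow> ((nat \<times> int) \<times> (nat \<times> int)) set" where
  "touching S = {((i, k), (j, l)). (i, k) \<in> S \<and> (j, l) \<in> S \<and>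
     \<bar>int i - int j\<bar> \<le> 1 \<and> \<bar>k - l\<bar> \<le> 1}"

definition components :: "(nat \<times> int) set \<Rightarrow> (nat \<times> int) set set" where
  "components S = S // (touching S)\<^sup>*"

definition meets_first_column :: "(nat \<times> int) set \<Rightarrow> bool" where
  "meets_first_column d \<longleftrightarrow> (\<exists>j. (j, 1) \<in> d)"

definition col :: "(nat \<times> int) set \<Rightarrow> int set" where
  "col d = insert (Min (snd ` d) - 1) (snd ` d)"

definition inner_components :: "nat \<Rightarrow> (nat \<Rightarrow> int) \<Rightarrow> (nat \<Rightarrow> int) \<Rightarrow> (nat \<times> int) set set" where
  "inner_components n la mu = {d \<in> components (skew n la mu). \<not> meets_first_column d}"

section \<open>The pieces of a subspace\<close>

text \<open>
  At most one component meets the first column. The union over all such components therefore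
  covers both the case that it exists and the case that it does not.
\<close>

definition V0 :: "nat \<Rightarrow> (nat \<Rightarrow> int) \<Rightarrow> (nat \<Rightarrow> int) \<Rightarrow> cvec set" where
  "V0 n la mu = cv.span (insert (e 0)
     (\<Union>d \<in> {d \<in> components (skew n la mu). meets_first_column d}. \<Union>k \<in> col d. {e k, e (-k)}))"

definition Vplus :: "(nat \<times> int) set \<Rightarrow> cvec set" where
  "Vplus d = cv.span (e ` col d)"

definition Vminus :: "(nat \<times> int) set \<Rightarrow> cvec set" where
  "Vminus d = cv.span ((\<lambda>k. e (-k)) ` col d)"

definition Vd :: "(nat \<times> int) set \<Rightarrow> cvec set" where
  "Vd d = cv.span (Vplus d \<union> Vminus d)"

definition Hphi :: "nat \<Rightarrow> (nat \<Rightarrow> int) \<Rightarrow> (nat \<Rightarrow> int) \<Rightarrow> cvec set" where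
  "Hphi n la mu = cv.span {e (mu j) | j. j \<in> {1..n} \<and> mu j = la j}"

definition H0_part :: "nat \<Rightarrow> (nat \<Rightarrow> int) \<Rightarrow> (nat \<Rightarrow> int) \<Rightarrow> cvec set \<Rightarrow> cvec set" where
  "H0_part n la mu H = H \<inter> V0 n la mu"

definition Hd_part :: "(nat \<times> int) set \<Rightarrow> cvec set \<Rightarrow> cvec set" where
  "Hd_part d H = cv.span ((H \<inter> Vplus d) \<union> (H \<inter> Vminus d))"

end

theory Submission
  imports Defs
begin

text \<open>
  Call a position \<open>t\<close> balanced if \<open>mu\<close> and \<open>la\<close> have equally many entries \<open>\<ge> t\<close>. For
  \<open>t \<ge> 1\<close> this says that column \<open>t\<close> of the skew diagram is empty, and \<open>t\<close> is balanced if and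
  only if \<open>1 - t\<close> is. At a balanced position the Schubert conditions from both sides add up to
  dimension \<open>n\<close>, so every \<open>H\<close> in the intersection splits there. Since \<open>\<plusminus>col d\<close>, the
  indices of \<open>V0\<close> and those of \<open>Hphi\<close> partition \<open>{-n..n}\<close> into intervals between balanced
  positions, \<open>H\<close> is the orthogonal sum of its parts, and parts of different \<open>H\<close> can be
  recombined: a dimension count from one balanced position to the next gives back the Schubert
  conditions.

  Up to a sign that depends only on the column set \<open>K\<close>, the Pluecker coordinate \<open>K\<close> of a sum
  of subspaces with disjoint supports is the product of the coordinates of the summands. Hence the
  map is given by forms, the source is the preimage of the target and therefore closed, and the
  coordinates of a part are recovered by fixing the columns in the other blocks.
\<close>

section \<open>Sequences and skew diagrams\<close>

text \<open>The obstacle on the algebraic side is that the factors of the source are images of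
  \<open>X\<close> under taking parts and come without equations. Maximality removes it. If
  \<open>p\<close> is any point of the ambient product and \<open>join p\<close> lies in
  \<open>X\<close>, then each factor of \<open>p\<close> is contained in the part of
  \<open>join p\<close> in its block. That part is isotropic and the factor is maximal isotropic, so
  they agree, and \<open>p\<close> consists of the parts of \<open>join p\<close>. Membership in the
  source can thus be tested on \<open>join p\<close>. For this reason isotropy and coordinates of
  \<open>join p\<close> are established for all points of the product, where not even its dimension
  is known.

  Equations of the target come from pivot sets. The rank of the restriction of \<open>H\<close> to a
  set \<open>C\<close> of columns is the largest number of elements of \<open>C\<close> in a column
  set with nonvanishing coordinate, so a Schubert condition says that certain coordinates vanish.
  Pivot sets also carry the dimension counts, because the space of all functions is
  infinite-dimensional and only the finite window \<open>{-n..n}\<close> is used.\<close>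

definition cnt :: "nat \<Rightarrow> (nat \<Rightarrow> int) \<Rightarrow> int \<Rightarrow> nat" where
  "cnt n la t = card {i\<in>{1..n}. t \<le> la i}"

lemma cnt_le: "cnt n la t \<le> n"
proof -
  have "card {i\<in>{1..n}. t \<le> la i} \<le> card {1..n}" by (rule card_mono) auto
  then show ?thesis by (simp add: cnt_def)
qed

lemma cnt_antimono: "s \<le> t \<Longrightarrow> cnt n la t \<le> cnt n la s"
  unfolding cnt_def by (rule card_mono) auto

lemma SY_bounds:
  assumes "la \<in> SY n" "i \<in> {1..n}"
  shows "- int n \<le> la i" "la i \<le> int n" "la i \<noteq> 0"
proof -
  have "la i \<in> {-int n..int n}" using assms by (auto simp: SY_def PiE_def Pi_def)
  then show "- int n \<le> la i" "la i \<le> int n" by auto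
  have "\<bar>la i\<bar> \<in> {1..int n}" using assms unfolding SY_def by blast
  then show "la i \<noteq> 0" by auto
qed

lemma SY_less: "la \<in> SY n \<Longrightarrow> i \<in> {1..n} \<Longrightarrow> j \<in> {1..n} \<Longrightarrow> i < j \<Longrightarrow> la j < la i"
  unfolding SY_def by auto

lemma SY_less_iff: "la \<in> SY n \<Longrightarrow> i \<in> {1..n} \<Longrightarrow> j \<in> {1..n} \<Longrightarrow> la j < la i \<longleftrightarrow> i < j"
  by (metis SY_less linorder_neqE_nat order_less_asym order_less_irrefl)

lemma SY_le_iff: "la \<in> SY n \<Longrightarrow> i \<in> {1..n} \<Longrightarrow> j \<in> {1..n} \<Longrightarrow> la j \<le> la i \<longleftrightarrow> i \<le> j"
  by (metis SY_less_iff linorder_not_less)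

text \<open>The sequence is strictly decreasing, so its entries \<open>\<ge> t\<close> are its first
  \<open>cnt n la t\<close> ones. This translates between rows \<open>i\<close> and positions
  \<open>t\<close>.\<close>

lemma SY_cnt_iff:
  assumes la: "la \<in> SY n" and i: "i \<in> {1..n}"
  shows "t \<le> la i \<longleftrightarrow> i \<le> cnt n la t"
proof
  assume t: "t \<le> la i"
  have "{1..i} \<subseteq> {k\<in>{1..n}. t \<le> la k}"
  proof
    fix k assume k: "k \<in> {1..i}"
    with i have "k \<in> {1..n}" by auto
    moreover then have "la i \<le> la k" using SY_le_iff[OF la _ i] k by auto
    ultimately show "k \<in> {k\<in>{1..n}. t \<le> la k}" using t by auto
  qed
  from card_mono[OF _ this] show "i \<le> cnt n la t" by (simp add: cnt_def)
next
  assume c: "i \<le> cnt n la t"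
  show "t \<le> la i"
  proof (rule ccontr)
    assume t: "\<not> t \<le> la i"
    have "{k\<in>{1..n}. t \<le> la k} \<subseteq> {1..<i}"
    proof
      fix k assume k: "k \<in> {k\<in>{1..n}. t \<le> la k}"
      then have "la i < la k" using t by auto
      then show "k \<in> {1..<i}" using SY_less_iff[OF la _ i, of k] k by auto
    qed
    from card_mono[OF _ this] have "cnt n la t \<le> i - 1" by (simp add: cnt_def)
    with c i show False by auto
  qed
qed

lemma cnt_at: assumes "la \<in> SY n" "i \<in> {1..n}" shows "cnt n la (la i) = i"
proof -
  have "{k\<in>{1..n}. la i \<le> la k} = {1..i}" using SY_le_iff[OF assms(1) _ assms(2)] assms(2) by auto
  then show ?thesis by (simp add: cnt_def)
qed

lemma cnt_after: assumes "la \<in> SY n" "i \<in> {1..n}" shows "cnt n la (la i + 1) = i - 1"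
proof -
  have "la i + 1 \<le> la k \<longleftrightarrow> la i < la k" for k by auto
  then have "{k\<in>{1..n}. la i + 1 \<le> la k} = {1..<i}" using SY_less_iff[OF assms(1) _ assms(2)] assms(2) by auto
  then show ?thesis by (simp add: cnt_def)
qed

lemma cnt_top: "la \<in> SY n \<Longrightarrow> cnt n la (int n + 1) = 0"
  unfolding cnt_def using SY_bounds(2)[of la n] by fastforce

lemma cnt_bot: assumes "la \<in> SY n" "t \<le> - int n" shows "cnt n la t = n"
proof -
  have "{i\<in>{1..n}. t \<le> la i} = {1..n}" using SY_bounds(1)[OF assms(1)] assms(2) by fastforce
  then show ?thesis by (simp add: cnt_def)
qed

lemma cnt_mono: "SY_le n mu la \<Longrightarrow> cnt n mu t \<le> cnt n la t"
  unfolding cnt_def SY_le_def by (rule card_mono) force+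

text \<open>The absolute values of the entries run through \<open>{1..int n}\<close> once each.
  Those that are at least \<open>t\<close> come from entries \<open>\<ge> t\<close> or
  \<open>\<le> - t\<close>, and the latter are the complement of the entries
  \<open>\<ge> 1 - t\<close>.\<close>

lemma cnt_reflect:
  assumes la: "la \<in> SY n" and t: "1 \<le> t"
  shows "cnt n la (1 - t) + card ({1..int n} \<inter> {t..}) = n + cnt n la t"
proof -
  let ?A = "{i\<in>{1..n}. t \<le> la i}" and ?B = "{i\<in>{1..n}. la i \<le> - t}" and ?C = "{i\<in>{1..n}. 1 - t \<le> la i}"
  have im: "(\<lambda>j. \<bar>la j\<bar>) ` {1..n} = {1..int n}" using la by (auto simp: SY_def)
  then have inj: "inj_on (\<lambda>j. \<bar>la j\<bar>) {1..n}" by (intro eq_card_imp_inj_on) auto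
  have eq: "(\<lambda>j. \<bar>la j\<bar>) ` {i\<in>{1..n}. t \<le> \<bar>la i\<bar>} = {1..int n} \<inter> {t..}"
    unfolding im[symmetric] by auto
  have c1: "card ({1..int n} \<inter> {t..}) = card {i\<in>{1..n}. t \<le> \<bar>la i\<bar>}"
    unfolding eq[symmetric] by (rule card_image[OF inj_on_subset[OF inj]]) auto
  have "{i\<in>{1..n}. t \<le> \<bar>la i\<bar>} = ?A \<union> ?B" using t by auto
  moreover have "?A \<inter> ?B = {}" using t by auto
  ultimately have c2: "card {i\<in>{1..n}. t \<le> \<bar>la i\<bar>} = card ?A + card ?B"
    by (simp add: card_Un_disjoint)
  have "{1..n} = ?B \<union> ?C" "?B \<inter> ?C = {}" by auto
  then have "card {1..n} = card ?B + card ?C" by (metis (no_types, lifting) card_Un_disjoint finite_Un finite_atLeastAtMost)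
  then show ?thesis using c1 c2 by (simp add: cnt_def)
qed

locale sy_pair =
  fixes n :: nat and mu la :: "nat \<Rightarrow> int"
  assumes mu: "mu \<in> SY n" and la: "la \<in> SY n" and le: "SY_le n mu la"
begin

definition balanced :: "int \<Rightarrow> bool" where
  "balanced t \<longleftrightarrow> cnt n mu t = cnt n la t"

text \<open>For \<open>t \<ge> 1\<close> the difference between the counts at \<open>1 - t\<close>
  and at \<open>t\<close> depends only on \<open>n\<close> and \<open>t\<close>, hence is the same
  for \<open>mu\<close> and \<open>la\<close>. For other \<open>t\<close> the two positions exchange
  roles.\<close>

lemma balanced_reflect: "balanced (1 - t) \<longleftrightarrow> balanced t"
proof -
  have *: "balanced (1 - s) \<longleftrightarrow> balanced s" if "1 \<le> s" for s
    using cnt_reflect[OF mu that] cnt_reflect[OF la that] unfolding balanced_def by linarith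
  show ?thesis
  proof (cases "1 \<le> t")
    case False
    then have "1 \<le> 1 - t" by auto
    from *[OF this] show ?thesis by simp
  qed (rule *)
qed

text \<open>\<open>cnt n la\<close> drops from \<open>i\<close> to \<open>i - 1\<close> between the
  two positions. Balance forces the same drop on \<open>cnt n mu\<close>, which puts the
  \<open>i\<close>-th entry of \<open>mu\<close> there.\<close>

lemma balanced_fixed:
  assumes i: "i \<in> {1..n}" and b: "balanced (la i)" "balanced (la i + 1)"
  shows "mu i = la i"
proof -
  have "cnt n mu (la i) = i" "cnt n mu (la i + 1) = i - 1"
    using b cnt_at[OF la i] cnt_after[OF la i] by (auto simp: balanced_def)
  then have "la i \<le> mu i" "\<not> la i + 1 \<le> mu i"
    using SY_cnt_iff[OF mu i] i by auto
  then show ?thesis by auto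
qed

lemma fixed_balanced:
  assumes i: "i \<in> {1..n}" and eq: "mu i = la i"
  shows "balanced (la i)" "balanced (la i + 1)"
  using cnt_at[OF la i] cnt_after[OF la i] cnt_at[OF mu i] cnt_after[OF mu i] eq
  by (auto simp: balanced_def)

section \<open>Components as maximal runs of nonempty columns\<close>

abbreviation boxes :: "(nat \<times> int) set" where "boxes \<equiv> skew n la mu"

lemma boxes_iff: "(j, k) \<in> boxes \<longleftrightarrow> 1 \<le> k \<and> cnt n mu k < j \<and> j \<le> cnt n la k"
proof (cases "j \<in> {1..n}")
  case True
  then show ?thesis using SY_cnt_iff[OF mu True, of k] SY_cnt_iff[OF la True, of k]
    by (auto simp: skew_def diagram_def)
next
  case False
  then show ?thesis using cnt_le[of n la k] by (auto simp: skew_def diagram_def)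
qed

lemma finite_boxes: "finite boxes"
proof (rule finite_subset)
  show "boxes \<subseteq> {1..n} \<times> {1..int n}"
    using SY_bounds(2)[OF la] by (fastforce simp: skew_def diagram_def)
qed auto

definition nonempty_column :: "int \<Rightarrow> bool" where
  "nonempty_column k \<longleftrightarrow> 1 \<le> k \<and> \<not> balanced k"

lemma nonempty_column_iff: "nonempty_column k \<longleftrightarrow> (\<exists>j. (j, k) \<in> boxes)"
proof
  assume "nonempty_column k"
  then have "(cnt n la k, k) \<in> boxes"
    using cnt_mono[OF le, of k] by (auto simp: boxes_iff nonempty_column_def balanced_def)
  then show "\<exists>j. (j, k) \<in> boxes" ..
qed (auto simp: boxes_iff nonempty_column_def balanced_def)

text \<open>This will turn out to be connectivity: two boxes lie in the same component exactly when
  no empty column separates them.\<close>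

definition linked :: "int \<Rightarrow> int \<Rightarrow> bool" where
  "linked k l \<longleftrightarrow> (\<forall>x\<in>{min k l..max k l}. nonempty_column x)"

lemma touching_linked:
  assumes "(a, b) \<in> (touching boxes)\<^sup>*" "a \<in> boxes"
  shows "b \<in> boxes \<and> linked (snd a) (snd b)"
  using assms(1)
proof (induction rule: rtrancl_induct)
  case base
  have "nonempty_column (snd a)" using assms(2) nonempty_column_iff by (cases a) auto
  then show ?case using assms(2) by (auto simp: linked_def)
next
  case (step y z)
  obtain i k j l where yz: "y = (i, k)" "z = (j, l)" by fastforce
  have z: "(j, l) \<in> boxes" "\<bar>k - l\<bar> \<le> 1" using step(2) by (auto simp: touching_def yz)
  then have "nonempty_column l" using nonempty_column_iff by auto
  moreover have "x \<in> {min (snd a) k..max (snd a) k} \<or> x = l"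
    if "x \<in> {min (snd a) l..max (snd a) l}" for x using that z(2) by auto
  ultimately have "linked (snd a) l"
    using step(3) unfolding linked_def yz snd_conv by blast
  then show ?case using z(1) yz by simp
qed

lemma same_column:
  assumes "(i, k) \<in> boxes" "(j, k) \<in> boxes"
  shows "((i, k), (j, k)) \<in> (touching boxes)\<^sup>*"
proof -
  have up: "((i, k), (j, k)) \<in> (touching boxes)\<^sup>* \<and> ((j, k), (i, k)) \<in> (touching boxes)\<^sup>*"
    if "i \<le> j" "(i, k) \<in> boxes" "(j, k) \<in> boxes" for i j
    using that
  proof (induction rule: dec_induct)
    case (step m)
    then have m: "(m, k) \<in> boxes" by (auto simp: boxes_iff)
    then have "((m, k), (Suc m, k)) \<in> touching boxes" "((Suc m, k), (m, k)) \<in> touching boxes"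
      using step by (auto simp: touching_def)
    then show ?case using step m
      by (meson converse_rtrancl_into_rtrancl rtrancl.rtrancl_into_rtrancl)
  qed auto
  show ?thesis using up[of i j] up[of j i] assms by linarith
qed

text \<open>The bottom boxes of the two columns touch. Their rows differ by at most one because the
  entries of \<open>la\<close> are distinct, and a common vertex is enough.\<close>

lemma next_column:
  assumes "nonempty_column k" "nonempty_column (k + 1)"
  obtains i j where "((i, k), (j, k + 1)) \<in> touching boxes" "((j, k + 1), (i, k)) \<in> touching boxes"
proof -
  have a: "(cnt n la k, k) \<in> boxes" "(cnt n la (k+1), k+1) \<in> boxes"
    using assms cnt_mono[OF le, of k] cnt_mono[OF le, of "k+1"]
    by (auto simp: boxes_iff nonempty_column_def balanced_def)
  \<comment> \<open>Otherwise two consecutive rows of \<open>la\<close> would both end in column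
    \<open>k\<close>.\<close>
  have "cnt n la k \<le> cnt n la (k + 1) + 1"
  proof (rule ccontr)
    assume c: "\<not> ?thesis"
    define i where "i = cnt n la (k + 1) + 1"
    have i: "i \<in> {1..n}" "Suc i \<in> {1..n}" using c cnt_le[of n la k] by (auto simp: i_def)
    have "k \<le> la (Suc i)" using SY_cnt_iff[OF la i(2), of k] c by (auto simp: i_def)
    moreover have "la (Suc i) < la i" by (rule SY_less[OF la i]) auto
    moreover have "\<not> k + 1 \<le> la i" using SY_cnt_iff[OF la i(1), of "k+1"] by (auto simp: i_def)
    ultimately show False by auto
  qed
  moreover have "cnt n la (k + 1) \<le> cnt n la k" by (rule cnt_antimono) simp
  ultimately show ?thesis using a by (intro that[of "cnt n la k" "cnt n la (k+1)"]) (auto simp: touching_def)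
qed

lemma linked_touching:
  assumes "(i, k) \<in> boxes" "(j, l) \<in> boxes" "linked k l"
  shows "((i, k), (j, l)) \<in> (touching boxes)\<^sup>*"
proof -
  have up: "((i, k), (j, l)) \<in> (touching boxes)\<^sup>* \<and> ((j, l), (i, k)) \<in> (touching boxes)\<^sup>*"
    if "k \<le> l" "(i, k) \<in> boxes" "(j, l) \<in> boxes" "linked k l" for i j k l
    using that
  proof (induction arbitrary: j rule: int_ge_induct)
    case base
    then show ?case using same_column by auto
  next
    case (step l)
    have "nonempty_column l" "nonempty_column (l + 1)" "linked k l"
      using step(1,5) by (auto simp: linked_def)
    then obtain i' j' where ij: "((i', l), (j', l + 1)) \<in> touching boxes" "((j', l + 1), (i', l)) \<in> touching boxes"
      using next_column by blast
    then have b: "(i', l) \<in> boxes" "(j', l + 1) \<in> boxes" by (auto simp: touching_def)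
    have "((i, k), (i', l)) \<in> (touching boxes)\<^sup>* \<and> ((i', l), (i, k)) \<in> (touching boxes)\<^sup>*"
      using step.IH step(3) b(1) \<open>linked k l\<close> by blast
    moreover have "((j', l + 1), (j, l + 1)) \<in> (touching boxes)\<^sup>*" "((j, l + 1), (j', l + 1)) \<in> (touching boxes)\<^sup>*"
      using same_column step(4) b(2) by auto
    ultimately show ?case using ij by (meson rtrancl.rtrancl_into_rtrancl rtrancl_trans)
  qed
  have "linked l k" using assms(3) by (auto simp: linked_def min.commute max.commute)
  then show ?thesis using up[of k l i j] up[of l k j i] assms by (meson linear)
qed

text \<open>Connectivity only depends on columns: \<open>touching_linked\<close> gives one
  inclusion, \<open>linked_touching\<close> the other. From here on a component is handled through
  its set of columns.\<close>

lemma components_eq: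
  "components boxes = (\<lambda>a. {b\<in>boxes. linked (snd a) (snd b)}) ` boxes"
proof -
  have "(touching boxes)\<^sup>* `` {a} = {b\<in>boxes. linked (snd a) (snd b)}" if "a \<in> boxes" for a
  proof (intro Set.set_eqI iffI)
    fix b assume "b \<in> (touching boxes)\<^sup>* `` {a}"
    then show "b \<in> {b\<in>boxes. linked (snd a) (snd b)}" using touching_linked[of a b] that by simp
  next
    fix b assume "b \<in> {b\<in>boxes. linked (snd a) (snd b)}"
    then show "b \<in> (touching boxes)\<^sup>* `` {a}"
      using linked_touching[of "fst a" "snd a" "fst b" "snd b"] that by simp
  qed
  then show ?thesis unfolding components_def quotient_def by auto
qed

lemma linked_trans: "linked k l \<Longrightarrow> linked l m \<Longrightarrow> linked k m"
  unfolding linked_def by (smt (verit, ccfv_threshold) atLeastAtMost_iff max_def min_def)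

lemma linked_sym: "linked k l \<Longrightarrow> linked l k"
  unfolding linked_def by (simp add: min.commute max.commute)

lemma component_columns_eq:
  assumes d: "d \<in> components boxes" and k: "k \<in> snd ` d"
  shows "d = {b\<in>boxes. linked k (snd b)}"
proof -
  obtain a where a: "a \<in> boxes" "d = {b\<in>boxes. linked (snd a) (snd b)}" using d components_eq by auto
  then have "linked (snd a) k" using k by auto
  then show ?thesis using a linked_trans linked_sym by blast
qed

lemma component_unique:
  "d \<in> components boxes \<Longrightarrow> d' \<in> components boxes \<Longrightarrow> k \<in> snd ` d \<Longrightarrow> k \<in> snd ` d' \<Longrightarrow> d = d'"
  using component_columns_eq by blast

lemma component_exists:
  assumes "nonempty_column k"
  obtains d where "d \<in> components boxes" "k \<in> snd ` d"
proof -
  obtain j where j: "(j, k) \<in> boxes" using assms nonempty_column_iff by auto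
  have "linked k k" using assms by (auto simp: linked_def)
  then show ?thesis using j components_eq
    by (intro that[of "{b\<in>boxes. linked k (snd b)}"]) force+
qed

text \<open>By maximality of the run, the columns \<open>p\<close> and \<open>q + 1\<close> next to
  it are empty, hence balanced. The exception \<open>p = 0\<close> is the component meeting the
  first column: position \<open>1\<close> is then unbalanced, and so is its reflection
  \<open>0\<close>.\<close>

lemma component_columns:
  assumes d: "d \<in> components boxes"
  obtains p q where "0 \<le> p" "p < q" "q \<le> int n" "snd ` d = {p+1..q}" "col d = {p..q}"
    "p = 0 \<or> balanced p" "balanced (q + 1)" "\<And>x. x \<in> {p+1..q} \<Longrightarrow> nonempty_column x"
proof -
  obtain a where a: "a \<in> boxes" "d = {b\<in>boxes. linked (snd a) (snd b)}" using d components_eq by auto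
  define k where "k = snd a"
  have ka: "nonempty_column k" using a nonempty_column_iff[of k] by (cases a) (auto simp: k_def)
  have cols: "l \<in> snd ` d \<longleftrightarrow> linked k l" for l
  proof
    assume l: "linked k l"
    then have "nonempty_column l" by (auto simp: linked_def)
    then obtain j where "(j, l) \<in> boxes" using nonempty_column_iff by auto
    then show "l \<in> snd ` d" using l a k_def by force
  qed (auto simp: a k_def)
  have fin: "finite (snd ` d)" using a finite_boxes by auto
  have kin: "k \<in> snd ` d" using cols ka by (auto simp: linked_def)
  define p q where "p = Min (snd ` d) - 1" and "q = Max (snd ` d)"
  have pin: "p + 1 \<in> snd ` d" and qin: "q \<in> snd ` d"
    using Min_in[OF fin] Max_in[OF fin] kin by (auto simp: p_def q_def)
  have pk: "p + 1 \<le> k" "k \<le> q" using Min_le[OF fin kin] Max_ge[OF fin kin] by (auto simp: p_def q_def)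
  have lp: "linked k (p + 1)" "linked k q" using cols pin qin by auto
  have eq: "snd ` d = {p+1..q}"
  proof (intro Set.set_eqI iffI)
    fix x assume "x \<in> snd ` d"
    from Min_le[OF fin this] Max_ge[OF fin this] show "x \<in> {p+1..q}" by (simp add: p_def q_def)
  next
    fix x assume x: "x \<in> {p+1..q}"
    have "linked k x" unfolding linked_def
    proof
      fix y assume "y \<in> {min k x..max k x}"
      then have "y \<in> {min k (p+1)..max k (p+1)} \<or> y \<in> {min k q..max k q}" using x pk by auto
      then show "nonempty_column y" using lp unfolding linked_def by blast
    qed
    then show "x \<in> snd ` d" using cols by auto
  qed
  have ne: "nonempty_column x" if "x \<in> {p+1..q}" for x
    using that cols[of x] eq by (auto simp: linked_def)
  have p0: "0 \<le> p" using ne[of "p+1"] pk by (auto simp: nonempty_column_def)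
  have "\<not> nonempty_column p"
  proof
    assume "nonempty_column p"
    then have "nonempty_column x" if "x \<in> {p..k}" for x
      using ne[of x] that pk by (cases "x = p") auto
    then have "linked k p" using pk by (auto simp: linked_def)
    then have "p \<in> {p+1..q}" using cols eq by blast
    then show False by simp
  qed
  then have bp: "p = 0 \<or> balanced p" using p0 by (auto simp: nonempty_column_def)
  have "\<not> nonempty_column (q + 1)"
  proof
    assume "nonempty_column (q + 1)"
    then have "nonempty_column x" if "x \<in> {k..q+1}" for x
      using ne[of x] that pk by (cases "x = q + 1") auto
    then have "linked k (q + 1)" using pk by (auto simp: linked_def)
    then have "q + 1 \<in> {p+1..q}" using cols eq by blast
    then show False by simp
  qed
  then have bq: "balanced (q + 1)" using p0 pk by (auto simp: nonempty_column_def)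
  have "col d = {p..q}" unfolding col_def p_def[symmetric] unfolding eq using pk by auto
  moreover have "q \<le> int n"
  proof -
    have "nonempty_column q" using ne pk by auto
    then obtain j where "(j, q) \<in> boxes" using nonempty_column_iff by auto
    then show ?thesis using SY_bounds(2)[OF la] by (fastforce simp: skew_def diagram_def)
  qed
  ultimately show ?thesis using that p0 bp bq ne eq pk by auto
qed

section \<open>The index blocks\<close>

definition Cphi :: "int set" where
  "Cphi = {k. \<exists>j\<in>{1..n}. mu j = la j \<and> \<bar>k\<bar> = \<bar>la j\<bar>}"

definition C0 :: "int set" where
  "C0 = insert 0 (\<Union>d \<in> {d \<in> components boxes. meets_first_column d}. \<Union>k \<in> col d. {k, -k})"

definition Cd :: "(nat \<times> int) set \<Rightarrow> int set" where
  "Cd d = {k. \<bar>k\<bar> \<in> col d}"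

abbreviation inner :: "(nat \<times> int) set set" where "inner \<equiv> inner_components n la mu"

text \<open>For \<open>k = la j\<close> this is \<open>fixed_balanced\<close>. For
  \<open>k = - la j\<close> the positions \<open>k\<close> and \<open>k + 1\<close> are the
  reflections of \<open>la j + 1\<close> and \<open>la j\<close>.\<close>

lemma Cphi_balanced:
  assumes k: "k \<in> Cphi"
  shows "balanced k" "balanced (k + 1)" "k \<noteq> 0" "k \<in> {-int n..int n}"
proof -
  obtain j where j: "j \<in> {1..n}" "mu j = la j" and jk: "\<bar>k\<bar> = \<bar>la j\<bar>" using k by (auto simp: Cphi_def)
  from jk have *: "k = la j \<or> k = - la j" by linarith
  note b = fixed_balanced[OF j]
  have "balanced (- la j)" "balanced (- la j + 1)"
    using b balanced_reflect[of "la j + 1"] balanced_reflect[of "la j"] by (simp_all add: algebra_simps)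
  with * b show "balanced k" "balanced (k + 1)" by auto
  show "k \<noteq> 0" "k \<in> {-int n..int n}" using * SY_bounds[OF la j(1)] by auto
qed

lemma balanced_Cphi:
  assumes k: "1 \<le> \<bar>k\<bar>" "\<bar>k\<bar> \<le> int n" and b: "balanced \<bar>k\<bar>" "balanced (\<bar>k\<bar> + 1)"
  shows "k \<in> Cphi"
proof -
  have "(\<lambda>j. \<bar>la j\<bar>) ` {1..n} = {1..int n}" using la by (auto simp: SY_def)
  moreover have "\<bar>k\<bar> \<in> {1..int n}" using k by auto
  ultimately obtain j where j: "j \<in> {1..n}" "\<bar>k\<bar> = \<bar>la j\<bar>" by (metis (no_types, lifting) imageE)
  have "balanced (- \<bar>k\<bar>)" "balanced (- \<bar>k\<bar> + 1)"
    using b balanced_reflect[of "\<bar>k\<bar> + 1"] balanced_reflect[of "\<bar>k\<bar>"] by (simp_all add: algebra_simps)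
  moreover have "la j = \<bar>k\<bar> \<or> la j = - \<bar>k\<bar>" using j(2) by linarith
  ultimately have "balanced (la j)" "balanced (la j + 1)" using b by metis+
  from balanced_fixed[OF j(1) this] show ?thesis using j by (auto simp: Cphi_def)
qed

lemma meets_first_column_iff: "meets_first_column d \<longleftrightarrow> 1 \<in> snd ` d"
  by (force simp: meets_first_column_def)

text \<open>Two components containing column \<open>1\<close> coincide, so the union in
  \<open>C0\<close> has at most one member. The bound \<open>m\<close> is its last column; without
  such a component \<open>m = 0\<close>, and column \<open>1\<close> is empty.\<close>

lemma first_component:
  obtains m where "0 \<le> m" "m \<le> int n" "C0 = {-m..m}" "balanced (m + 1)"
    "\<And>x. x \<in> {1..m} \<Longrightarrow> \<exists>d \<in> components boxes. meets_first_column d \<and> x \<in> snd ` d"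
proof (cases "\<exists>d \<in> components boxes. meets_first_column d")
  case True
  then obtain d where d: "d \<in> components boxes" "meets_first_column d" by auto
  obtain p q where pq: "0 \<le> p" "p < q" "q \<le> int n" "snd ` d = {p+1..q}" "col d = {p..q}" "balanced (q + 1)"
    using component_columns[OF d(1)] by metis
  have p: "p = 0" using d(2) pq by (auto simp: meets_first_column_iff)
  have "{d \<in> components boxes. meets_first_column d} = {d}"
  proof (intro Set.set_eqI iffI)
    fix d' assume "d' \<in> {d \<in> components boxes. meets_first_column d}"
    then show "d' \<in> {d}" using component_unique[of d' d 1] d by (simp add: meets_first_column_iff)
  qed (use d in simp)
  then have C0: "C0 = insert 0 (\<Union>k \<in> {0..q}. {k, -k})" using pq p by (simp add: C0_def)
  have "C0 = {-q..q}"
  proof (intro Set.set_eqI iffI)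
    fix k assume k: "k \<in> {-q..q}"
    then have "k \<in> {\<bar>k\<bar>, - \<bar>k\<bar>}" "\<bar>k\<bar> \<in> {0..q}" by auto
    then show "k \<in> C0" unfolding C0 by blast
  qed (use C0 pq in auto)
  moreover have "\<exists>d \<in> components boxes. meets_first_column d \<and> x \<in> snd ` d" if "x \<in> {1..q}" for x
    using d pq p that by (intro bexI[of _ d]) simp_all
  ultimately show ?thesis using pq that[of q] by simp
next
  case False
  have "balanced 1"
  proof (rule ccontr)
    assume "\<not> balanced 1"
    then have "nonempty_column 1" by (simp add: nonempty_column_def)
    then show False using False component_exists by (metis meets_first_column_iff)
  qed
  moreover have "C0 = {0}" using False by (auto simp: C0_def)
  ultimately show ?thesis by (intro that[of 0]) auto
qed

lemma inner_columns:
  assumes d: "d \<in> inner"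
  obtains p q where "1 \<le> p" "p < q" "q \<le> int n" "snd ` d = {p+1..q}" "col d = {p..q}"
    "balanced p" "balanced (q + 1)" "\<And>x. x \<in> {p+1..q} \<Longrightarrow> \<not> balanced x"
proof -
  have d': "d \<in> components boxes" "\<not> meets_first_column d" using d by (auto simp: inner_components_def)
  obtain p q where pq: "0 \<le> p" "p < q" "q \<le> int n" "snd ` d = {p+1..q}" "col d = {p..q}"
    "p = 0 \<or> balanced p" "balanced (q + 1)" "\<And>x. x \<in> {p+1..q} \<Longrightarrow> nonempty_column x"
    using component_columns[OF d'(1)] by metis
  have "p \<noteq> 0" using d'(2) pq(1-4) by (auto simp: meets_first_column_iff)
  then show ?thesis using pq by (intro that[of p q]) (auto simp: nonempty_column_def)
qed

lemma finite_inner: "finite inner"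
  using finite_boxes by (auto simp: inner_components_def components_eq)

text \<open>Only the left end of \<open>{p..q}\<close> is balanced. A common index is therefore the
  left end of both intervals, in which case column \<open>p + 1\<close> is common, or it is a column
  with boxes in both components.\<close>

lemma disjoint_inner:
  assumes d: "d \<in> inner" "d' \<in> inner" and k: "k \<in> col d" "k \<in> col d'"
  shows "d = d'"
proof -
  obtain p q where pq: "snd ` d = {p+1..q}" "col d = {p..q}" "balanced p" "p < q"
    "\<And>x. x \<in> {p+1..q} \<Longrightarrow> \<not> balanced x"
    using inner_columns[OF d(1)] by metis
  obtain p' q' where pq': "snd ` d' = {p'+1..q'}" "col d' = {p'..q'}" "balanced p'" "p' < q'"
    "\<And>x. x \<in> {p'+1..q'} \<Longrightarrow> \<not> balanced x"
    using inner_columns[OF d(2)] by metis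
  have c: "d \<in> components boxes" "d' \<in> components boxes" using d by (auto simp: inner_components_def)
  consider "k = p" "k = p'" | "k \<in> {p+1..q}" "k \<in> {p'+1..q'}"
    using k pq pq' by fastforce
  then show ?thesis
  proof cases
    case 1
    then show ?thesis using component_unique[OF c, of "p + 1"] pq pq' by auto
  next
    case 2
    then show ?thesis using component_unique[OF c, of k] pq pq' by auto
  qed
qed

lemma disjoint_C0_inner: assumes d: "d \<in> inner" shows "C0 \<inter> Cd d = {}"
proof (rule ccontr)
  assume "\<not> ?thesis"
  then obtain k where k: "k \<in> C0" "\<bar>k\<bar> \<in> col d" by (auto simp: Cd_def)
  obtain m where m: "C0 = {-m..m}"
    "\<And>x. x \<in> {1..m} \<Longrightarrow> \<exists>d \<in> components boxes. meets_first_column d \<and> x \<in> snd ` d"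
    using first_component by metis
  obtain p q where pq: "1 \<le> p" "snd ` d = {p+1..q}" "col d = {p..q}" "balanced p"
    using inner_columns[OF d] by metis
  have "\<bar>k\<bar> \<in> {1..m}" using k m(1) pq by auto
  from m(2)[OF this] obtain d' where d': "d' \<in> components boxes" "meets_first_column d'" "\<bar>k\<bar> \<in> snd ` d'" by auto
  have "nonempty_column \<bar>k\<bar>" using d'(3) component_columns[OF d'(1)] by metis
  then have "\<bar>k\<bar> \<in> snd ` d" using k pq by (cases "\<bar>k\<bar> = p") (auto simp: nonempty_column_def)
  then have "d = d'" using component_unique d' d by (auto simp: inner_components_def)
  then show False using d d' by (auto simp: inner_components_def)
qed

text \<open>An index in \<open>Cphi\<close> is balanced together with its successor. Since
  \<open>p < q\<close>, for every \<open>k\<close> in \<open>{p..q}\<close> one of \<open>k\<close>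
  and \<open>k + 1\<close> lies in \<open>{p+1..q}\<close>, where nothing is balanced.\<close>

lemma disjoint_Cphi_inner: assumes d: "d \<in> inner" shows "Cphi \<inter> Cd d = {}"
proof (rule ccontr)
  assume "\<not> ?thesis"
  then obtain k where k: "k \<in> Cphi" "\<bar>k\<bar> \<in> col d" by (auto simp: Cd_def)
  obtain p q where pq: "col d = {p..q}" "p < q" "\<And>x. x \<in> {p+1..q} \<Longrightarrow> \<not> balanced x"
    using inner_columns[OF d] by metis
  have "\<bar>k\<bar> \<in> Cphi" using k(1) by (auto simp: Cphi_def)
  then have "balanced \<bar>k\<bar>" "balanced (\<bar>k\<bar> + 1)" using Cphi_balanced by auto
  then have "\<bar>k\<bar> \<notin> {p+1..q}" "\<bar>k\<bar> + 1 \<notin> {p+1..q}" using pq(3) by blast+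
  moreover have "\<bar>k\<bar> \<in> {p..q}" using k(2) pq(1) by simp
  ultimately show False using pq(2) unfolding atLeastAtMost_iff by arith
qed

lemma disjoint_Cphi_C0: "Cphi \<inter> C0 = {}"
proof (rule ccontr)
  assume "\<not> ?thesis"
  then obtain k where k: "k \<in> Cphi" "k \<in> C0" by auto
  obtain m where m: "C0 = {-m..m}"
    "\<And>x. x \<in> {1..m} \<Longrightarrow> \<exists>d \<in> components boxes. meets_first_column d \<and> x \<in> snd ` d"
    using first_component by metis
  have ak: "\<bar>k\<bar> \<in> Cphi" using k(1) by (auto simp: Cphi_def)
  have "k \<noteq> 0" using k(1) by (rule Cphi_balanced(3))
  then have "\<bar>k\<bar> \<in> {1..m}" using k(2) m(1) by auto
  from m(2)[OF this] have "nonempty_column \<bar>k\<bar>" using component_columns by metis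
  then show False using Cphi_balanced(1)[OF ak] by (auto simp: nonempty_column_def)
qed

text \<open>This is where the extra left column in \<open>col\<close> is used. If column
  \<open>\<bar>t\<bar>\<close> has boxes, it belongs to a component; if it is empty but the next one
  is not, it is the extra column of that component; if both are empty, \<open>t\<close> is in
  \<open>Cphi\<close>.\<close>

lemma blocks_cover:
  assumes t: "t \<in> {-int n..int n}"
  shows "t \<in> Cphi \<or> t \<in> C0 \<or> (\<exists>d\<in>inner. t \<in> Cd d)"
proof (cases "t = 0")
  case True
  then show ?thesis by (auto simp: C0_def)
next
  case False
  have in_comp: ?thesis if d: "d \<in> components boxes" and c: "\<bar>t\<bar> \<in> col d" for d
  proof (cases "meets_first_column d")
    case True
    then have "t \<in> C0" unfolding C0_def using d c by (cases "t \<ge> 0") force+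
    then show ?thesis by auto
  qed (use d c in \<open>auto simp: inner_components_def Cd_def\<close>)
  consider "\<not> balanced \<bar>t\<bar>" | "balanced \<bar>t\<bar>" "\<not> balanced (\<bar>t\<bar> + 1)" | "balanced \<bar>t\<bar>" "balanced (\<bar>t\<bar> + 1)" by auto
  then show ?thesis
  proof cases
    case 1
    then have "nonempty_column \<bar>t\<bar>" using False by (auto simp: nonempty_column_def)
    then obtain d where d: "d \<in> components boxes" "\<bar>t\<bar> \<in> snd ` d" by (rule component_exists)
    then show ?thesis using in_comp by (auto simp: col_def)
  next
    case 2
    then have "nonempty_column (\<bar>t\<bar> + 1)" by (auto simp: nonempty_column_def)
    then obtain d where d: "d \<in> components boxes" "\<bar>t\<bar> + 1 \<in> snd ` d" by (rule component_exists)
    obtain p q where pq: "snd ` d = {p+1..q}" "col d = {p..q}"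
      using component_columns[OF d(1)] by metis
    then show ?thesis using d by (intro in_comp[OF d(1)]) auto
  next
    case 3
    have "1 \<le> \<bar>t\<bar>" "\<bar>t\<bar> \<le> int n" using t False by auto
    then show ?thesis using balanced_Cphi 3 by blast
  qed
qed

end

section \<open>Coordinate subspaces\<close>

definition supp :: "int set \<Rightarrow> cvec set" where
  "supp J = {v. \<forall>i. i \<notin> J \<longrightarrow> v i = 0}"

definition trunc :: "int set \<Rightarrow> cvec \<Rightarrow> cvec" where
  "trunc J v = (\<lambda>i. if i \<in> J then v i else 0)"

lemma cscale_apply [simp]: "cscale c v i = c * v i"
  by (simp add: cscale_def)

lemma cvec_sum_apply: "(\<Sum>a\<in>A. f a) i = (\<Sum>a\<in>A. (f a :: cvec) i)"
  by (induction A rule: infinite_finite_induct) auto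

lemma trunc_apply [simp]: "trunc J v i = (if i \<in> J then v i else 0)"
  by (simp add: trunc_def)

lemma trunc_mem_supp [simp]: "trunc J v \<in> supp J"
  by (simp add: supp_def)

lemma trunc_trunc: "trunc A (trunc B v) = trunc (A \<inter> B) v"
  by (auto simp: trunc_def)

lemma trunc_supp: "v \<in> supp J \<Longrightarrow> J \<subseteq> J' \<Longrightarrow> trunc J' v = v"
  by (auto simp: trunc_def supp_def fun_eq_iff)

lemma trunc_disjoint: "v \<in> supp J \<Longrightarrow> J \<inter> J' = {} \<Longrightarrow> trunc J' v = 0"
  by (auto simp: trunc_def supp_def fun_eq_iff)

lemma trunc_add: "trunc J (u + v) = trunc J u + trunc J v"
  and trunc_cscale: "trunc J (cscale c v) = cscale c (trunc J v)"
  by (auto simp: fun_eq_iff)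

lemma trunc_Un: "A \<inter> B = {} \<Longrightarrow> trunc (A \<union> B) v = trunc A v + trunc B v"
  by (auto simp: fun_eq_iff)

lemma subspace_supp: "cv.subspace (supp J)"
  by (auto simp: cv.subspace_def supp_def)

lemma supp_mono: "J \<subseteq> J' \<Longrightarrow> supp J \<subseteq> supp J'"
  by (auto simp: supp_def)

lemma supp_Int: "supp J \<inter> supp J' = supp (J \<inter> J')"
  by (auto simp: supp_def)

lemma trunc_UN:
  assumes "finite I" "disjoint_family_on C I"
  shows "trunc (\<Union>i\<in>I. C i) v = (\<Sum>i\<in>I. trunc (C i) v)"
  using assms
proof (induction I rule: finite_induct)
  case empty
  then show ?case by (auto simp: fun_eq_iff)
next
  case (insert i I)
  have "C i \<inter> (\<Union>i\<in>I. C i) = {}" using insert.prems insert.hyps by (auto simp: disjoint_family_on_def)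
  moreover have "disjoint_family_on C I" using insert.prems by (auto simp: disjoint_family_on_def)
  ultimately show ?case
    using insert.IH by (simp only: UN_insert trunc_Un sum.insert[OF insert.hyps])
qed

lemma e_apply: "e k i = (if i = k then 1 else 0)"
  by (simp add: e_def)

lemma span_e:
  assumes "finite J"
  shows "cv.span (e ` J) = supp J"
proof
  show "cv.span (e ` J) \<subseteq> supp J"
    by (rule cv.span_minimal[OF _ subspace_supp]) (auto simp: supp_def e_apply)
  show "supp J \<subseteq> cv.span (e ` J)"
  proof
    fix v assume v: "v \<in> supp J"
    have "v i = (\<Sum>k\<in>J. cscale (v k) (e k)) i" for i
    proof -
      have "(\<Sum>k\<in>J. cscale (v k) (e k)) i = (\<Sum>k\<in>J. if k = i then v i else 0)"
        unfolding cvec_sum_apply by (rule sum.cong) (auto simp: e_apply)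
      also have "\<dots> = v i" using v assms by (simp add: supp_def)
      finally show ?thesis by simp
    qed
    then have "v = (\<Sum>k\<in>J. cscale (v k) (e k))" by (rule ext)
    then show "v \<in> cv.span (e ` J)"
      by (metis (no_types, lifting) cv.span_base cv.span_scale cv.span_sum image_eqI)
  qed
qed

lemma V_eq_supp: "V n = supp {-int n..int n}"
  by (simp add: V_def span_e)

text \<open>\<open>pivots H K\<close> says that evaluation on \<open>K\<close> is an isomorphism from \<open>H\<close> to the functions on \<open>K\<close>,
  which is the condition for the Pluecker coordinate \<open>K\<close> of \<open>H\<close> not to vanish.\<close>

definition separated :: "cvec set \<Rightarrow> int set \<Rightarrow> bool" where
  "separated H K \<longleftrightarrow> (\<forall>k\<in>K. \<exists>w\<in>H. \<forall>i\<in>K. w i = (if i = k then 1 else 0))"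

definition pivots :: "cvec set \<Rightarrow> int set \<Rightarrow> bool" where
  "pivots H K \<longleftrightarrow> finite K \<and> separated H K \<and> (\<forall>v\<in>H. (\<forall>k\<in>K. v k = 0) \<longrightarrow> v = 0)"

text \<open>Gaussian elimination: a column of \<open>C\<close> is added exactly when some vector of
  \<open>H\<close> vanishes on the columns chosen so far but not there. Starting from
  \<open>S\<close> allows pivots to be prescribed.\<close>

lemma separated_extend:
  assumes "finite C" and H: "cv.subspace H" and S: "finite S" "separated H S"
  shows "\<exists>K. S \<subseteq> K \<and> K \<subseteq> S \<union> C \<and> separated H K \<and> (\<forall>v\<in>H. (\<forall>k\<in>K. v k = 0) \<longrightarrow> (\<forall>i\<in>C. v i = 0))"
  using assms(1)
proof (induction C rule: finite_induct)
  case empty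
  then show ?case using S by blast
next
  case (insert c C)
  then obtain K where K: "S \<subseteq> K" "K \<subseteq> S \<union> C" "separated H K"
    "\<And>v. v \<in> H \<Longrightarrow> (\<forall>k\<in>K. v k = 0) \<Longrightarrow> (\<forall>i\<in>C. v i = 0)" by blast
  show ?case
  proof (cases "\<exists>w\<in>H. (\<forall>k\<in>K. w k = 0) \<and> w c \<noteq> 0")
    case False
    then have "\<forall>i\<in>insert c C. v i = 0" if "v \<in> H" "\<forall>k\<in>K. v k = 0" for v
      using K(4)[OF that] that by auto
    then show ?thesis using K(1-3) by (intro exI[of _ K]) blast
  next
    case True
    then obtain w0 where w0: "w0 \<in> H" "\<forall>k\<in>K. w0 k = 0" "w0 c \<noteq> 0" by blast
    define w where "w = cscale (1 / w0 c) w0"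
    have w: "w \<in> H" "\<forall>k\<in>K. w k = 0" "w c = 1"
      using w0 H by (auto simp: w_def cv.subspace_def)
    have cK: "c \<notin> K" using w by auto
    have "separated H (insert c K)"
      unfolding separated_def
    proof
      fix k assume "k \<in> insert c K"
      then consider "k = c" | "k \<in> K" "k \<noteq> c" by auto
      then show "\<exists>w\<in>H. \<forall>i\<in>insert c K. w i = (if i = k then 1 else 0)"
      proof cases
        case 1
        then show ?thesis using w cK by (intro bexI[of _ w]) auto
      next
        case 2
        then obtain u where u: "u \<in> H" "\<forall>i\<in>K. u i = (if i = k then 1 else 0)"
          using K(3) by (auto simp: separated_def)
        \<comment> \<open>\<open>w\<close> vanishes on \<open>K\<close> and is \<open>1\<close> at
          \<open>c\<close>, so the correction clears the entry at \<open>c\<close> and keeps the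
          entries on \<open>K\<close>.\<close>
        have "u - cscale (u c) w \<in> H" using u w H by (meson cv.subspace_diff cv.subspace_scale)
        then show ?thesis using u w 2 by (intro bexI[of _ "u - cscale (u c) w"]) auto
      qed
    qed
    moreover have "\<forall>i\<in>insert c C. v i = 0" if "v \<in> H" "\<forall>k\<in>insert c K. v k = 0" for v
      using K(4)[OF that(1)] that(2) by auto
    ultimately show ?thesis using K(1,2) by (intro exI[of _ "insert c K"]) blast
  qed
qed

lemma pivots_extend:
  assumes "finite N" "cv.subspace H" "H \<subseteq> supp N" "S \<subseteq> N" "separated H S"
  obtains K where "S \<subseteq> K" "K \<subseteq> N" "pivots H K"
proof -
  obtain K where K: "S \<subseteq> K" "K \<subseteq> S \<union> N" "separated H K"
    "\<And>v. v \<in> H \<Longrightarrow> (\<forall>k\<in>K. v k = 0) \<Longrightarrow> (\<forall>i\<in>N. v i = 0)"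
    using separated_extend[OF assms(1,2) finite_subset[OF assms(4,1)] assms(5)] by blast
  have KN: "K \<subseteq> N" using K(2) assms(4) by auto
  have "v = 0" if "v \<in> H" "\<forall>k\<in>K. v k = 0" for v
  proof
    fix i show "v i = 0 i" using K(4)[OF that] that(1) assms(3) by (cases "i \<in> N") (auto simp: supp_def)
  qed
  then have "pivots H K" using K(3) finite_subset[OF KN assms(1)] by (auto simp: pivots_def)
  then show ?thesis using that K(1) KN by blast
qed

lemma pivots_exist:
  assumes "finite N" "cv.subspace H" "H \<subseteq> supp N"
  obtains K where "K \<subseteq> N" "pivots H K"
  using pivots_extend[OF assms, of "{}"] by (auto simp: separated_def)

text \<open>The basis is dual to the evaluations at \<open>K\<close>. A vector minus the combination
  with its own entries as coefficients vanishes on \<open>K\<close>, hence is zero.\<close>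

lemma pivots_basis:
  assumes H: "cv.subspace H" and K: "pivots H K"
  obtains w where "\<And>k i. k \<in> K \<Longrightarrow> i \<in> K \<Longrightarrow> w k i = (if i = k then 1 else 0)"
    "inj_on w K" "cv.independent (w ` K)" "cv.span (w ` K) = H"
    "\<And>v. v \<in> H \<Longrightarrow> v = (\<Sum>k\<in>K. cscale (v k) (w k))"
proof -
  have fin: "finite K" using K by (auto simp: pivots_def)
  obtain w where w: "\<And>k. k \<in> K \<Longrightarrow> w k \<in> H" "\<And>k i. k \<in> K \<Longrightarrow> i \<in> K \<Longrightarrow> w k i = (if i = k then 1 else 0)"
    using K unfolding pivots_def separated_def by metis
  have ev: "(\<Sum>k\<in>K. cscale (c k) (w k)) i = c i" if "i \<in> K" for c i
  proof -
    have "(\<Sum>k\<in>K. cscale (c k) (w k)) i = (\<Sum>k\<in>K. if k = i then c i else 0)"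
      unfolding cvec_sum_apply by (rule sum.cong) (use w(2) that in auto)
    then show ?thesis using that fin by simp
  qed
  have inj: "inj_on w K"
  proof (rule inj_onI)
    fix k l assume kl: "k \<in> K" "l \<in> K" "w k = w l"
    then have "w l k = 1" using w(2)[OF kl(1,1)] by simp
    then show "k = l" using w(2)[OF kl(2,1)] by (simp split: if_splits)
  qed
  have ind: "cv.independent (w ` K)"
  proof (rule cv.independent_if_scalars_zero)
    fix f x assume z: "(\<Sum>x\<in>w ` K. cscale (f x) x) = 0" and x: "x \<in> w ` K"
    then obtain k where k: "k \<in> K" "x = w k" by auto
    have "(\<Sum>k\<in>K. cscale (f (w k)) (w k)) = 0" using z by (simp add: sum.reindex[OF inj])
    then show "f x = 0" using ev[of k "\<lambda>k. f (w k)"] k by simp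
  qed (use fin in auto)
  have rep: "v = (\<Sum>k\<in>K. cscale (v k) (w k))" if v: "v \<in> H" for v
  proof -
    let ?u = "v - (\<Sum>k\<in>K. cscale (v k) (w k))"
    have "?u \<in> H" using v w(1) H by (intro cv.subspace_diff cv.subspace_sum cv.subspace_scale) auto
    moreover have "\<forall>k\<in>K. ?u k = 0" using ev by (simp)
    ultimately have "?u = 0" using K by (auto simp: pivots_def)
    then show ?thesis by simp
  qed
  have "cv.span (w ` K) = H"
  proof
    show "cv.span (w ` K) \<subseteq> H" using w(1) H by (intro cv.span_minimal) auto
    show "H \<subseteq> cv.span (w ` K)"
    proof
      fix v assume "v \<in> H"
      from rep[OF this] show "v \<in> cv.span (w ` K)"
        by (metis (no_types, lifting) cv.span_base cv.span_scale cv.span_sum image_eqI)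
    qed
  qed
  then show ?thesis using that[OF w(2) inj ind _ rep] by blast
qed

section \<open>Dimension counts\<close>

lemma pivots_dim:
  assumes "cv.subspace H" "pivots H K"
  shows "cv.dim H = card K"
proof -
  obtain w where "inj_on w K" "cv.independent (w ` K)" "cv.span (w ` K) = H"
    using pivots_basis[OF assms] by metis
  then show ?thesis using cv.dim_span_eq_card_independent card_image by metis
qed

lemma separated_card_le:
  assumes "finite N" "cv.subspace H" "H \<subseteq> supp N" "S \<subseteq> N" "separated H S"
  shows "card S \<le> cv.dim H"
proof -
  obtain K where "S \<subseteq> K" "pivots H K" using pivots_extend[OF assms] by metis
  then show ?thesis using pivots_dim[OF assms(2)] by (simp add: card_mono pivots_def)
qed

lemma separated_mono: "separated H S \<Longrightarrow> H \<subseteq> H' \<Longrightarrow> separated H' S"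
  unfolding separated_def by blast

lemma dim_mono:
  assumes "finite N" "cv.subspace H" "cv.subspace H'" "H \<subseteq> H'" "H' \<subseteq> supp N"
  shows "cv.dim H \<le> cv.dim H'"
proof -
  obtain K where K: "K \<subseteq> N" "pivots H K" using pivots_exist[OF assms(1,2)] assms by blast
  then have "separated H' K" using assms(4) separated_mono by (auto simp: pivots_def)
  from separated_card_le[OF assms(1,3,5) K(1) this] show ?thesis using pivots_dim[OF assms(2) K(2)] by simp
qed

text \<open>Pivots of \<open>H\<close> extend to pivots of \<open>H'\<close>, and equal dimension
  leaves no room for new ones. A vector of \<open>H'\<close> then agrees on the common pivots, which
  determine it, with a vector of \<open>H\<close>.\<close>

lemma dim_eq_subset:
  assumes "finite N" "cv.subspace H" "cv.subspace H'" "H \<subseteq> H'" "H' \<subseteq> supp N" "cv.dim H' \<le> cv.dim H"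
  shows "H = H'"
proof
  obtain K where K: "K \<subseteq> N" "pivots H K" using pivots_exist[OF assms(1,2)] assms by blast
  then have "separated H' K" using assms(4) separated_mono by (auto simp: pivots_def)
  then obtain K' where K': "K \<subseteq> K'" "pivots H' K'" using pivots_extend[OF assms(1,3,5) K(1)] by metis
  then have "card K' \<le> card K" using pivots_dim assms K by metis
  then have "K = K'" using K' card_seteq by (auto simp: pivots_def)
  with K' have p': "pivots H' K" by simp
  obtain w where w: "\<And>k i. k \<in> K \<Longrightarrow> i \<in> K \<Longrightarrow> w k i = (if i = k then 1 else 0)" "cv.span (w ` K) = H"
    using pivots_basis[OF assms(2) K(2)] by metis
  show "H' \<subseteq> H"
  proof
    fix v assume v: "v \<in> H'"
    let ?u = "\<Sum>k\<in>K. cscale (v k) (w k)"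
    have u: "?u \<in> H" unfolding w(2)[symmetric]
      by (intro cv.span_sum cv.span_scale cv.span_base) auto
    have "(v - ?u) i = 0" if "i \<in> K" for i
    proof -
      have "?u i = (\<Sum>k\<in>K. if k = i then v i else 0)"
        unfolding cvec_sum_apply by (rule sum.cong) (use w(1) that in auto)
      then show ?thesis using that K(2) by (simp add: pivots_def)
    qed
    moreover have "v - ?u \<in> H'" using v u assms(3,4) by (intro cv.subspace_diff) auto
    ultimately have "v - ?u = 0" using p' unfolding pivots_def by blast
    then show "v \<in> H" using u by simp
  qed
qed (rule assms(4))

lemma dim_le_if_injective:
  assumes "finite T" "cv.subspace H" "\<And>v. v \<in> H \<Longrightarrow> (\<forall>i\<in>T. v i = 0) \<Longrightarrow> v = 0"
  shows "cv.dim H \<le> card T"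
proof -
  obtain K where K: "K \<subseteq> T" "separated H K"
    "\<And>v. v \<in> H \<Longrightarrow> (\<forall>k\<in>K. v k = 0) \<Longrightarrow> (\<forall>i\<in>T. v i = 0)"
    using separated_extend[OF assms(1,2), of "{}"] by (auto simp: separated_def)
  then have "pivots H K" using assms finite_subset[OF K(1)] unfolding pivots_def by blast
  then have "cv.dim H = card K" using pivots_dim assms by blast
  then show ?thesis using card_mono[OF assms(1) K(1)] by simp
qed

lemma pivots_exist_Int:
  assumes "finite N" "cv.subspace H" "H \<subseteq> supp N"
  obtains K where "K \<subseteq> N \<inter> A" "pivots (H \<inter> supp A) K"
proof (rule pivots_exist)
  show "finite (N \<inter> A)" using assms(1) by simp
  show "cv.subspace (H \<inter> supp A)" using assms(2) subspace_supp by (rule cv.subspace_inter)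
  show "H \<inter> supp A \<subseteq> supp (N \<inter> A)" using assms(3) unfolding supp_Int[symmetric] by blast
qed

text \<open>Dual vectors for the pivots of one part vanish on the pivots of the other, so the union
  of both pivot sets is separated.\<close>

lemma dim_add_le:
  assumes "finite N" "cv.subspace H" "H \<subseteq> supp N" and AB: "A \<inter> B = {}"
  shows "cv.dim (H \<inter> supp A) + cv.dim (H \<inter> supp B) \<le> cv.dim (H \<inter> supp (A \<union> B))"
proof -
  have s: "cv.subspace (H \<inter> supp J)" for J using assms(2) subspace_supp by (rule cv.subspace_inter)
  obtain K where K: "K \<subseteq> N \<inter> A" "pivots (H \<inter> supp A) K"
    using pivots_exist_Int[OF assms(1-3)] by blast
  obtain L where L: "L \<subseteq> N \<inter> B" "pivots (H \<inter> supp B) L"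
    using pivots_exist_Int[OF assms(1-3)] by blast
  have KL: "K \<inter> L = {}" using K L AB by auto
  have "separated (H \<inter> supp (A \<union> B)) (K \<union> L)"
    unfolding separated_def
  proof
    fix k assume "k \<in> K \<union> L"
    then show "\<exists>w\<in>H \<inter> supp (A \<union> B). \<forall>i\<in>K \<union> L. w i = (if i = k then 1 else 0)"
    proof
      assume k: "k \<in> K"
      then obtain w where w: "w \<in> H \<inter> supp A" "\<forall>i\<in>K. w i = (if i = k then 1 else 0)"
        using K(2) unfolding pivots_def separated_def by blast
      then show ?thesis using L(1) AB KL k by (intro bexI[of _ w]) (auto simp: supp_def)
    next
      assume k: "k \<in> L"
      then obtain w where w: "w \<in> H \<inter> supp B" "\<forall>i\<in>L. w i = (if i = k then 1 else 0)"
        using L(2) unfolding pivots_def separated_def by blast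
      then show ?thesis using K(1) AB KL k by (intro bexI[of _ w]) (auto simp: supp_def)
    qed
  qed
  from separated_card_le[OF assms(1) s _ _ this] have "card (K \<union> L) \<le> cv.dim (H \<inter> supp (A \<union> B))"
    using assms(3) K(1) L(1) by blast
  moreover have "card (K \<union> L) = card K + card L"
    using KL K(2) L(2) by (auto simp: pivots_def card_Un_disjoint)
  ultimately show ?thesis using pivots_dim[OF s K(2)] pivots_dim[OF s L(2)] by simp
qed

lemma dim_add_eq:
  assumes "finite N" "cv.subspace H" "H \<subseteq> supp N" and AB: "A \<inter> B = {}"
    and tr: "\<And>v. v \<in> H \<Longrightarrow> trunc A v \<in> H"
  shows "cv.dim (H \<inter> supp (A \<union> B)) = cv.dim (H \<inter> supp A) + cv.dim (H \<inter> supp B)"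
proof (rule antisym)
  have s: "cv.subspace (H \<inter> supp J)" for J using assms(2) subspace_supp by (rule cv.subspace_inter)
  obtain K where K: "K \<subseteq> N \<inter> A" "pivots (H \<inter> supp A) K"
    using pivots_exist_Int[OF assms(1-3)] by blast
  obtain L where L: "L \<subseteq> N \<inter> B" "pivots (H \<inter> supp B) L"
    using pivots_exist_Int[OF assms(1-3)] by blast
  have fin: "finite K" "finite L" using K L by (auto simp: pivots_def)
  have "cv.dim (H \<inter> supp (A \<union> B)) \<le> card (K \<union> L)"
  proof (rule dim_le_if_injective)
    fix v assume v: "v \<in> H \<inter> supp (A \<union> B)" "\<forall>i\<in>K \<union> L. v i = 0"
    have a: "trunc A v \<in> H \<inter> supp A" using tr v by auto
    then have "trunc A v = 0" using K(2) v(2) unfolding pivots_def by fastforce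
    moreover have "trunc (A \<union> B) v = v" using v by (intro trunc_supp) auto
    ultimately have vb: "v = trunc B v" using trunc_Un[OF AB, of v] by simp
    then have "v \<in> H \<inter> supp B" using v by (metis IntD1 IntI trunc_mem_supp)
    then show "v = 0" using L(2) v(2) unfolding pivots_def by blast
  qed (use s fin in auto)
  also have "card (K \<union> L) \<le> card K + card L" by (rule card_Un_le)
  finally show "cv.dim (H \<inter> supp (A \<union> B)) \<le> cv.dim (H \<inter> supp A) + cv.dim (H \<inter> supp B)"
    using pivots_dim[OF s K(2)] pivots_dim[OF s L(2)] by simp
qed (rule dim_add_le[OF assms(1-4)])

text \<open>The sum of the two parts of \<open>H\<close> has at least the dimension of
  \<open>H\<close>, hence is \<open>H\<close>. The two summands of a vector are then its
  truncations.\<close>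

lemma trunc_closed_if_dim:
  assumes "finite N" "cv.subspace H" "H \<subseteq> supp N" and AB: "A \<inter> B = {}"
    and d: "cv.dim H \<le> cv.dim (H \<inter> supp A) + cv.dim (H \<inter> supp B)" and v: "v \<in> H"
  shows "trunc A v \<in> H" "trunc B v \<in> H" "v \<in> supp (A \<union> B)"
proof -
  have s: "cv.subspace (H \<inter> supp J)" for J using assms(2) subspace_supp by (rule cv.subspace_inter)
  let ?S = "{x + y |x y. x \<in> H \<inter> supp A \<and> y \<in> H \<inter> supp B}"
  have S: "cv.subspace ?S" by (rule cv.subspace_sums[OF s s])
  have 0: "0 \<in> H" "0 \<in> supp J" for J using assms(2) subspace_supp cv.subspace_0 by blast+
  \<comment> \<open>\<open>dim_add_le\<close> is to be applied to the sum itself, so its parts have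
    to be recognised as those of \<open>H\<close>.\<close>
  have eqA: "?S \<inter> supp A = H \<inter> supp A"
  proof
    show "H \<inter> supp A \<subseteq> ?S \<inter> supp A"
    proof
      fix x assume "x \<in> H \<inter> supp A"
      moreover have "x = x + 0" by simp
      ultimately show "x \<in> ?S \<inter> supp A" using 0 by blast
    qed
    show "?S \<inter> supp A \<subseteq> H \<inter> supp A" using assms(2) by (auto intro: cv.subspace_add)
  qed
  have eqB: "?S \<inter> supp B = H \<inter> supp B"
  proof
    show "H \<inter> supp B \<subseteq> ?S \<inter> supp B"
    proof
      fix x assume "x \<in> H \<inter> supp B"
      moreover have "x = 0 + x" by simp
      ultimately show "x \<in> ?S \<inter> supp B" using 0 by blast
    qed
    show "?S \<inter> supp B \<subseteq> H \<inter> supp B" using assms(2) by (auto intro: cv.subspace_add)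
  qed
  have sub: "?S \<subseteq> H" using assms(2) by (auto intro: cv.subspace_add)
  have "cv.dim H \<le> cv.dim (?S \<inter> supp (A \<union> B))"
    using dim_add_le[OF assms(1) S _ AB] sub assms(3) d unfolding eqA eqB by force
  moreover have "cv.dim (?S \<inter> supp (A \<union> B)) \<le> cv.dim ?S"
    using S subspace_supp sub assms(3) by (intro dim_mono[OF assms(1)] cv.subspace_inter) auto
  ultimately have "?S = H" using dim_eq_subset[OF assms(1) S assms(2) sub assms(3)] by linarith
  with v obtain x y where xy: "v = x + y" "x \<in> H" "x \<in> supp A" "y \<in> H" "y \<in> supp B" by blast
  have "trunc A x = x" "trunc A y = 0" "trunc B x = 0" "trunc B y = y"
    using xy AB by (auto intro: trunc_supp trunc_disjoint)
  then show "trunc A v \<in> H" "trunc B v \<in> H" using xy by (simp_all add: trunc_add)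
  show "v \<in> supp (A \<union> B)" using xy by (auto simp: supp_def)
qed

section \<open>Isotropic subspaces and block sums\<close>

lemma beta_add_left: "beta n (u + u') v = beta n u v + beta n u' v"
  and beta_add_right: "beta n u (v + v') = beta n u v + beta n u v'"
  by (auto simp: beta_def algebra_simps sum.distrib)

lemma beta_sym: "beta n u v = beta n v u"
  unfolding beta_def by (rule sum.reindex_bij_witness[of _ uminus uminus]) auto

lemma beta_supp_zero:
  assumes "u \<in> supp A" "v \<in> supp B" "\<And>i. i \<in> A \<Longrightarrow> - i \<notin> B"
  shows "beta n u v = 0"
  unfolding beta_def
proof (rule sum.neutral, rule ballI)
  fix i show "u i * v (- i) = 0" using assms by (cases "i \<in> A") (auto simp: supp_def)
qed

text \<open>The leading positions of the vectors of an isotropic subspace contain no pair \<open>i\<close>, \<open>-i\<close>.\<close>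

lemma isotropic_dim_le:
  assumes H: "cv.subspace H" "H \<subseteq> V n" "isotropic n H"
  shows "cv.dim H \<le> n"
proof -
  define T where "T = {t\<in>{-int n..int n}. \<exists>w\<in>H. w t \<noteq> 0 \<and> (\<forall>i<t. w i = 0)}"
  have finT: "finite T" by (rule finite_subset[of _ "{-int n..int n}"]) (auto simp: T_def)
  have "cv.dim H \<le> card T"
  proof (rule dim_le_if_injective)
    fix v assume v: "v \<in> H" "\<forall>i\<in>T. v i = 0"
    show "v = 0"
    proof (rule ccontr)
      assume "v \<noteq> 0"
      then obtain j where j: "v j \<noteq> 0" by (auto simp: fun_eq_iff)
      have vs: "v i = 0" if "i \<notin> {-int n..int n}" for i
        using that v(1) H(2) by (auto simp: V_eq_supp supp_def)
      let ?S = "{i\<in>{-int n..int n}. v i \<noteq> 0}"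
      have fin: "finite ?S" by (rule finite_subset[of _ "{-int n..int n}"]) auto
      have "j \<in> ?S" using j vs[of j] by blast
      then have ne: "?S \<noteq> {}" by blast
      define m where "m = Min ?S"
      have m: "m \<in> ?S" using Min_in[OF fin ne] by (simp add: m_def)
      have "v i = 0" if "i < m" for i
        using that Min_le[OF fin, of i] vs[of i] unfolding m_def by force
      then have "m \<in> T" using m v(1) by (auto simp: T_def)
      then show False using v(2) m by auto
    qed
  qed (use H finT in auto)
  moreover have disj: "- t \<notin> T" if "t \<in> T" for t
  proof
    assume "- t \<in> T"
    with that obtain w u where w: "w \<in> H" "w t \<noteq> 0" "\<forall>i<t. w i = 0" and u: "u \<in> H" "u (-t) \<noteq> 0" "\<forall>i. i < -t \<longrightarrow> u i = 0"
      and t: "t \<in> {-int n..int n}" by (auto simp: T_def)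
    have "beta n w u = (\<Sum>i = -int n..int n. if i = t then w t * u (-t) else 0)"
      unfolding beta_def
    proof (rule sum.cong)
      fix i
      consider "i < t" | "i = t" | "-i < -t" by linarith
      then show "w i * u (-i) = (if i = t then w t * u (-t) else 0)" using w u by cases auto
    qed simp
    also have "\<dots> = w t * u (-t)" using t by simp
    finally show False using w u H(3) by (auto simp: isotropic_def)
  qed
  moreover have "card T \<le> n"
  proof -
    \<comment> \<open>The case \<open>t = 0\<close> of \<open>disj\<close> excludes \<open>0\<close>
      from \<open>T\<close>. The count gives \<open>2 * card T \<le> 2 * n + 1\<close>, and parity
      does the rest.\<close>
    have "card (T \<union> uminus ` T) \<le> card {-int n..int n}"
      by (intro card_mono) (auto simp: T_def)
    moreover have "card (T \<union> uminus ` T) = card T + card (uminus ` T)"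
      using finT disj by (intro card_Un_disjoint) auto
    moreover have "card (uminus ` T) = card T" by (intro card_image) auto
    ultimately show ?thesis by simp
  qed
  ultimately show ?thesis by simp
qed

text \<open>With disjoint supports the components of a vector are its truncations, so membership in
  the sum can be tested block by block.\<close>

lemma span_UN_supp:
  assumes I: "finite I" "disjoint_family_on C I"
    and A: "\<And>i. i \<in> I \<Longrightarrow> cv.subspace (A i) \<and> A i \<subseteq> supp (C i)"
  shows "cv.span (\<Union>i\<in>I. A i) = {v \<in> supp (\<Union>i\<in>I. C i). \<forall>i\<in>I. trunc (C i) v \<in> A i}" (is "_ = ?R")
proof
  have sub: "cv.subspace ?R"
    unfolding cv.subspace_def
  proof (intro conjI ballI allI)
    have "trunc J 0 = 0" for J by (auto simp: fun_eq_iff)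
    then show "0 \<in> ?R" using A cv.subspace_0 subspace_supp by simp
  next
    fix x y assume "x \<in> ?R" "y \<in> ?R"
    then show "x + y \<in> ?R" using A subspace_supp by (auto simp: trunc_add intro!: cv.subspace_add)
  next
    fix c x assume "x \<in> ?R"
    then show "cscale c x \<in> ?R" using A subspace_supp by (auto simp: trunc_cscale intro!: cv.subspace_scale)
  qed
  have "A i \<subseteq> ?R" if i: "i \<in> I" for i
  proof
    fix v assume v: "v \<in> A i"
    then have vs: "v \<in> supp (C i)" using A i by auto
    have "trunc (C j) v \<in> A j" if j: "j \<in> I" for j
    proof (cases "j = i")
      case True
      then show ?thesis using vs v trunc_supp by simp
    next
      case False
      then have "C i \<inter> C j = {}" using I(2) i j by (auto simp: disjoint_family_on_def)
      then have "trunc (C j) v = 0" using trunc_disjoint vs by blast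
      then show ?thesis using A[OF j] cv.subspace_0 by auto
    qed
    then show "v \<in> ?R" using vs i supp_mono[of "C i" "\<Union>i\<in>I. C i"] by auto
  qed
  then show "cv.span (\<Union>i\<in>I. A i) \<subseteq> ?R" using sub by (intro cv.span_minimal) auto
  show "?R \<subseteq> cv.span (\<Union>i\<in>I. A i)"
  proof
    fix v assume v: "v \<in> ?R"
    then have "v = (\<Sum>i\<in>I. trunc (C i) v)"
      using trunc_UN[OF I] trunc_supp by (metis (no_types, lifting) mem_Collect_eq order_refl)
    moreover have "(\<Sum>i\<in>I. trunc (C i) v) \<in> cv.span (\<Union>i\<in>I. A i)"
      using v by (intro cv.span_sum cv.span_base) auto
    ultimately show "v \<in> cv.span (\<Union>i\<in>I. A i)" by simp
  qed
qed

section \<open>Splitting at balanced positions\<close>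

lemma beta_trunc:
  assumes "C \<subseteq> {-int n..int n}" "\<And>k. k \<in> C \<Longrightarrow> - k \<in> C"
  shows "beta n (trunc C u) (trunc C v) = (\<Sum>k\<in>C. u k * v (- k))"
proof -
  have "beta n (trunc C u) (trunc C v) = (\<Sum>k\<in>{-int n..int n}. if k \<in> C then u k * v (- k) else 0)"
    unfolding beta_def using assms(2) by (intro sum.cong) auto
  also have "\<dots> = (\<Sum>k\<in>{-int n..int n} \<inter> C. u k * v (- k))" by (rule sum.inter_restrict[symmetric]) simp
  also have "{-int n..int n} \<inter> C = C" using assms(1) by auto
  finally show ?thesis .
qed

lemma BnD:
  assumes "H \<in> Bn n"
  shows "cv.subspace H" "H \<subseteq> supp {-int n..int n}" "cv.dim H = n" "isotropic n H"
  using assms by (auto simp: Bn_def V_eq_supp)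

context sy_pair
begin

abbreviation "N \<equiv> {-int n..int n}"
abbreviation "X \<equiv> Xs n mu \<inter> Xs' n la"

text \<open>The conditions are spread from the entries to all positions, so that both families can
  be compared at a single \<open>t\<close>. At \<open>t\<close> one uses the last entry of
  \<open>mu\<close> that is \<open>\<ge> t\<close>, respectively the first entry of
  \<open>la\<close> that is \<open>< t\<close>.\<close>

lemma X_iff:
  "H \<in> X \<longleftrightarrow> H \<in> Bn n \<and> (\<forall>t. cnt n mu t \<le> cv.dim (H \<inter> supp {t..int n})) \<and>
     (\<forall>t. n \<le> cnt n la t + cv.dim (H \<inter> supp {-int n..t - 1}))" (is "_ \<longleftrightarrow> ?R")
proof
  assume H: "H \<in> X"
  then have B: "H \<in> Bn n" by (auto simp: Xs_def)
  have s: "cv.subspace (H \<inter> supp J)" for J using BnD(1)[OF B] subspace_supp by (rule cv.subspace_inter)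
  have m: "cv.dim (H \<inter> supp J) \<le> cv.dim (H \<inter> supp J')" if "J \<subseteq> J'" for J J'
    using s supp_mono[OF that] BnD(2)[OF B] by (intro dim_mono[where N=N]) auto
  have "cnt n mu t \<le> cv.dim (H \<inter> supp {t..int n})" for t
  proof (cases "cnt n mu t = 0")
    case False
    define j where "j = cnt n mu t"
    have j: "j \<in> {1..n}" using False cnt_le[of n mu t] by (auto simp: j_def)
    have "t \<le> mu j" using SY_cnt_iff[OF mu j, of t] by (simp add: j_def)
    then have "cv.dim (H \<inter> supp {mu j..int n}) \<le> cv.dim (H \<inter> supp {t..int n})" by (intro m) auto
    moreover have "j \<le> cv.dim (H \<inter> supp {mu j..int n})"
      using H j by (auto simp: Xs_def span_e)
    ultimately show ?thesis by (simp add: j_def)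
  qed simp
  moreover have "n \<le> cnt n la t + cv.dim (H \<inter> supp {-int n..t - 1})" for t
  proof (cases "n \<le> cnt n la t")
    case False
    define j where "j = cnt n la t + 1"
    have j: "j \<in> {1..n}" using False by (auto simp: j_def)
    have "\<not> t \<le> la j" using SY_cnt_iff[OF la j, of t] by (simp add: j_def)
    then have "cv.dim (H \<inter> supp {-int n..la j}) \<le> cv.dim (H \<inter> supp {-int n..t - 1})" by (intro m) auto
    moreover have "n + 1 - j \<le> cv.dim (H \<inter> supp {-int n..la j})"
      using H j by (auto simp: Xs'_def span_e)
    ultimately show ?thesis by (simp add: j_def)
  qed simp
  ultimately show ?R using B by blast
next
  assume R: ?R
  have "j \<le> cv.dim (H \<inter> supp {mu j..int n})" "n + 1 - j \<le> cv.dim (H \<inter> supp {-int n..la j})"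
    if j: "j \<in> {1..n}" for j
  proof -
    have "cnt n mu (mu j) \<le> cv.dim (H \<inter> supp {mu j..int n})" using R by blast
    then show "j \<le> cv.dim (H \<inter> supp {mu j..int n})" using cnt_at[OF mu j] by simp
    have "n \<le> cnt n la (la j + 1) + cv.dim (H \<inter> supp {-int n..la j + 1 - 1})" using R by blast
    then have "n \<le> (j - 1) + cv.dim (H \<inter> supp {-int n..la j})"
      by (simp only: cnt_after[OF la j] add_diff_cancel_right')
    then show "n + 1 - j \<le> cv.dim (H \<inter> supp {-int n..la j})" using j unfolding atLeastAtMost_iff by linarith
  qed
  then show "H \<in> X" using R by (auto simp: Xs_def Xs'_def span_e)
qed

lemma X_D:
  assumes "H \<in> X"
  shows "H \<in> Bn n" "cv.subspace H" "H \<subseteq> supp N" "cv.dim H = n" "isotropic n H"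
    "cnt n mu t \<le> cv.dim (H \<inter> supp {t..int n})"
    "n \<le> cnt n la t + cv.dim (H \<inter> supp {-int n..t - 1})"
  using assms BnD[of H n] unfolding X_iff by blast+

text \<open>The lower bounds for the two sides add up to \<open>n\<close>, the dimension of
  \<open>H\<close>, so both are equalities. These exact dimensions are what \<open>mix_X\<close>
  subtracts.\<close>

lemma X_cut:
  assumes H: "H \<in> X" and b: "balanced t"
  shows "v \<in> H \<Longrightarrow> trunc {t..int n} v \<in> H" "v \<in> H \<Longrightarrow> trunc {-int n..t - 1} v \<in> H"
    "cv.dim (H \<inter> supp {t..int n}) = cnt n mu t"
    "cnt n la t + cv.dim (H \<inter> supp {-int n..t - 1}) = n"
proof -
  note HD = X_D(2-4)[OF H] and d = X_D(6,7)[OF H, of t]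
  have fin: "finite N" by simp
  have disj: "{t..int n} \<inter> {-int n..t - 1} = {}" by auto
  have c: "cnt n mu t = cnt n la t" using b by (simp add: balanced_def)
  have le: "cv.dim H \<le> cv.dim (H \<inter> supp {t..int n}) + cv.dim (H \<inter> supp {-int n..t - 1})"
    using d HD(3) c by linarith
  show "trunc {t..int n} v \<in> H" "trunc {-int n..t - 1} v \<in> H" if "v \<in> H"
    using trunc_closed_if_dim[OF fin HD(1,2) disj le that] by auto
  have "cv.dim (H \<inter> supp ({t..int n} \<union> {-int n..t - 1})) \<le> cv.dim H"
    using HD subspace_supp by (intro dim_mono[OF fin] cv.subspace_inter) auto
  with dim_add_le[OF fin HD(1,2) disj]
  have "cv.dim (H \<inter> supp {t..int n}) + cv.dim (H \<inter> supp {-int n..t - 1}) \<le> n"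
    using HD(3) by linarith
  then show "cv.dim (H \<inter> supp {t..int n}) = cnt n mu t"
    "cnt n la t + cv.dim (H \<inter> supp {-int n..t - 1}) = n"
    using d c by linarith+
qed

lemma X_trunc_interval:
  assumes H: "H \<in> X" and b: "balanced p" "balanced (q + 1)" and pq: "- int n \<le> p" "q \<le> int n" and v: "v \<in> H"
  shows "trunc {p..q} v \<in> H"
proof -
  have "trunc {-int n..q + 1 - 1} (trunc {p..int n} v) \<in> H"
    using X_cut(1)[OF H b(1) v] X_cut(2)[OF H b(2)] by blast
  moreover have "{-int n..q + 1 - 1} \<inter> {p..int n} = {p..q}" using pq by auto
  ultimately show ?thesis by (simp only: trunc_trunc)
qed

text \<open>Unions of intervals between balanced positions. The pointwise form needs no enumeration
  of the intervals and is obviously stable under unions.\<close>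

definition cut_set :: "int set \<Rightarrow> bool" where
  "cut_set C \<longleftrightarrow> C \<subseteq> N \<and>
     (\<forall>t\<in>C. \<exists>p q. p \<le> t \<and> t \<le> q \<and> balanced p \<and> balanced (q + 1) \<and> {p..q} \<subseteq> C)"

lemma X_trunc:
  assumes H: "H \<in> X" and C: "cut_set C" and v: "v \<in> H"
  shows "trunc C v \<in> H"
proof -
  obtain p q where pq: "\<And>t. t \<in> C \<Longrightarrow> p t \<le> t \<and> t \<le> q t \<and> balanced (p t) \<and> balanced (q t + 1) \<and> {p t..q t} \<subseteq> C"
    using C unfolding cut_set_def by metis
  have CN: "C \<subseteq> N" using C by (simp add: cut_set_def)
  have iv: "trunc {p t..q t} v \<in> H" if t: "t \<in> C" and v: "v \<in> H" for t v
  proof -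
    have "p t \<in> C" "q t \<in> C" using pq[OF t] by auto
    then have "- int n \<le> p t" "q t \<le> int n" using CN by auto
    then show ?thesis using X_trunc_interval[OF H _ _ _ _ v] pq[OF t] by blast
  qed
  have un: "trunc (\<Union>t\<in>T. {p t..q t}) v \<in> H" if "finite T" "T \<subseteq> C" "v \<in> H" for T v
    using that
  proof (induction T arbitrary: v rule: finite_induct)
    case empty
    have "trunc {} v = 0" by (auto simp: fun_eq_iff)
    then show ?case using cv.subspace_0[OF X_D(2)[OF H]] by (simp only: UN_empty)
  next
    case (insert t T)
    let ?A = "{p t..q t}" and ?B = "\<Union>t\<in>T. {p t..q t}"
    have tT: "t \<in> C" "T \<subseteq> C" using insert.prems(1) by auto
    have A: "trunc ?A v \<in> H" by (rule iv[OF tT(1) insert.prems(2)])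
    have B: "trunc ?B v \<in> H" and AB: "trunc ?B (trunc ?A v) \<in> H"
      by (rule insert.IH[OF tT(2) insert.prems(2)], rule insert.IH[OF tT(2) A])
    \<comment> \<open>The intervals chosen for different points may overlap; inclusion-exclusion
      removes what is counted twice.\<close>
    have "trunc (?A \<union> ?B) v = trunc ?A v + trunc ?B v - trunc ?B (trunc ?A v)" by (auto simp: fun_eq_iff)
    also have "\<dots> \<in> H" using A B AB X_D(2)[OF H] by (intro cv.subspace_diff cv.subspace_add) 
    finally show ?case by (simp only: UN_insert)
  qed
  have "(\<Union>t\<in>C. {p t..q t}) = C" using pq by fastforce
  then show ?thesis using un[of C v] v finite_subset[OF CN] by simp
qed

lemma cut_set_Un: "cut_set A \<Longrightarrow> cut_set B \<Longrightarrow> cut_set (A \<union> B)"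
  unfolding cut_set_def by (meson Un_iff le_supI1 le_supI2 le_sup_iff)

lemma cut_set_interval:
  assumes "balanced p" "balanced (q + 1)" "- int n \<le> p" "q \<le> int n"
  shows "cut_set {p..q}"
  unfolding cut_set_def
proof (intro conjI ballI)
  show "{p..q} \<subseteq> N" using assms by auto
  fix t assume "t \<in> {p..q}"
  then show "\<exists>p' q'. p' \<le> t \<and> t \<le> q' \<and> balanced p' \<and> balanced (q' + 1) \<and> {p'..q'} \<subseteq> {p..q}"
    using assms(1,2) by (intro exI[of _ p] exI[of _ q]) auto
qed

lemma cut_set_Cphi: "cut_set Cphi"
  unfolding cut_set_def
proof (intro conjI ballI)
  show "Cphi \<subseteq> N" using Cphi_balanced(4) by blast
  fix t assume t: "t \<in> Cphi"
  show "\<exists>p q. p \<le> t \<and> t \<le> q \<and> balanced p \<and> balanced (q + 1) \<and> {p..q} \<subseteq> Cphi"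
    using t Cphi_balanced(1,2)[OF t] by (intro exI[of _ t]) auto
qed

text \<open>A single interval across \<open>0\<close>, whose cuts \<open>-m\<close> and
  \<open>m + 1\<close> are reflections of each other.\<close>

lemma cut_set_C0: "cut_set C0"
proof -
  obtain m where m: "0 \<le> m" "m \<le> int n" "C0 = {-m..m}" "balanced (m + 1)" using first_component by metis
  have "balanced (-m)" using balanced_reflect[of "m + 1"] m(4) by simp
  then show ?thesis unfolding m(3) by (intro cut_set_interval) (use m in auto)
qed

text \<open>Reflection sends the cuts \<open>p\<close> and \<open>q + 1\<close> to
  \<open>1 - p\<close> and \<open>- q\<close>, the cuts of the mirrored interval. Both halves are
  treated separately because the part for \<open>d\<close> is defined by its plus and minus
  halves.\<close>

lemma cut_set_col: assumes "d \<in> inner" shows "cut_set (col d)" "cut_set (uminus ` col d)"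
proof -
  obtain p q where pq: "1 \<le> p" "q \<le> int n" "p < q" "col d = {p..q}" "balanced p" "balanced (q + 1)"
    using inner_columns[OF assms] by metis
  show "cut_set (col d)" unfolding pq(4) by (intro cut_set_interval) (use pq in auto)
  have "balanced (-q)" "balanced (-p + 1)"
    using balanced_reflect[of "q + 1"] balanced_reflect[of p] pq by (simp_all add: algebra_simps)
  then have "cut_set {-q..-p}" by (intro cut_set_interval) (use pq in auto)
  then show "cut_set (uminus ` col d)" unfolding pq(4) by simp
qed

lemma Cd_eq: "d \<in> inner \<Longrightarrow> Cd d = col d \<union> uminus ` col d"
proof -
  assume d: "d \<in> inner"
  obtain p q where pq: "1 \<le> p" "col d = {p..q}"
    using inner_columns[OF d] by metis
  show ?thesis unfolding Cd_def pq(2) using pq(1) by auto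
qed

lemma col_disjoint: assumes d: "d \<in> inner" shows "col d \<inter> uminus ` col d = {}"
proof -
  obtain p q where pq: "1 \<le> p" "col d = {p..q}"
    using inner_columns[OF d] by metis
  show ?thesis unfolding pq(2) using pq(1) by auto
qed

lemma cut_set_Cd: "d \<in> inner \<Longrightarrow> cut_set (Cd d)"
  by (simp add: Cd_eq cut_set_Un cut_set_col)

text \<open>One index type for all orthogonal summands, so that spans, sums and products run over
  one finite set. \<open>Inl True\<close> stands for \<open>V0\<close>, \<open>Inl False\<close> for
  the part fixed by \<open>mu\<close> and \<open>la\<close>.\<close>

definition block :: "bool + (nat \<times> int) set \<Rightarrow> int set" where
  "block = case_sum (\<lambda>b. if b then C0 else Cphi) Cd"

definition blocks :: "(bool + (nat \<times> int) set) set" where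
  "blocks = UNIV <+> inner"

lemma block_simps [simp]: "block (Inl True) = C0" "block (Inl False) = Cphi" "block (Inr d) = Cd d"
  by (simp_all add: block_def)

lemma finite_blocks: "finite blocks"
  by (simp add: blocks_def finite_inner)

lemma blocks_cases:
  assumes "i \<in> blocks"
  obtains "i = Inl True" | "i = Inl False" | d where "i = Inr d" "d \<in> inner"
proof (cases i)
  case (Inl b)
  then show ?thesis using that(1,2) by (cases b) auto
next
  case (Inr d)
  then show ?thesis using that(3)[of d] assms by (auto simp: blocks_def)
qed

lemma cut_set_block: assumes "i \<in> blocks" shows "cut_set (block i)"
  using assms by (rule blocks_cases) (auto simp: cut_set_C0 cut_set_Cphi cut_set_Cd)

lemma block_sym: assumes "i \<in> blocks" "k \<in> block i" shows "- k \<in> block i"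
  using assms(1)
proof (rule blocks_cases)
  assume i: "i = Inl True"
  obtain m where "C0 = {-m..m}" using first_component by metis
  then show ?thesis using assms(2) i by auto
qed (use assms(2) in \<open>auto simp: Cphi_def Cd_def\<close>)

lemma disjoint_Cd: "d \<in> inner \<Longrightarrow> d' \<in> inner \<Longrightarrow> d \<noteq> d' \<Longrightarrow> Cd d \<inter> Cd d' = {}"
  using disjoint_inner by (auto simp: Cd_def)

lemma disjoint_blocks: "disjoint_family_on block blocks"
  unfolding disjoint_family_on_def
proof (intro ballI impI)
  fix i j assume "i \<in> blocks" "j \<in> blocks" "i \<noteq> j"
  then show "block i \<inter> block j = {}"
    using disjoint_C0_inner disjoint_Cphi_inner disjoint_Cphi_C0 disjoint_Cd
    by (elim blocks_cases) (simp_all add: Int_commute)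
qed

lemma UN_blocks: "(\<Union>i\<in>blocks. block i) = N"
proof
  show "(\<Union>i\<in>blocks. block i) \<subseteq> N" using cut_set_block unfolding cut_set_def by blast
  have members: "Inl b \<in> blocks" "d \<in> inner \<Longrightarrow> Inr d \<in> blocks" for b d
    by (auto simp: blocks_def)
  show "N \<subseteq> (\<Union>i\<in>blocks. block i)"
  proof
    fix t assume "t \<in> N"
    then consider "t \<in> block (Inl False)" | "t \<in> block (Inl True)" | d where "d \<in> inner" "t \<in> block (Inr d)"
      using blocks_cover by auto
    then show "t \<in> (\<Union>i\<in>blocks. block i)" using members by cases blast+
  qed
qed

text \<open>\<open>beta\<close> pairs \<open>k\<close> with \<open>- k\<close>, and every block is
  closed under negation, so distinct blocks are orthogonal.\<close>

lemma beta_blocks: "beta n u v = (\<Sum>i\<in>blocks. beta n (trunc (block i) u) (trunc (block i) v))"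
proof -
  have finb: "finite (block i)" if "i \<in> blocks" for i
    using cut_set_block[OF that] finite_subset unfolding cut_set_def by blast
  have "beta n u v = (\<Sum>k\<in>(\<Union>i\<in>blocks. block i). u k * v (- k))" by (simp add: beta_def UN_blocks)
  also have "\<dots> = (\<Sum>i\<in>blocks. \<Sum>k\<in>block i. u k * v (- k))"
    using finite_blocks finb disjoint_blocks by (intro sum.UNION_disjoint) (auto simp: disjoint_family_on_def)
  also have "\<dots> = (\<Sum>i\<in>blocks. beta n (trunc (block i) u) (trunc (block i) v))"
    using cut_set_block block_sym by (intro sum.cong refl beta_trunc[symmetric]) (auto simp: cut_set_def)
  finally show ?thesis .
qed

section \<open>Recombining parts of different subspaces\<close>

definition mix :: "(bool + (nat \<times> int) set \<Rightarrow> cvec set) \<Rightarrow> cvec set" where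
  "mix Hs = cv.span (\<Union>i\<in>blocks. Hs i \<inter> supp (block i))"

lemma mix_eq:
  assumes "\<And>i. i \<in> blocks \<Longrightarrow> cv.subspace (Hs i)"
  shows "mix Hs = {v \<in> supp N. \<forall>i\<in>blocks. trunc (block i) v \<in> Hs i}"
  unfolding mix_def
  by (subst span_UN_supp[OF finite_blocks disjoint_blocks])
    (auto simp: UN_blocks assms subspace_supp cv.subspace_inter)

text \<open>Isotropy holds block by block. Let \<open>t\<close> lie in an interval
  \<open>{p..q}\<close> of block \<open>i\<close> between balanced positions. Since
  \<open>Hs i\<close> has exact dimension at \<open>q + 1\<close>, its part in \<open>{t..q}\<close>
  has dimension at least \<open>cnt n mu t - cnt n mu (q + 1)\<close>; this part lies in the
  mixture, and the bound at \<open>q + 1\<close> is known by induction. The conditions for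
  \<open>la\<close> are obtained from the other end, using \<open>p\<close>. Dimension
  \<open>n\<close> follows from the condition at \<open>-n\<close> and the bound for isotropic
  subspaces.\<close>

lemma mix_X:
  assumes Hs: "\<And>i. i \<in> blocks \<Longrightarrow> Hs i \<in> X"
  shows "mix Hs \<in> X"
proof -
  let ?H = "mix Hs"
  have eq: "?H = {v \<in> supp N. \<forall>i\<in>blocks. trunc (block i) v \<in> Hs i}"
    using Hs X_D(2) by (intro mix_eq) blast
  have sub: "cv.subspace ?H" by (simp add: mix_def)
  have fin: "finite N" by simp
  have HN: "?H \<subseteq> supp N" by (auto simp: eq)
  have s: "cv.subspace (G \<inter> supp J)" if "cv.subspace G" for G J
    using that subspace_supp by (rule cv.subspace_inter)
  have iso: "isotropic n ?H"
    unfolding isotropic_def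
  proof (intro ballI)
    fix u v assume uv: "u \<in> ?H" "v \<in> ?H"
    have "beta n u v = (\<Sum>i\<in>blocks. beta n (trunc (block i) u) (trunc (block i) v))"
      by (rule beta_blocks)
    also have "\<dots> = 0"
      using X_D(5)[OF Hs] uv by (intro sum.neutral) (auto simp: isotropic_def eq)
    finally show "beta n u v = 0" .
  qed
  have in_H: "Hs i \<inter> supp J \<subseteq> ?H" if i: "i \<in> blocks" and J: "J \<subseteq> block i" for i J
  proof
    fix v assume v: "v \<in> Hs i \<inter> supp J"
    then have "v \<in> Hs i \<inter> supp (block i)" using supp_mono[OF J] by auto
    then show "v \<in> ?H" unfolding mix_def using i by (intro cv.span_base) blast
  qed
  have interval: "\<exists>p q i. i \<in> blocks \<and> p \<le> t \<and> t \<le> q \<and> balanced p \<and> balanced (q + 1) \<and> {p..q} \<subseteq> block i \<and>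
      - int n \<le> p \<and> q \<le> int n" if t: "t \<in> N" for t
  proof -
    obtain i where i: "i \<in> blocks" "t \<in> block i" using t UN_blocks by blast
    obtain p q where pq: "p \<le> t" "t \<le> q" "balanced p" "balanced (q + 1)" "{p..q} \<subseteq> block i" "block i \<subseteq> N"
      using cut_set_block[OF i(1)] i(2) unfolding cut_set_def by blast
    then have "p \<in> N" "q \<in> N" by (meson atLeastAtMost_iff order_refl order_trans subsetD)+
    then show ?thesis using i pq by auto
  qed
  have lower: "cnt n mu t \<le> cv.dim (?H \<inter> supp {t..int n})" if "- int n \<le> t" for t
    using that
  proof (induction "nat (int n + 1 - t)" arbitrary: t rule: less_induct)
    case less
    show ?case
    proof (cases "t \<le> int n")
      case False
      then have "cnt n mu t = 0" using cnt_antimono[of "int n + 1" t n mu] cnt_top[OF mu] by simp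
      then show ?thesis by simp
    next
      case True
      then obtain p q i where i: "i \<in> blocks" and pq: "p \<le> t" "t \<le> q" "balanced p" "balanced (q + 1)"
        "{p..q} \<subseteq> block i" "- int n \<le> p" "q \<le> int n"
        using interval[of t] less.prems by auto
      have IH: "cnt n mu (q + 1) \<le> cv.dim (?H \<inter> supp {q + 1..int n})"
        using pq True less.prems by (intro less.hyps) auto
      let ?A = "{t..q}" and ?B = "{q + 1..int n}"
      have AB: "?A \<inter> ?B = {}" "?B \<inter> ?A = {}" and U: "?A \<union> ?B = {t..int n}" "?B \<union> ?A = {t..int n}"
        using pq by auto
      note G = X_D[OF Hs[OF i]]
      have sA: "Hs i \<inter> supp ?A \<subseteq> ?H" using pq by (intro in_H[OF i]) auto
      have "cnt n mu t \<le> cv.dim (Hs i \<inter> supp {t..int n})" by (rule G(6))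
      also have "\<dots> = cv.dim (Hs i \<inter> supp ?B) + cv.dim (Hs i \<inter> supp ?A)"
        using dim_add_eq[OF fin G(2,3) AB(2) X_cut(1)[OF Hs[OF i] pq(4)]] U by simp
      \<comment> \<open>An equality is needed here, since this term is to be removed from an upper
        bound for \<open>cnt n mu t\<close>. It holds because \<open>q + 1\<close> is
        balanced.\<close>
      also have "cv.dim (Hs i \<inter> supp ?B) = cnt n mu (q + 1)" by (rule X_cut(3)[OF Hs[OF i] pq(4)])
      also have "cv.dim (Hs i \<inter> supp ?A) \<le> cv.dim (?H \<inter> supp ?A)"
        using sA HN by (intro dim_mono[OF fin] s sub G(2)) auto
      finally show ?thesis using IH dim_add_le[OF fin sub HN AB(1)] U by simp
    qed
  qed
  \<comment> \<open>Shifted by one against \<open>X_iff\<close>, so that the induction runs over the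
    right end of \<open>{-int n..t}\<close>.\<close>
  have upper: "n \<le> cnt n la (t + 1) + cv.dim (?H \<inter> supp {-int n..t})" if "t \<le> int n" for t
    using that
  proof (induction "nat (t + int n + 1)" arbitrary: t rule: less_induct)
    case less
    show ?case
    proof (cases "- int n \<le> t")
      case False
      then have "cnt n la (t + 1) = n" by (intro cnt_bot[OF la]) simp
      then show ?thesis by simp
    next
      case True
      then obtain p q i where i: "i \<in> blocks" and pq: "p \<le> t" "t \<le> q" "balanced p" "balanced (q + 1)"
        "{p..q} \<subseteq> block i" "- int n \<le> p" "q \<le> int n"
        using interval[of t] less.prems by auto
      have IH: "n \<le> cnt n la (p - 1 + 1) + cv.dim (?H \<inter> supp {-int n..p - 1})"
        using pq True less.prems by (intro less.hyps) auto
      let ?A = "{p..t}" and ?B = "{-int n..p - 1}"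
      have AB: "?A \<inter> ?B = {}" "?B \<inter> ?A = {}" and U: "?A \<union> ?B = {-int n..t}" "?B \<union> ?A = {-int n..t}"
        using pq by auto
      note G = X_D[OF Hs[OF i]]
      have sA: "Hs i \<inter> supp ?A \<subseteq> ?H" using pq by (intro in_H[OF i]) auto
      have "n \<le> cnt n la (t + 1) + cv.dim (Hs i \<inter> supp {-int n..t + 1 - 1})" by (rule G(7))
      moreover have "cv.dim (Hs i \<inter> supp {-int n..t}) = cv.dim (Hs i \<inter> supp ?B) + cv.dim (Hs i \<inter> supp ?A)"
        using dim_add_eq[OF fin G(2,3) AB(2) X_cut(2)[OF Hs[OF i] pq(3)]] U by simp
      moreover have "cnt n la p + cv.dim (Hs i \<inter> supp ?B) = n" by (rule X_cut(4)[OF Hs[OF i] pq(3)])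
      moreover have "cv.dim (Hs i \<inter> supp ?A) \<le> cv.dim (?H \<inter> supp ?A)"
        using sA HN by (intro dim_mono[OF fin] s sub G(2)) auto
      moreover have "cv.dim (?H \<inter> supp ?A) + cv.dim (?H \<inter> supp ?B) \<le> cv.dim (?H \<inter> supp {-int n..t})"
        using dim_add_le[OF fin sub HN AB(1)] U by simp
      ultimately show ?thesis using IH by simp
    qed
  qed
  have "?H \<inter> supp N = ?H" using HN by auto
  then have "n \<le> cv.dim ?H" using lower[of "- int n"] cnt_bot[OF mu, of "- int n"] by simp
  moreover have "cv.dim ?H \<le> n" using sub HN iso by (intro isotropic_dim_le) (simp_all add: V_eq_supp)
  ultimately have dim: "cv.dim ?H = n" by simp
  have "cnt n mu t \<le> cv.dim (?H \<inter> supp {t..int n})" for t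
  proof (cases "- int n \<le> t")
    case False
    then have "?H \<inter> supp {t..int n} = ?H" using HN supp_mono[of N "{t..int n}"] by auto
    then show ?thesis using dim cnt_le by simp
  qed (rule lower)
  moreover have "n \<le> cnt n la t + cv.dim (?H \<inter> supp {-int n..t - 1})" for t
  proof (cases "t - 1 \<le> int n")
    case False
    then have "?H \<inter> supp {-int n..t - 1} = ?H" using HN supp_mono[of N "{-int n..t - 1}"] by auto
    then show ?thesis using dim by simp
  qed (use upper[of "t - 1"] in simp)
  ultimately show ?thesis using sub HN iso dim unfolding X_iff by (simp add: Bn_def V_eq_supp)
qed

section \<open>The parts of a member of the intersection\<close>

text \<open>If an isotropic \<open>G\<close> in \<open>supp C\<close> contains the part, then
  \<open>H + G\<close> is still isotropic. Its dimension is at most \<open>n\<close>, that of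
  \<open>H\<close>, so \<open>G\<close> is contained in \<open>H\<close>.\<close>

lemma X_piece_maximal:
  assumes H: "H \<in> X" and C: "cut_set C" and sym: "\<And>k. k \<in> C \<Longrightarrow> - k \<in> C"
  shows "H \<inter> supp C \<in> max_isotropic n (supp C)"
  unfolding max_isotropic_def
proof (intro CollectI conjI allI impI)
  note HD = X_D[OF H]
  show "cv.subspace (H \<inter> supp C)" using HD(2) subspace_supp by (rule cv.subspace_inter)
  show "isotropic n (H \<inter> supp C)" using HD(5) by (auto simp: isotropic_def)
  fix G assume G: "cv.subspace G \<and> G \<subseteq> supp C \<and> isotropic n G \<and> H \<inter> supp C \<subseteq> G"
  have CN: "C \<subseteq> N" using C by (simp add: cut_set_def)
  let ?S = "{x + y |x y. x \<in> H \<and> y \<in> G}"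
  have 0: "0 \<in> H" "0 \<in> G" using HD(2) G cv.subspace_0 by blast+
  have HS: "H \<subseteq> ?S"
  proof
    fix x assume "x \<in> H"
    moreover have "x = x + 0" by simp
    ultimately show "x \<in> ?S" using 0 by blast
  qed
  have GS: "G \<subseteq> ?S"
  proof
    fix x assume "x \<in> G"
    moreover have "x = 0 + x" by simp
    ultimately show "x \<in> ?S" using 0 by blast
  qed
  have S: "cv.subspace ?S" using HD(2) G by (intro cv.subspace_sums) auto
  have SN: "?S \<subseteq> supp N"
    using HD(3) G supp_mono[OF CN] by (auto intro!: cv.subspace_add[OF subspace_supp])
  \<comment> \<open>The truncation of \<open>x\<close> to \<open>C\<close> lies in the part of
    \<open>H\<close>, hence in \<open>G\<close>. The rest of \<open>x\<close> has no index opposite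
    to an index in \<open>C\<close>.\<close>
  have HG: "beta n x y = 0" if x: "x \<in> H" and y: "y \<in> G" for x y
  proof -
    have "trunc C x \<in> G" using X_trunc[OF H C x] G by auto
    then have "beta n (trunc C x) y = 0" using G y by (auto simp: isotropic_def)
    moreover have "beta n (trunc (- C) x) y = 0"
      using y G sym by (intro beta_supp_zero[of _ "- C" _ C]) fastforce+
    moreover have "x = trunc C x + trunc (- C) x" by (auto simp: fun_eq_iff)
    ultimately show ?thesis using beta_add_left[of n "trunc C x" "trunc (- C) x" y] by simp
  qed
  have "isotropic n ?S"
    unfolding isotropic_def
  proof (intro ballI)
    fix u v assume "u \<in> ?S" "v \<in> ?S"
    then obtain x y x' y' where uv: "u = x + y" "v = x' + y'" "x \<in> H" "y \<in> G" "x' \<in> H" "y' \<in> G" by blast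
    have "beta n y x' = 0" using HG uv beta_sym by metis
    moreover have "beta n x x' = 0" using HD(5) uv by (auto simp: isotropic_def)
    moreover have "beta n y y' = 0" using G uv by (auto simp: isotropic_def)
    ultimately show "beta n u v = 0" using HG uv by (simp add: beta_add_left beta_add_right)
  qed
  then have "cv.dim ?S \<le> cv.dim H" using S SN isotropic_dim_le[of ?S n] HD(4) by (simp add: V_eq_supp)
  then have eq: "?S = H"
    by (intro dim_eq_subset[OF _ HD(2) S HS SN, symmetric]) auto
  have "G \<subseteq> H" using GS unfolding eq .
  then show "G = H \<inter> supp C" using G by blast
qed auto

lemma V0_eq: "V0 n la mu = supp C0"
proof -
  have "insert (e 0) (\<Union>d \<in> {d \<in> components boxes. meets_first_column d}. \<Union>k \<in> col d. {e k, e (-k)}) = e ` C0"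
    unfolding C0_def by blast
  moreover have "finite C0" using first_component by (metis finite_atLeastAtMost_int)
  ultimately show ?thesis unfolding V0_def by (simp add: span_e)
qed

lemma Vplus_eq: "d \<in> inner \<Longrightarrow> Vplus d = supp (col d)"
  unfolding Vplus_def using inner_columns by (metis finite_atLeastAtMost_int span_e)

lemma Vminus_eq: assumes "d \<in> inner" shows "Vminus d = supp (uminus ` col d)"
proof -
  have "finite (col d)" using inner_columns[OF assms] by (metis finite_atLeastAtMost_int)
  then show ?thesis unfolding Vminus_def using span_e[of "uminus ` col d"] by (simp add: image_image)
qed

lemma Vd_eq: assumes d: "d \<in> inner" shows "Vd d = supp (Cd d)"
proof
  show "Vd d \<subseteq> supp (Cd d)"
    unfolding Vd_def Vplus_eq[OF d] Vminus_eq[OF d] Cd_eq[OF d]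
    using supp_mono[of "col d" "col d \<union> uminus ` col d"] supp_mono[of "uminus ` col d" "col d \<union> uminus ` col d"]
    by (intro cv.span_minimal subspace_supp) auto
  show "supp (Cd d) \<subseteq> Vd d"
  proof
    fix v assume "v \<in> supp (Cd d)"
    then have "v = trunc (col d) v + trunc (uminus ` col d) v"
      using trunc_Un[OF col_disjoint[OF d], of v] trunc_supp[of v "Cd d" "Cd d"] by (simp add: Cd_eq[OF d])
    also have "\<dots> \<in> Vd d"
      unfolding Vd_def Vplus_eq[OF d] Vminus_eq[OF d] by (intro cv.span_add cv.span_base) auto
    finally show "v \<in> Vd d" .
  qed
qed

lemma H0_part_eq: "H0_part n la mu H = H \<inter> supp C0"
  by (simp add: H0_part_def V0_eq)

text \<open>\<open>col d\<close> and its mirror image are both cut sets, so a vector of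
  \<open>H\<close> supported on \<open>Cd d\<close> splits into two vectors of \<open>H\<close>, one
  in each half.\<close>

lemma Hd_part_eq:
  assumes H: "H \<in> X" and d: "d \<in> inner"
  shows "Hd_part d H = H \<inter> supp (Cd d)"
proof
  have "cv.subspace (H \<inter> supp (Cd d))" using X_D(2)[OF H] subspace_supp by (rule cv.subspace_inter)
  then show "Hd_part d H \<subseteq> H \<inter> supp (Cd d)"
    unfolding Hd_part_def Vplus_eq[OF d] Vminus_eq[OF d] Cd_eq[OF d]
    using supp_mono[of "col d" "col d \<union> uminus ` col d"] supp_mono[of "uminus ` col d" "col d \<union> uminus ` col d"]
    by (intro cv.span_minimal) auto
  show "H \<inter> supp (Cd d) \<subseteq> Hd_part d H"
  proof
    fix v assume v: "v \<in> H \<inter> supp (Cd d)"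
    then have "v = trunc (col d) v + trunc (uminus ` col d) v"
      using trunc_Un[OF col_disjoint[OF d], of v] trunc_supp[of v "Cd d" "Cd d"] by (simp add: Cd_eq[OF d])
    also have "\<dots> \<in> Hd_part d H"
      unfolding Hd_part_def Vplus_eq[OF d] Vminus_eq[OF d]
      using v X_trunc[OF H] cut_set_col[OF d] by (intro cv.span_add cv.span_base) auto
    finally show "v \<in> Hd_part d H" .
  qed
qed

text \<open>The exact dimension drops between the balanced positions \<open>k\<close> and
  \<open>k + 1\<close>, so some vector of \<open>H\<close> has a nonzero entry at \<open>k\<close>.
  Cutting on both sides of \<open>k\<close> leaves a multiple of \<open>e k\<close>.\<close>

lemma X_contains_fixed:
  assumes H: "H \<in> X" and j: "j \<in> {1..n}" "mu j = la j"
  shows "e (la j) \<in> H"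
proof -
  define k where "k = la j"
  have b: "balanced k" "balanced (k + 1)" using fixed_balanced[OF j] by (auto simp: k_def)
  have c: "cnt n mu k = j" "cnt n mu (k + 1) = j - 1" using cnt_at[OF mu j(1)] cnt_after[OF mu j(1)] j by (auto simp: k_def)
  have "\<exists>v\<in>H \<inter> supp {k..int n}. v k \<noteq> 0"
  proof (rule ccontr)
    assume a: "\<not> ?thesis"
    have "H \<inter> supp {k..int n} \<subseteq> H \<inter> supp {k + 1..int n}"
    proof
      fix v assume v: "v \<in> H \<inter> supp {k..int n}"
      then have "v k = 0" using a by blast
      then have "v i = 0" if "i \<notin> {k + 1..int n}" for i
        using v that by (cases "i = k") (auto simp: supp_def)
      then show "v \<in> H \<inter> supp {k + 1..int n}" using v by (auto simp: supp_def)
    qed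
    then have "cv.dim (H \<inter> supp {k..int n}) \<le> cv.dim (H \<inter> supp {k + 1..int n})"
      using X_D(2,3)[OF H] subspace_supp by (intro dim_mono[of N] cv.subspace_inter) auto
    then show False using X_cut(3)[OF H b(1)] X_cut(3)[OF H b(2)] c j by auto
  qed
  then obtain v where v: "v \<in> H" "v k \<noteq> 0" by blast
  have "trunc {k..k} v \<in> H"
    using X_trunc_interval[OF H b _ _ v(1)] SY_bounds[OF la j(1)] by (simp add: k_def)
  then have "cscale (1 / v k) (trunc {k..k} v) \<in> H" using X_D(2)[OF H] by (rule cv.subspace_scale[rotated])
  moreover have "cscale (1 / v k) (trunc {k..k} v) = e k" using v(2) by (auto simp: fun_eq_iff e_apply)
  ultimately show ?thesis by (simp add: k_def)
qed

lemma Hphi_eq_supp: "Hphi n la mu = supp {la j | j. j \<in> {1..n} \<and> mu j = la j}"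
proof -
  let ?K = "{la j | j. j \<in> {1..n} \<and> mu j = la j}"
  have "{e (mu j) | j. j \<in> {1..n} \<and> mu j = la j} = e ` ?K" by force
  moreover have "finite ?K" by simp
  ultimately show ?thesis by (simp add: Hphi_def span_e)
qed

text \<open>Derived from the distinct absolute values of the entries, without any member of
  \<open>X\<close>: it is used for points of the product that need not come from one.\<close>

lemma Hphi_isotropic: "isotropic n (Hphi n la mu)"
  unfolding isotropic_def
proof (intro ballI)
  fix u v assume uv: "u \<in> Hphi n la mu" "v \<in> Hphi n la mu"
  show "beta n u v = 0"
  proof (rule beta_supp_zero[OF uv[unfolded Hphi_eq_supp]])
    fix i assume "i \<in> {la j | j. j \<in> {1..n} \<and> mu j = la j}"
    then obtain j where j: "j \<in> {1..n}" "i = la j" by blast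
    show "- i \<notin> {la j | j. j \<in> {1..n} \<and> mu j = la j}"
    proof
      assume "- i \<in> {la j | j. j \<in> {1..n} \<and> mu j = la j}"
      then obtain k where k: "k \<in> {1..n}" "- i = la k" by blast
      have "(\<lambda>j. \<bar>la j\<bar>) ` {1..n} = {1..int n}" using la by (auto simp: SY_def)
      then have inj: "inj_on (\<lambda>j. \<bar>la j\<bar>) {1..n}" by (intro eq_card_imp_inj_on) auto
      have "\<bar>la j\<bar> = \<bar>la k\<bar>" using j(2) k(2) by linarith
      then have "j = k" using inj_onD[OF inj _ j(1) k(1)] by blast
      then show False using j(2) k(2) SY_bounds(3)[OF la j(1)] by simp
    qed
  qed
qed

text \<open>Besides the indices \<open>la j\<close>, the block \<open>Cphi\<close> contains only
  their negatives. Pairing with \<open>e (la j)\<close>, which lies in \<open>H\<close>, kills the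
  entries there.\<close>

lemma Hphi_eq:
  assumes H: "H \<in> X"
  shows "Hphi n la mu = H \<inter> supp Cphi"
proof -
  let ?K = "{la j | j. j \<in> {1..n} \<and> mu j = la j}"
  have "finite ?K" by simp
  have "Hphi n la mu = supp ?K" by (rule Hphi_eq_supp)
  also have "\<dots> = H \<inter> supp Cphi"
  proof
    have "e ` ?K \<subseteq> H" using X_contains_fixed[OF H] by auto
    then have "cv.span (e ` ?K) \<subseteq> H" by (rule cv.span_minimal[OF _ X_D(2)[OF H]])
    then have "supp ?K \<subseteq> H" unfolding span_e[OF \<open>finite ?K\<close>] .
    moreover have "?K \<subseteq> Cphi" by (auto simp: Cphi_def)
    ultimately show "supp ?K \<subseteq> H \<inter> supp Cphi" using supp_mono by blast
    show "H \<inter> supp Cphi \<subseteq> supp ?K"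
    proof
      fix v assume v: "v \<in> H \<inter> supp Cphi"
      have "v i = 0" if i: "i \<notin> ?K" for i
      proof (cases "i \<in> Cphi")
        case True
        then obtain j where j: "j \<in> {1..n}" "mu j = la j" "\<bar>i\<bar> = \<bar>la j\<bar>" by (auto simp: Cphi_def)
        then have "i \<noteq> la j" using i by blast
        then have ij: "i = - la j" using j(3) by linarith
        have "beta n v (e (la j)) = 0" using X_contains_fixed[OF H j(1,2)] X_D(5)[OF H] v by (auto simp: isotropic_def)
        moreover have "beta n v (e (la j)) = (\<Sum>k\<in>N. if k = i then v i else 0)"
          unfolding beta_def by (rule sum.cong) (auto simp: e_apply ij)
        moreover have "i \<in> N" using True Cphi_balanced(4) by blast
        ultimately show ?thesis by simp
      qed (use v in \<open>auto simp: supp_def\<close>)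
      then show "v \<in> supp ?K" by (auto simp: supp_def)
    qed
  qed
  finally show ?thesis .
qed

end

section \<open>Pluecker coordinates\<close>

text \<open>Minors for an ordered list of columns. In a direct sum the natural order is block after
  block rather than increasing.\<close>

definition mdet :: "cvec list \<Rightarrow> int list \<Rightarrow> complex" where
  "mdet vs cs = det (mat (length vs) (length vs) (\<lambda>(a, b). (vs ! a) (cs ! b)))"

lemma minor_at_eq: "minor_at vs K = (if card K = length vs then mdet vs (sorted_list_of_set K) else 0)"
  by (simp add: minor_at_def mdet_def)

lemma reorder_mat:
  fixes f :: "nat \<Rightarrow> int \<Rightarrow> complex"
  assumes cs: "distinct cs" "length cs = m" "length cs' = m" "set cs' \<subseteq> set cs"
  shows "mat m m (\<lambda>(a, b). f a (cs ! b)) * mat m m (\<lambda>(b, c). if cs ! b = cs' ! c then 1 else 0) =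
    mat m m (\<lambda>(a, c). f a (cs' ! c))"
proof (rule eq_matI)
  fix a c assume "a < dim_row (mat m m (\<lambda>(a, c). f a (cs' ! c)))" "c < dim_col (mat m m (\<lambda>(a, c). f a (cs' ! c)))"
  then have ac: "a < m" "c < m" by auto
  then have "cs' ! c \<in> set cs" using cs by auto
  then obtain b where b: "b < m" "cs ! b = cs' ! c" using cs by (auto simp: in_set_conv_nth)
  have "(\<Sum>k = 0..<m. f a (cs ! k) * (if cs ! k = cs' ! c then 1 else 0)) = (\<Sum>k = 0..<m. if k = b then f a (cs' ! c) else 0)"
  proof (rule sum.cong)
    fix k assume "k \<in> {0..<m}"
    then have "cs ! k = cs' ! c \<longleftrightarrow> k = b" using nth_eq_iff_index_eq[OF cs(1), of k b] b cs(2) by auto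
    then show "f a (cs ! k) * (if cs ! k = cs' ! c then 1 else 0) = (if k = b then f a (cs' ! c) else 0)"
      using b(2) by auto
  qed simp
  then show "(mat m m (\<lambda>(a, b). f a (cs ! b)) * mat m m (\<lambda>(b, c). if cs ! b = cs' ! c then 1 else 0)) $$ (a, c) =
    mat m m (\<lambda>(a, c). f a (cs' ! c)) $$ (a, c)"
    using ac b by (simp add: scalar_prod_def)
qed auto

text \<open>The factor is the determinant of the permutation matrix between the two orders, the same
  for all \<open>vs\<close>. It is nonzero because the opposite reordering gives the inverse
  matrix.\<close>

lemma mdet_reorder:
  assumes "distinct cs" "distinct cs'" "set cs = set cs'"
  shows "\<exists>\<epsilon>. \<epsilon> \<noteq> 0 \<and> (\<forall>vs. length vs = length cs \<longrightarrow> mdet vs cs' = \<epsilon> * mdet vs cs)"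
proof -
  define m where "m = length cs"
  have len: "length cs' = m" using assms distinct_card by (metis m_def)
  let ?P = "\<lambda>cs cs'. mat m m (\<lambda>(b, c). if (cs :: int list) ! b = cs' ! c then 1 else 0) :: complex mat"
  have eqs: "mat m m (\<lambda>(a, b). f a (cs ! b)) * ?P cs cs' = mat m m (\<lambda>(a, c). f a (cs' ! c))"
    "mat m m (\<lambda>(a, b). f a (cs' ! b)) * ?P cs' cs = mat m m (\<lambda>(a, c). f a (cs ! c))" for f :: "nat \<Rightarrow> int \<Rightarrow> complex"
    using assms len by (intro reorder_mat; simp add: m_def)+
  \<comment> \<open>With rows testing for the entry \<open>cs ! a\<close>, the left factor of the
    second equation becomes the permutation matrix itself.\<close>
  have "?P cs cs' * ?P cs' cs = ?P cs cs"
    using eqs(2)[of "\<lambda>a x. if cs ! a = x then 1 else 0"] .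
  also have "\<dots> = 1\<^sub>m m"
    using nth_eq_iff_index_eq[OF assms(1)] by (intro eq_matI) (auto simp: m_def)
  finally have "det (?P cs cs') * det (?P cs' cs) = 1"
    using det_mult[of "?P cs cs'" m "?P cs' cs"] by simp
  then have "det (?P cs cs') \<noteq> 0" by auto
  moreover have "mdet vs cs' = det (?P cs cs') * mdet vs cs" if "length vs = length cs" for vs
  proof -
    have "mdet vs cs' = det (mat m m (\<lambda>(a, b). (vs ! a) (cs ! b)) * ?P cs cs')"
      using eqs(1)[of "\<lambda>a. vs ! a"] that by (simp add: mdet_def m_def)
    also have "\<dots> = det (mat m m (\<lambda>(a, b). (vs ! a) (cs ! b))) * det (?P cs cs')"
      by (intro det_mult) auto
    finally show ?thesis using that by (simp add: mdet_def m_def)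
  qed
  ultimately show ?thesis by blast
qed

lemma mdet_block:
  assumes us: "set us \<subseteq> supp C" and ws: "set ws \<subseteq> supp D" and CD: "C \<inter> D = {}"
    and cs: "set cs \<subseteq> C" "length cs = length us" and ds: "set ds \<subseteq> D" "length ds = length ws"
  shows "mdet (us @ ws) (cs @ ds) = mdet us cs * mdet ws ds"
proof -
  let ?p = "length us" and ?q = "length ws"
  let ?A = "mat ?p ?p (\<lambda>(a, b). (us ! a) (cs ! b))" and ?B = "mat ?q ?q (\<lambda>(a, b). (ws ! a) (ds ! b))"
  have u0: "(us ! a) (ds ! b) = 0" if "a < ?p" "b < ?q" for a b
  proof -
    have "us ! a \<in> supp C" "ds ! b \<in> D" using us ds that by auto
    then show ?thesis using CD by (auto simp: supp_def)
  qed
  have w0: "(ws ! a) (cs ! b) = 0" if "a < ?q" "b < ?p" for a b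
  proof -
    have "ws ! a \<in> supp D" "cs ! b \<in> C" using ws cs that by auto
    then show ?thesis using CD by (auto simp: supp_def)
  qed
  have "mat (length (us @ ws)) (length (us @ ws)) (\<lambda>(a, b). ((us @ ws) ! a) ((cs @ ds) ! b)) =
      four_block_mat ?A (0\<^sub>m ?p ?q) (0\<^sub>m ?q ?p) ?B"
    by (rule eq_matI) (auto simp: nth_append cs ds u0 w0)
  then have "mdet (us @ ws) (cs @ ds) = det (four_block_mat ?A (0\<^sub>m ?p ?q) (0\<^sub>m ?q ?p) ?B)"
    by (simp only: mdet_def)
  also have "\<dots> = det ?A * det ?B"
    by (rule det_four_block_mat_upper_right_zero) auto
  finally show ?thesis by (simp add: mdet_def)
qed

lemma span_list:
  assumes "distinct vs" "v \<in> cv.span (set vs)"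
  obtains c where "v = (\<Sum>b = 0..<length vs. cscale (c b) (vs ! b))"
proof -
  obtain u where "v = (\<Sum>x\<in>set vs. cscale (u x) x)"
    using assms(2) by (auto simp: cv.span_finite)
  also have "\<dots> = (\<Sum>b\<in>{..<length vs}. cscale (u (vs ! b)) (vs ! b))"
    by (rule sum.reindex_bij_betw[OF bij_betw_nth[OF assms(1) refl refl], symmetric])
  finally show ?thesis using that[of "\<lambda>b. u (vs ! b)"] by (simp add: lessThan_atLeast0)
qed

text \<open>The constant is the determinant of the matrix expressing \<open>us\<close> in terms of
  \<open>vs\<close>, so it is independent of the columns.\<close>

lemma minor_at_change:
  assumes "length us = length vs" "distinct vs" "set us \<subseteq> cv.span (set vs)"
  obtains c where "\<And>K. minor_at us K = c * minor_at vs K"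
proof -
  let ?m = "length vs"
  have "\<exists>c. us ! a = (\<Sum>b = 0..<?m. cscale (c b) (vs ! b))" if "a < ?m" for a
    using span_list[OF assms(2), of "us ! a"] assms(1,3) that by (metis nth_mem subsetD)
  then obtain M where M: "\<And>a. a < ?m \<Longrightarrow> us ! a = (\<Sum>b = 0..<?m. cscale (M a b) (vs ! b))" by metis
  have "mdet us cs = det (mat ?m ?m (\<lambda>(a, b). M a b)) * mdet vs cs" for cs
  proof -
    have "mat ?m ?m (\<lambda>(a, b). (us ! a) (cs ! b)) = mat ?m ?m (\<lambda>(a, b). M a b) * mat ?m ?m (\<lambda>(a, b). (vs ! a) (cs ! b))"
      by (rule eq_matI) (simp_all add: scalar_prod_def M cvec_sum_apply)
    then have "mdet us cs = det (mat ?m ?m (\<lambda>(a, b). M a b) * mat ?m ?m (\<lambda>(a, b). (vs ! a) (cs ! b)))"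
      by (simp only: mdet_def assms(1))
    also have "\<dots> = det (mat ?m ?m (\<lambda>(a, b). M a b)) * det (mat ?m ?m (\<lambda>(a, b). (vs ! a) (cs ! b)))"
      by (rule det_mult) auto
    finally show ?thesis by (simp only: mdet_def)
  qed
  then show ?thesis by (intro that[of "det (mat ?m ?m (\<lambda>(a, b). M a b))"]) (simp add: minor_at_eq assms(1))
qed

section \<open>Coordinates of a subspace\<close>

definition basis_list :: "cvec set \<Rightarrow> cvec list \<Rightarrow> bool" where
  "basis_list H vs \<longleftrightarrow> distinct vs \<and> cv.independent (set vs) \<and> cv.span (set vs) = H"

lemma pluecker_coords_eq:
  "pluecker_coords H = {(\<lambda>K. c * minor_at vs K) | c vs. c \<noteq> 0 \<and> basis_list H vs}"
  by (simp add: pluecker_coords_def basis_list_def)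

lemma basis_list_length: "basis_list H vs \<Longrightarrow> length vs = cv.dim H"
  using cv.dim_span_eq_card_independent distinct_card by (metis basis_list_def)

lemma pivots_basis_list:
  assumes "cv.subspace H" "pivots H K"
  obtains vs where "basis_list H vs" "minor_at vs K = 1"
proof -
  obtain w where w: "\<And>k i. k \<in> K \<Longrightarrow> i \<in> K \<Longrightarrow> w k i = (if i = k then 1 else 0)"
    "inj_on w K" "cv.independent (w ` K)" "cv.span (w ` K) = H"
    using pivots_basis[OF assms] by metis
  have fin: "finite K" using assms(2) by (simp add: pivots_def)
  define cs where "cs = sorted_list_of_set K"
  have cs: "distinct cs" "set cs = K" using fin by (auto simp: cs_def)
  let ?m = "length cs"
  have "mat ?m ?m (\<lambda>(a, b). (map w cs ! a) (cs ! b)) = 1\<^sub>m ?m"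
  proof (rule eq_matI)
    fix a b assume "a < dim_row (1\<^sub>m ?m :: complex mat)" "b < dim_col (1\<^sub>m ?m :: complex mat)"
    then have ab: "a < ?m" "b < ?m" by auto
    then have "cs ! a \<in> K" "cs ! b \<in> K" using cs(2) by auto
    then show "mat ?m ?m (\<lambda>(a, b). (map w cs ! a) (cs ! b)) $$ (a, b) = 1\<^sub>m ?m $$ (a, b)"
      using ab w(1) nth_eq_iff_index_eq[OF cs(1), of a b] by auto
  qed auto
  then have "mdet (map w cs) cs = 1" by (simp add: mdet_def)
  then have "minor_at (map w cs) K = 1" using fin by (simp add: minor_at_eq cs_def)
  moreover have "basis_list H (map w cs)"
    using w(2-4) cs by (simp add: basis_list_def distinct_map)
  ultimately show ?thesis using that by blast
qed

lemma pluecker_coords_subspace: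
  assumes "x \<in> pluecker_coords H" shows "cv.subspace H"
proof -
  obtain vs where "H = cv.span (set vs)" using assms by (auto simp: pluecker_coords_eq basis_list_def)
  then show ?thesis by simp
qed

lemma pluecker_coords_nonempty:
  assumes "finite N" "cv.subspace H" "H \<subseteq> supp N"
  obtains x where "x \<in> pluecker_coords H"
proof -
  obtain K where "pivots H K" using pivots_exist[OF assms] by metis
  then obtain vs where "basis_list H vs" using pivots_basis_list assms(2) by metis
  then have "(\<lambda>K. 1 * minor_at vs K) \<in> pluecker_coords H" unfolding pluecker_coords_eq by fastforce
  then show ?thesis by (rule that)
qed

lemma basis_list_change:
  assumes "basis_list H us" "basis_list H vs"
  obtains c where "\<And>K. minor_at us K = c * minor_at vs K"
proof (rule minor_at_change)
  show "length us = length vs" using assms basis_list_length by metis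
  show "set us \<subseteq> cv.span (set vs)" using assms cv.span_superset unfolding basis_list_def by blast
qed (use assms in \<open>auto simp: basis_list_def\<close>)

lemma minor_at_pivots:
  assumes "pivots H K" "basis_list H vs"
  shows "minor_at vs K \<noteq> 0"
proof -
  have "cv.subspace H" using assms(2) unfolding basis_list_def by (metis cv.subspace_span)
  then obtain us where us: "basis_list H us" "minor_at us K = 1" using pivots_basis_list assms(1) by metis
  then show ?thesis using basis_list_change[OF us(1) assms(2)] by (metis mult_zero_right zero_neq_one)
qed

text \<open>A vector of \<open>H\<close> vanishing on \<open>K\<close> has its coefficients in the
  kernel of the transposed matrix, hence is zero. So \<open>K\<close> contains a pivot set, and
  comparing cardinalities with \<open>cv.dim H\<close> shows that it is all of
  \<open>K\<close>.\<close>

lemma pivots_minor_at: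
  assumes K: "finite K" and vs: "basis_list H vs" and nz: "minor_at vs K \<noteq> 0"
  shows "pivots H K"
proof -
  have sub: "cv.subspace H" using vs unfolding basis_list_def by (metis cv.subspace_span)
  let ?m = "length vs"
  define cs where "cs = sorted_list_of_set K"
  have card: "card K = ?m" and det: "mdet vs cs \<noteq> 0"
    using nz by (auto simp: minor_at_eq cs_def split: if_splits)
  have cs: "set cs = K" "length cs = ?m" using K card by (auto simp: cs_def)
  let ?A = "mat ?m ?m (\<lambda>(a, b). (vs ! a) (cs ! b))"
  have detT: "det (transpose_mat ?A) \<noteq> 0"
    using det det_transpose[of ?A ?m] by (simp add: mdet_def)
  have inj: "v = 0" if v: "v \<in> H" and z: "\<forall>k\<in>K. v k = 0" for v
  proof -
    have "v \<in> cv.span (set vs)" "distinct vs" using v vs by (auto simp: basis_list_def)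
    then obtain c where c: "v = (\<Sum>a = 0..<?m. cscale (c a) (vs ! a))" using span_list by metis
    have "transpose_mat ?A *\<^sub>v vec ?m c = 0\<^sub>v ?m"
    proof (rule eq_vecI)
      fix b assume "b < dim_vec (0\<^sub>v ?m :: complex vec)"
      then have b: "b < ?m" by simp
      then have "v (cs ! b) = 0" using z cs by auto
      then have "(\<Sum>a = 0..<?m. (vs ! a) (cs ! b) * c a) = 0"
        by (simp add: c cvec_sum_apply mult.commute)
      then show "(transpose_mat ?A *\<^sub>v vec ?m c) $ b = 0\<^sub>v ?m $ b"
        using b by (simp add: scalar_prod_def)
    qed auto
    moreover have "\<not> (\<exists>w. w \<in> carrier_vec ?m \<and> w \<noteq> 0\<^sub>v ?m \<and> transpose_mat ?A *\<^sub>v w = 0\<^sub>v ?m)"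
      using det_0_iff_vec_prod_zero[of "transpose_mat ?A" ?m] detT by auto
    ultimately have "vec ?m c = 0\<^sub>v ?m" by (metis vec_carrier)
    then have "c a = 0" if "a < ?m" for a using that by (metis index_vec index_zero_vec(1))
    then have "v = (\<Sum>a = 0..<?m. 0)" unfolding c by (intro sum.cong) (auto simp: fun_eq_iff)
    then show "v = 0" by simp
  qed
  obtain L where L: "L \<subseteq> K" "separated H L"
    "\<And>v. v \<in> H \<Longrightarrow> (\<forall>k\<in>L. v k = 0) \<Longrightarrow> (\<forall>i\<in>K. v i = 0)"
    using separated_extend[OF K sub, of "{}"] by (auto simp: separated_def)
  then have pL: "pivots H L" using inj finite_subset[OF L(1) K] unfolding pivots_def by blast
  have "card L = card K" using pivots_dim[OF sub pL] basis_list_length[OF vs] card by simp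
  then have "L = K" using card_subset_eq[OF K L(1)] by simp
  then show ?thesis using pL by simp
qed

text \<open>Infinite \<open>K\<close> have \<open>card K = 0\<close>, so for the zero subspace their
  coordinate is nonzero; finiteness excludes this.\<close>

lemma pluecker_coords_nonzero_iff:
  assumes "x \<in> pluecker_coords H" "finite K"
  shows "x K \<noteq> 0 \<longleftrightarrow> pivots H K"
proof -
  obtain c vs where "x = (\<lambda>K. c * minor_at vs K)" "c \<noteq> 0" "basis_list H vs"
    using assms(1) by (auto simp: pluecker_coords_eq)
  then show ?thesis using minor_at_pivots pivots_minor_at[OF assms(2)] by auto
qed

lemma pluecker_coords_nonzero_exists:
  assumes "x \<in> pluecker_coords H" "finite N" "H \<subseteq> supp N"
  obtains K where "K \<subseteq> N" "x K \<noteq> 0"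
proof -
  obtain K where "K \<subseteq> N" "pivots H K"
    using pivots_exist[OF assms(2) pluecker_coords_subspace[OF assms(1)] assms(3)] .
  then show ?thesis using that pluecker_coords_nonzero_iff[OF assms(1)] finite_subset[OF _ assms(2)] by blast
qed

lemma pluecker_coords_proportional:
  assumes "x \<in> pluecker_coords H" "y \<in> pluecker_coords H" "finite N" "H \<subseteq> supp N"
  obtains c where "c \<noteq> 0" "\<And>K. x K = c * y K"
proof -
  obtain a us where x: "x = (\<lambda>K. a * minor_at us K)" "a \<noteq> 0" "basis_list H us"
    using assms(1) by (auto simp: pluecker_coords_eq)
  obtain b vs where y: "y = (\<lambda>K. b * minor_at vs K)" "b \<noteq> 0" "basis_list H vs"
    using assms(2) by (auto simp: pluecker_coords_eq)
  obtain c where c: "\<And>K. minor_at us K = c * minor_at vs K" using basis_list_change[OF x(3) y(3)] by metis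
  obtain K where "x K \<noteq> 0" using pluecker_coords_nonzero_exists[OF assms(1,3,4)] by metis
  then have "c \<noteq> 0" using c x(1) by auto
  then show ?thesis using x y c by (intro that[of "a * c / b"]) auto
qed

lemma pluecker_coords_scale:
  assumes "x \<in> pluecker_coords H" "c \<noteq> 0"
  shows "(\<lambda>K. c * x K) \<in> pluecker_coords H"
proof -
  obtain a us where x: "x = (\<lambda>K. a * minor_at us K)" "a \<noteq> 0" "basis_list H us"
    using assms(1) by (auto simp: pluecker_coords_eq)
  have "(\<lambda>K. c * x K) = (\<lambda>K. (c * a) * minor_at us K)" by (simp add: x(1) mult.assoc)
  then show ?thesis unfolding pluecker_coords_eq using x assms(2) mult_eq_0_iff by blast
qed

lemma pluecker_coords_outside:
  assumes "x \<in> pluecker_coords H" "H \<subseteq> supp C" "finite K" "\<not> K \<subseteq> C"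
  shows "x K = 0"
proof (rule ccontr)
  assume "x K \<noteq> 0"
  then have p: "pivots H K" using pluecker_coords_nonzero_iff assms by blast
  obtain k where k: "k \<in> K" "k \<notin> C" using assms(4) by auto
  then obtain w where "w \<in> H" "w k = 1" using p unfolding pivots_def separated_def by fastforce
  then show False using k(2) assms(2) by (auto simp: supp_def)
qed

section \<open>Coordinates of sums with disjoint supports\<close>

lemma span_join:
  assumes A: "cv.subspace A" "A \<subseteq> supp C" and B: "cv.subspace B" "B \<subseteq> supp D" and CD: "C \<inter> D = {}"
    and v: "v \<in> cv.span (A \<union> B)"
  shows "trunc C v \<in> A" "trunc D v \<in> B" "v = trunc C v + trunc D v"
proof -
  obtain a b where ab: "v = a + b" "a \<in> A" "b \<in> B"
    using v A(1) B(1) by (auto simp: cv.span_Un cv.span_eq_iff[THEN iffD2])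
  have "trunc C a = a" "trunc D a = 0" "trunc C b = 0" "trunc D b = b"
    using ab A(2) B(2) CD by (auto intro!: trunc_supp trunc_disjoint)
  then show "trunc C v \<in> A" "trunc D v \<in> B" "v = trunc C v + trunc D v" using ab by (simp_all add: trunc_add)
qed

text \<open>Truncating dual vectors of the sum gives dual vectors of the summand. Thus a
  nonvanishing coordinate of the sum has the right number of columns in each summand.\<close>

lemma pivots_join:
  assumes A: "cv.subspace A" "A \<subseteq> supp C" and B: "cv.subspace B" "B \<subseteq> supp D" and CD: "C \<inter> D = {}"
    and p: "pivots (cv.span (A \<union> B)) K"
  shows "pivots A (K \<inter> C)"
proof -
  have sep: "separated A (K \<inter> C)"
    unfolding separated_def
  proof
    fix k assume k: "k \<in> K \<inter> C"
    then obtain w where "w \<in> cv.span (A \<union> B)" "\<forall>i\<in>K. w i = (if i = k then 1 else 0)"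
      using p unfolding pivots_def separated_def by blast
    then show "\<exists>w\<in>A. \<forall>i\<in>K \<inter> C. w i = (if i = k then 1 else 0)"
      using span_join(1)[OF A B CD] k by (intro bexI[of _ "trunc C w"]) auto
  qed
  have "v = 0" if v: "v \<in> A" "\<forall>k\<in>K \<inter> C. v k = 0" for v
  proof -
    have "v \<in> cv.span (A \<union> B)" using v by (intro cv.span_base) auto
    moreover have "\<forall>k\<in>K. v k = 0" using v A(2) by (auto simp: supp_def)
    ultimately show "v = 0" using p unfolding pivots_def by blast
  qed
  then show ?thesis using sep p by (auto simp: pivots_def)
qed

lemma independent_join:
  assumes us: "cv.independent us" "us \<subseteq> supp C" and ws: "cv.independent ws" "ws \<subseteq> supp D" and CD: "C \<inter> D = {}"
    and fin: "finite us" "finite ws"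
  shows "us \<inter> ws = {}" "cv.independent (us \<union> ws)"
proof -
  have "v = 0" if "v \<in> supp C" "v \<in> supp D" for v
  proof
    fix i show "v i = 0 i" using that CD by (cases "i \<in> C") (auto simp: supp_def)
  qed
  then show disj: "us \<inter> ws = {}" using us ws cv.dependent_zero by blast
  show "cv.independent (us \<union> ws)"
  proof (rule cv.independent_if_scalars_zero)
    fix f x assume z: "(\<Sum>x\<in>us \<union> ws. cscale (f x) x) = 0" and x: "x \<in> us \<union> ws"
    let ?a = "\<Sum>x\<in>us. cscale (f x) x" and ?b = "\<Sum>x\<in>ws. cscale (f x) x"
    have ab: "?a + ?b = 0" using z fin disj by (simp add: sum.union_disjoint)
    have a: "?a \<in> supp C" and b: "?b \<in> supp D"
      using us(2) ws(2) by (auto intro!: cv.subspace_sum subspace_supp cv.subspace_scale)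
    have "trunc C (?a + ?b) = ?a" "trunc D (?a + ?b) = ?b"
      using a b CD by (simp_all only: trunc_add trunc_supp[OF a order_refl] trunc_supp[OF b order_refl]
          trunc_disjoint[OF a CD] trunc_disjoint[OF b, of C] Int_commute add_0_left add_0_right)
    moreover have "trunc J 0 = 0" for J by (auto simp: fun_eq_iff)
    ultimately have "?a = 0" "?b = 0" using ab by metis+
    then show "f x = 0" using x cv.independentD[OF us(1) fin(1)] cv.independentD[OF ws(1) fin(2)] by blast
  qed (use fin in auto)
qed

text \<open>The sign \<open>\<epsilon>\<close> depends only on how the columns are shuffled, not on the subspaces.\<close>

lemma minor_at_join:
  assumes C: "finite C" and D: "finite D" and CD: "C \<inter> D = {}"
  obtains \<epsilon> :: "int set \<Rightarrow> complex" where "\<And>K. \<epsilon> K \<noteq> 0"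
    "\<And>us ws K. set us \<subseteq> supp C \<Longrightarrow> set ws \<subseteq> supp D \<Longrightarrow> K \<subseteq> C \<union> D \<Longrightarrow>
       card (K \<inter> C) = length us \<Longrightarrow> card (K \<inter> D) = length ws \<Longrightarrow>
       minor_at (us @ ws) K = \<epsilon> K * (minor_at us (K \<inter> C) * minor_at ws (K \<inter> D))"
proof -
  let ?l = "\<lambda>K. sorted_list_of_set (K \<inter> C) @ sorted_list_of_set (K \<inter> D)"
  have "\<exists>\<epsilon>. \<epsilon> \<noteq> 0 \<and> (K \<subseteq> C \<union> D \<longrightarrow>
      (\<forall>vs. length vs = length (?l K) \<longrightarrow> mdet vs (sorted_list_of_set K) = \<epsilon> * mdet vs (?l K)))" for K
  proof (cases "K \<subseteq> C \<union> D")
    case True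
    have "distinct (?l K)" "set (?l K) = set (sorted_list_of_set K)"
      using True C D CD finite_subset[OF True] by auto
    then show ?thesis using mdet_reorder[of "?l K" "sorted_list_of_set K"] by auto
  qed (auto intro: exI[of _ 1])
  then obtain \<epsilon> where \<epsilon>: "\<And>K. \<epsilon> K \<noteq> 0" "\<And>K vs. K \<subseteq> C \<union> D \<Longrightarrow> length vs = length (?l K) \<Longrightarrow>
      mdet vs (sorted_list_of_set K) = \<epsilon> K * mdet vs (?l K)"
    by metis
  show ?thesis
  proof (rule that[OF \<epsilon>(1)])
    fix us ws K
    assume a: "set us \<subseteq> supp C" "set ws \<subseteq> supp D" and K: "K \<subseteq> C \<union> D"
      and c: "card (K \<inter> C) = length us" "card (K \<inter> D) = length ws"
    have finK: "finite K" using finite_subset[OF K] C D by auto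
    have "K = (K \<inter> C) \<union> (K \<inter> D)" using K by auto
    moreover have "card ((K \<inter> C) \<union> (K \<inter> D)) = card (K \<inter> C) + card (K \<inter> D)"
      using finK CD by (intro card_Un_disjoint) auto
    ultimately have card: "card K = length (us @ ws)" using c by simp
    have "mdet (us @ ws) (sorted_list_of_set K) = \<epsilon> K * mdet (us @ ws) (?l K)"
      using c finK by (intro \<epsilon>(2)[OF K]) simp
    also have "mdet (us @ ws) (?l K) = mdet us (sorted_list_of_set (K \<inter> C)) * mdet ws (sorted_list_of_set (K \<inter> D))"
      using a CD c finK by (intro mdet_block) auto
    finally show "minor_at (us @ ws) K = \<epsilon> K * (minor_at us (K \<inter> C) * minor_at ws (K \<inter> D))"
      using card c by (simp add: minor_at_eq)
  qed
qed

lemma pluecker_coords_join: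
  assumes C: "finite C" and D: "finite D" and CD: "C \<inter> D = {}"
  obtains \<epsilon> :: "int set \<Rightarrow> complex" where "\<And>K. \<epsilon> K \<noteq> 0"
    "\<And>A B x y. A \<subseteq> supp C \<Longrightarrow> B \<subseteq> supp D \<Longrightarrow> x \<in> pluecker_coords A \<Longrightarrow> y \<in> pluecker_coords B \<Longrightarrow>
       \<exists>z\<in>pluecker_coords (cv.span (A \<union> B)). \<forall>K\<subseteq>C \<union> D. z K = \<epsilon> K * (x (K \<inter> C) * y (K \<inter> D))"
proof -
  obtain \<epsilon> :: "int set \<Rightarrow> complex" where \<epsilon>: "\<And>K. \<epsilon> K \<noteq> 0"
    "\<And>us ws K. set us \<subseteq> supp C \<Longrightarrow> set ws \<subseteq> supp D \<Longrightarrow> K \<subseteq> C \<union> D \<Longrightarrow>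
       card (K \<inter> C) = length us \<Longrightarrow> card (K \<inter> D) = length ws \<Longrightarrow>
       minor_at (us @ ws) K = \<epsilon> K * (minor_at us (K \<inter> C) * minor_at ws (K \<inter> D))"
    using minor_at_join[OF C D CD] by metis
  show ?thesis
  proof (rule that[OF \<epsilon>(1)])
    fix A B x y
    assume A: "A \<subseteq> supp C" and B: "B \<subseteq> supp D" and x: "x \<in> pluecker_coords A" and y: "y \<in> pluecker_coords B"
    obtain a us where us: "x = (\<lambda>K. a * minor_at us K)" "a \<noteq> 0" "basis_list A us"
      using x by (auto simp: pluecker_coords_eq)
    obtain b ws where ws: "y = (\<lambda>K. b * minor_at ws K)" "b \<noteq> 0" "basis_list B ws"
      using y by (auto simp: pluecker_coords_eq)
    note sA = pluecker_coords_subspace[OF x] and sB = pluecker_coords_subspace[OF y]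
    let ?H = "cv.span (A \<union> B)"
    have s: "set us \<subseteq> supp C" "set ws \<subseteq> supp D"
      using A B us(3) ws(3) cv.span_superset unfolding basis_list_def by blast+
    have ind: "set us \<inter> set ws = {}" "cv.independent (set us \<union> set ws)"
      using independent_join[OF _ s(1) _ s(2) CD] us(3) ws(3) by (auto simp: basis_list_def)
    have "cv.span (set us \<union> set ws) = cv.span (cv.span (set us) \<union> cv.span (set ws))"
      by (simp only: cv.span_Un cv.span_span)
    also have "\<dots> = ?H" using us(3) ws(3) by (simp only: basis_list_def)
    finally have "cv.span (set us \<union> set ws) = ?H" .
    then have bl: "basis_list ?H (us @ ws)" using ind us(3) ws(3) by (simp add: basis_list_def)
    let ?z = "\<lambda>K. (a * b) * minor_at (us @ ws) K"
    have z: "?z \<in> pluecker_coords ?H" unfolding pluecker_coords_eq using bl us(2) ws(2) mult_eq_0_iff by blast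
    have "?z K = \<epsilon> K * (x (K \<inter> C) * y (K \<inter> D))" if K: "K \<subseteq> C \<union> D" for K
    proof (cases "card (K \<inter> C) = length us \<and> card (K \<inter> D) = length ws")
      case True
      then show ?thesis using \<epsilon>(2)[OF s K] us(1) ws(1) by simp
    next
      \<comment> \<open>With a wrong number of columns in \<open>C\<close> or \<open>D\<close> a
        factor on the right is zero by the convention in \<open>minor_at\<close>. The left side is
        zero as well, because a pivot set of the sum meets \<open>C\<close> and \<open>D\<close> in
        pivot sets of \<open>A\<close> and \<open>B\<close>.\<close>
      case False
      have finK: "finite K" using finite_subset[OF K] C D by auto
      have "x (K \<inter> C) * y (K \<inter> D) = 0"
        using False us(1) ws(1) by (auto simp: minor_at_eq)
      moreover have "?z K = 0"
      proof (rule ccontr)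
        assume "?z K \<noteq> 0"
        then have p: "pivots ?H K" using pluecker_coords_nonzero_iff[OF z finK] by simp
        have "pivots A (K \<inter> C)" by (rule pivots_join[OF sA A sB B CD p])
        moreover have "pivots B (K \<inter> D)"
          using CD p by (intro pivots_join[OF sB B sA A]) (simp_all only: Un_commute Int_commute)
        ultimately show False
          using False pivots_dim sA sB basis_list_length us(3) ws(3) by metis
      qed
      ultimately show ?thesis by auto
    qed
    then show "\<exists>z\<in>pluecker_coords ?H. \<forall>K\<subseteq>C \<union> D. z K = \<epsilon> K * (x (K \<inter> C) * y (K \<inter> D))"
      by (intro bexI[OF _ z] allI impI)
  qed
qed

lemma span_zero_minor: "(\<lambda>K. 1 * minor_at [] K) \<in> pluecker_coords {0}"
proof -
  have "basis_list {0} []" by (simp add: basis_list_def cv.independent_empty)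
  then show ?thesis unfolding pluecker_coords_eq by fastforce
qed

text \<open>The factor is quantified before the subspaces: being the same for all of them, it can
  serve as a constant coefficient of a form.\<close>

lemma pluecker_coords_UN:
  assumes "finite I" "\<forall>i\<in>I. finite (C i)" "disjoint_family_on C I"
  shows "\<exists>\<epsilon> :: int set \<Rightarrow> complex. (\<forall>K. \<epsilon> K \<noteq> 0) \<and>
    (\<forall>A x. (\<forall>i\<in>I. A i \<subseteq> supp (C i) \<and> x i \<in> pluecker_coords (A i)) \<longrightarrow>
       (\<exists>z\<in>pluecker_coords (cv.span (\<Union>i\<in>I. A i)). \<forall>K\<subseteq>(\<Union>i\<in>I. C i). z K = \<epsilon> K * (\<Prod>i\<in>I. x i (K \<inter> C i))))"
  using assms
proof (induction I rule: finite_induct)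
  case empty
  have "minor_at [] {} = 1" by (simp add: minor_at_def)
  then have "\<exists>z\<in>pluecker_coords {0}. z {} = 1" using span_zero_minor by (metis mult_1)
  then have "\<exists>z\<in>pluecker_coords (cv.span {}). z {} = 1" by (simp only: cv.span_empty)
  then show ?case by (intro exI[of _ "\<lambda>_. 1"]) (auto simp del: cscale_apply)
next
  case (insert i I)
  have "disjoint_family_on C I" using insert.prems(2) by (auto simp: disjoint_family_on_def)
  with insert.prems(1) have "\<exists>\<epsilon> :: int set \<Rightarrow> complex. (\<forall>K. \<epsilon> K \<noteq> 0) \<and>
    (\<forall>A x. (\<forall>i\<in>I. A i \<subseteq> supp (C i) \<and> x i \<in> pluecker_coords (A i)) \<longrightarrow>
       (\<exists>z\<in>pluecker_coords (cv.span (\<Union>i\<in>I. A i)). \<forall>K\<subseteq>(\<Union>i\<in>I. C i). z K = \<epsilon> K * (\<Prod>i\<in>I. x i (K \<inter> C i))))"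
    by (intro insert.IH) auto
  then obtain \<epsilon>1 :: "int set \<Rightarrow> complex" where \<epsilon>1: "\<And>K. \<epsilon>1 K \<noteq> 0"
    "\<And>A x. (\<forall>i\<in>I. A i \<subseteq> supp (C i) \<and> x i \<in> pluecker_coords (A i)) \<Longrightarrow>
       (\<exists>z\<in>pluecker_coords (cv.span (\<Union>i\<in>I. A i)). \<forall>K\<subseteq>(\<Union>i\<in>I. C i). z K = \<epsilon>1 K * (\<Prod>i\<in>I. x i (K \<inter> C i)))"
    by (elim exE conjE) (rule that, erule spec, erule allE, erule allE, erule mp)
  let ?D = "\<Union>i\<in>I. C i"
  have fin: "finite (C i)" "finite ?D" using insert by auto
  have disj: "C i \<inter> ?D = {}" using insert.prems(2) insert.hyps by (auto simp: disjoint_family_on_def)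
  obtain \<epsilon>2 :: "int set \<Rightarrow> complex" where \<epsilon>2: "\<And>K. \<epsilon>2 K \<noteq> 0"
    "\<And>A B x y. A \<subseteq> supp (C i) \<Longrightarrow> B \<subseteq> supp ?D \<Longrightarrow> x \<in> pluecker_coords A \<Longrightarrow> y \<in> pluecker_coords B \<Longrightarrow>
       \<exists>z\<in>pluecker_coords (cv.span (A \<union> B)). \<forall>K\<subseteq>C i \<union> ?D. z K = \<epsilon>2 K * (x (K \<inter> C i) * y (K \<inter> ?D))"
    using pluecker_coords_join[OF fin disj] by metis
  show ?case
  proof (intro exI[of _ "\<lambda>K. \<epsilon>2 K * \<epsilon>1 (K \<inter> ?D)"] conjI allI impI)
    fix K show "\<epsilon>2 K * \<epsilon>1 (K \<inter> ?D) \<noteq> 0" using \<epsilon>1(1) \<epsilon>2(1) by simp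
  next
    fix A x assume Ax: "\<forall>j\<in>insert i I. A j \<subseteq> supp (C j) \<and> x j \<in> pluecker_coords (A j)"
    let ?B = "cv.span (\<Union>j\<in>I. A j)"
    obtain y where y: "y \<in> pluecker_coords ?B" "\<And>K. K \<subseteq> ?D \<Longrightarrow> y K = \<epsilon>1 K * (\<Prod>j\<in>I. x j (K \<inter> C j))"
      using \<epsilon>1(2)[of A x] Ax by auto
    have "?B \<subseteq> supp ?D"
    proof (intro cv.span_minimal subspace_supp UN_least)
      fix j assume j: "j \<in> I"
      then have "A j \<subseteq> supp (C j)" using Ax by blast
      also have "\<dots> \<subseteq> supp ?D" using j by (intro supp_mono) blast
      finally show "A j \<subseteq> supp ?D" .
    qed
    then obtain z where z: "z \<in> pluecker_coords (cv.span (A i \<union> ?B))"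
      "\<And>K. K \<subseteq> C i \<union> ?D \<Longrightarrow> z K = \<epsilon>2 K * (x i (K \<inter> C i) * y (K \<inter> ?D))"
      using \<epsilon>2(2)[of "A i" ?B "x i" y] Ax y(1) by blast
    have eq: "cv.span (A i \<union> ?B) = cv.span (\<Union>j\<in>insert i I. A j)"
      by (simp only: UN_insert cv.span_Un cv.span_span)
    have "z K = \<epsilon>2 K * \<epsilon>1 (K \<inter> ?D) * (\<Prod>j\<in>insert i I. x j (K \<inter> C j))" if K: "K \<subseteq> (\<Union>j\<in>insert i I. C j)" for K
    proof -
      have "(\<Prod>j\<in>I. x j (K \<inter> ?D \<inter> C j)) = (\<Prod>j\<in>I. x j (K \<inter> C j))"
      proof (rule prod.cong[OF refl])
        fix j assume "j \<in> I"
        then have "K \<inter> ?D \<inter> C j = K \<inter> C j" by blast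
        then show "x j (K \<inter> ?D \<inter> C j) = x j (K \<inter> C j)" by (simp only:)
      qed
      moreover have "K \<subseteq> C i \<union> ?D" using K by auto
      ultimately show ?thesis using z(2)[of K] y(2)[of "K \<inter> ?D"] insert.hyps by simp
    qed
    then show "\<exists>z\<in>pluecker_coords (cv.span (\<Union>j\<in>insert i I. A j)). \<forall>K\<subseteq>(\<Union>j\<in>insert i I. C j).
        z K = \<epsilon>2 K * \<epsilon>1 (K \<inter> ?D) * (\<Prod>j\<in>insert i I. x j (K \<inter> C j))"
      using z(1) unfolding eq by (intro bexI[of _ z] allI impI)
  qed
qed

text \<open>\<open>H \<inter> supp (N - C)\<close> is the kernel of the restriction of
  \<open>H\<close> to \<open>C\<close>, and the rank of this restriction is the maximum of
  \<open>card (K \<inter> C)\<close> over the pivot sets \<open>K\<close>.\<close>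

lemma dim_ge_iff_pivots:
  assumes N: "finite N" and H: "cv.subspace H" "H \<subseteq> supp N"
  shows "r \<le> cv.dim (H \<inter> supp (N - C)) \<longleftrightarrow> (\<forall>K\<subseteq>N. pivots H K \<longrightarrow> card (K \<inter> C) + r \<le> cv.dim H)"
proof (intro iffI allI impI)
  fix K assume r: "r \<le> cv.dim (H \<inter> supp (N - C))" and K: "K \<subseteq> N" "pivots H K"
  have fin: "finite K" using K(2) by (simp add: pivots_def)
  have "cv.dim (H \<inter> supp (N - C)) \<le> card (K - C)"
  proof (rule dim_le_if_injective)
    fix v assume v: "v \<in> H \<inter> supp (N - C)" "\<forall>i\<in>K - C. v i = 0"
    then have "\<forall>i\<in>K. v i = 0" by (auto simp: supp_def)
    then show "v = 0" using K(2) v(1) unfolding pivots_def by blast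
  qed (use fin H(1) subspace_supp cv.subspace_inter in blast)+
  moreover have "card K = card (K \<inter> C) + card (K - C)"
    by (rule card_Int_Diff[OF fin])
  ultimately show "card (K \<inter> C) + r \<le> cv.dim H" using r pivots_dim[OF H(1) K(2)] by linarith
next
  assume a: "\<forall>K\<subseteq>N. pivots H K \<longrightarrow> card (K \<inter> C) + r \<le> cv.dim H"
  have "finite (N \<inter> C)" "separated H {}" using N by (simp_all add: separated_def)
  \<comment> \<open>\<open>S\<close> consists of pivots for the restriction to \<open>C\<close>.
    Once it is extended to pivots \<open>K\<close> of \<open>H\<close>, the dual vectors at
    \<open>K - S\<close> vanish on \<open>C\<close> and show that the kernel is large
    enough.\<close>
  then obtain S where S': "S \<subseteq> {} \<union> N \<inter> C" "separated H S"
    "\<forall>v\<in>H. (\<forall>k\<in>S. v k = 0) \<longrightarrow> (\<forall>i\<in>N \<inter> C. v i = 0)"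
    using separated_extend[OF _ H(1) finite.emptyI] by meson
  then have S: "S \<subseteq> N \<inter> C" "separated H S"
    "\<And>v. v \<in> H \<Longrightarrow> (\<forall>k\<in>S. v k = 0) \<Longrightarrow> (\<forall>i\<in>N \<inter> C. v i = 0)" by auto
  obtain K where K: "S \<subseteq> K" "K \<subseteq> N" "pivots H K"
    using pivots_extend[OF N H _ S(2)] S(1) by blast
  have finK: "finite K" using K(3) by (simp add: pivots_def)
  have "separated (H \<inter> supp (N - C)) (K - S)"
    unfolding separated_def
  proof
    fix k assume k: "k \<in> K - S"
    then obtain w where w: "w \<in> H" "\<forall>i\<in>K. w i = (if i = k then 1 else 0)"
      using K(3) unfolding pivots_def separated_def by blast
    have "\<forall>i\<in>S. w i = 0" using w(2) k K(1) by auto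
    then have "\<forall>i\<in>N \<inter> C. w i = 0" using S(3) w(1) by blast
    moreover have "w \<in> supp N" using w(1) H(2) by blast
    ultimately have "w \<in> supp (N - C)" by (auto simp: supp_def)
    then show "\<exists>w\<in>H \<inter> supp (N - C). \<forall>i\<in>K - S. w i = (if i = k then 1 else 0)"
      using w by (intro bexI[of _ w]) auto
  qed
  then have "card (K - S) \<le> cv.dim (H \<inter> supp (N - C))"
    using H K(2) subspace_supp by (intro separated_card_le[OF N] cv.subspace_inter) auto
  moreover have "card (K - S) = card K - card S" using K(1) finK by (intro card_Diff_subset) (auto intro: finite_subset)
  moreover have "card S \<le> card (K \<inter> C)" using S(1) K(1) finK by (intro card_mono) auto
  moreover have "card (K \<inter> C) + r \<le> card K" using a K(2,3) pivots_dim[OF H(1) K(3)] by simp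
  ultimately show "r \<le> cv.dim (H \<inter> supp (N - C))" by linarith
qed

section \<open>The isomorphism\<close>

lemma multiform_prod:
  assumes "finite S" "\<And>s. s \<in> S \<Longrightarrow> multiform I K (m s) (G s)"
  shows "multiform I K (\<lambda>j. \<Sum>s\<in>S. m s j) (\<lambda>x. \<Prod>s\<in>S. G s x)"
  using assms
proof (induction S rule: finite_induct)
  case empty
  then show ?case using multiform.const[of I K 1] by simp
next
  case (insert s S)
  then show ?case using multiform.mult[of I K "m s" "G s" "\<lambda>j. \<Sum>s\<in>S. m s j" "\<lambda>x. \<Prod>s\<in>S. G s x"] by simp
qed

lemma pluecker_simps [simp]:
  "points (pluecker n S) = S" "factors (pluecker n S) = UNIV" "indices (pluecker n S) i = Pow {-int n..int n}"
  by (simp_all add: pluecker_def)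

lemma hom_coords_pluecker: "h \<in> hom_coords (pluecker n S) H \<longleftrightarrow> h () \<in> pluecker_coords H"
proof
  assume a: "h () \<in> pluecker_coords H"
  have eq: "h = (\<lambda>_. h ())" by (rule ext) simp
  have "h \<in> {(\<lambda>_. x) | x. x \<in> pluecker_coords H}"
    by (rule CollectI, rule exI[of _ "h ()"], rule conjI[OF eq a])
  then show "h \<in> hom_coords (pluecker n S) H" by (simp add: pluecker_def)
qed (auto simp: pluecker_def)

context sy_pair
begin

text \<open>The columns sets whose coordinate must vanish on \<open>X\<close>, read off from
  \<open>dim_ge_iff_pivots\<close>. The cardinality clause is the condition
  \<open>cv.dim H = n\<close>; the last clause is
  \<open>n < card (K \<inter> {la j<..int n}) + (n + 1 - j)\<close> simplified.\<close>

definition bad :: "int set \<Rightarrow> bool" where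
  "bad K \<longleftrightarrow> K \<subseteq> N \<and> (card K \<noteq> n \<or>
     (\<exists>j\<in>{1..n}. n < card (K \<inter> {-int n..<mu j}) + j \<or> j \<le> card (K \<inter> {la j<..int n})))"

text \<open>The dimension of \<open>H\<close> is left open, so that this also applies to
  \<open>join p\<close> for an arbitrary point \<open>p\<close> of the product.\<close>

lemma X_iff_bad:
  assumes H: "cv.subspace H" "H \<subseteq> supp N" "isotropic n H" and x: "x \<in> pluecker_coords H"
  shows "H \<in> X \<longleftrightarrow> (\<forall>K. bad K \<longrightarrow> x K = 0)"
proof -
  have fin: "finite N" by simp
  have dim: "cv.dim (H \<inter> cv.span (e ` {mu j..int n})) = cv.dim (H \<inter> supp (N - {-int n..<mu j}))"
    "cv.dim (H \<inter> cv.span (e ` {-int n..la j})) = cv.dim (H \<inter> supp (N - {la j<..int n}))" if "j \<in> {1..n}" for j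
  proof -
    have "{mu j..int n} = N - {-int n..<mu j}" "{-int n..la j} = N - {la j<..int n}"
      using SY_bounds[OF mu that] SY_bounds[OF la that] by auto
    then show "cv.dim (H \<inter> cv.span (e ` {mu j..int n})) = cv.dim (H \<inter> supp (N - {-int n..<mu j}))"
      "cv.dim (H \<inter> cv.span (e ` {-int n..la j})) = cv.dim (H \<inter> supp (N - {la j<..int n}))"
      unfolding span_e[OF finite_atLeastAtMost_int] by (simp_all only:)
  qed
  have "H \<in> X \<longleftrightarrow> cv.dim H = n \<and> (\<forall>j\<in>{1..n}. j \<le> cv.dim (H \<inter> supp (N - {-int n..<mu j})) \<and>
      n + 1 - j \<le> cv.dim (H \<inter> supp (N - {la j<..int n})))"
    using H by (auto simp: Xs_def Xs'_def Bn_def V_eq_supp dim)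
  also have "\<dots> \<longleftrightarrow> cv.dim H = n \<and> (\<forall>j\<in>{1..n}. \<forall>K\<subseteq>N. pivots H K \<longrightarrow>
      card (K \<inter> {-int n..<mu j}) + j \<le> n \<and> card (K \<inter> {la j<..int n}) + (n + 1 - j) \<le> n)"
    unfolding dim_ge_iff_pivots[OF fin H(1,2)] by auto
  also have "\<dots> \<longleftrightarrow> (\<forall>K. bad K \<longrightarrow> \<not> pivots H K)"
  proof
    assume a: "cv.dim H = n \<and> (\<forall>j\<in>{1..n}. \<forall>K\<subseteq>N. pivots H K \<longrightarrow>
      card (K \<inter> {-int n..<mu j}) + j \<le> n \<and> card (K \<inter> {la j<..int n}) + (n + 1 - j) \<le> n)"
    show "\<forall>K. bad K \<longrightarrow> \<not> pivots H K"
    proof (intro allI impI notI)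
      fix K assume b: "bad K" and p: "pivots H K"
      have KN: "K \<subseteq> N" using b by (simp add: bad_def)
      have "card K = n" using pivots_dim[OF H(1) p] a by simp
      then obtain j where j: "j \<in> {1..n}" "n < card (K \<inter> {-int n..<mu j}) + j \<or> j \<le> card (K \<inter> {la j<..int n})"
        using b by (auto simp: bad_def)
      have "card (K \<inter> {-int n..<mu j}) + j \<le> n" "card (K \<inter> {la j<..int n}) + (n + 1 - j) \<le> n"
        using a j(1) KN p by blast+
      then show False using j unfolding atLeastAtMost_iff by linarith
    qed
  next
    assume a: "\<forall>K. bad K \<longrightarrow> \<not> pivots H K"
    then have nb: "card K = n \<and> (\<forall>j\<in>{1..n}. \<not> n < card (K \<inter> {-int n..<mu j}) + j \<and> \<not> j \<le> card (K \<inter> {la j<..int n}))"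
      if "K \<subseteq> N" "pivots H K" for K using that unfolding bad_def by blast
    obtain K where "K \<subseteq> N" "pivots H K" using pivots_exist[OF fin H(1,2)] .
    then have "cv.dim H = n" using nb pivots_dim[OF H(1)] by metis
    moreover have "card (K \<inter> {-int n..<mu j}) + j \<le> n \<and> card (K \<inter> {la j<..int n}) + (n + 1 - j) \<le> n"
      if "j \<in> {1..n}" "K \<subseteq> N" "pivots H K" for j K
    proof -
      have "\<not> n < card (K \<inter> {-int n..<mu j}) + j" "\<not> j \<le> card (K \<inter> {la j<..int n})"
        using nb[OF that(2,3)] that(1) by blast+
      then show ?thesis using that(1) unfolding atLeastAtMost_iff by linarith
    qed
    ultimately show "cv.dim H = n \<and> (\<forall>j\<in>{1..n}. \<forall>K\<subseteq>N. pivots H K \<longrightarrow>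
      card (K \<inter> {-int n..<mu j}) + j \<le> n \<and> card (K \<inter> {la j<..int n}) + (n + 1 - j) \<le> n)" by blast
  qed
  also have "\<dots> \<longleftrightarrow> (\<forall>K. bad K \<longrightarrow> x K = 0)"
  proof -
    have "x K \<noteq> 0 \<longleftrightarrow> pivots H K" if "bad K" for K
      using that finite_subset[OF _ fin] by (intro pluecker_coords_nonzero_iff[OF x]) (auto simp: bad_def)
    then show ?thesis by blast
  qed
  finally show ?thesis .
qed

lemma closed_X: "closed_subvariety (pluecker n (Bn n)) X"
proof -
  let ?\<Phi> = "{(\<lambda>x. x () K) | K. bad K} :: ((unit \<Rightarrow> int set \<Rightarrow> complex) \<Rightarrow> complex) set"
  have "\<exists>m. form_on (pluecker n (Bn n)) m F" if F: "F \<in> ?\<Phi>" for F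
  proof -
    obtain K where K: "F = (\<lambda>x. x () K)" "K \<subseteq> N" using F by (auto simp: bad_def)
    have "form_on (pluecker n (Bn n)) (\<lambda>j. if j = () then 1 else 0) F"
      unfolding K(1) by (rule multiform.var) (use K(2) in auto)
    then show ?thesis by blast
  qed
  moreover have "H \<in> X \<longleftrightarrow> (\<forall>F\<in>?\<Phi>. \<forall>x\<in>hom_coords (pluecker n (Bn n)) H. F x = 0)" if B: "H \<in> Bn n" for H
  proof -
    note HB = BnD[OF B]
    have iff: "H \<in> X \<longleftrightarrow> (\<forall>K. bad K \<longrightarrow> x K = 0)" if "x \<in> pluecker_coords H" for x
      using X_iff_bad[OF HB(1,2,4) that] .
    obtain x where x: "x \<in> pluecker_coords H" using pluecker_coords_nonempty[OF _ HB(1,2)] by auto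
    show ?thesis
    proof
      assume "H \<in> X"
      then show "\<forall>F\<in>?\<Phi>. \<forall>x\<in>hom_coords (pluecker n (Bn n)) H. F x = 0"
        using iff by (auto simp: hom_coords_pluecker)
    next
      assume a: "\<forall>F\<in>?\<Phi>. \<forall>x\<in>hom_coords (pluecker n (Bn n)) H. F x = 0"
      have "x K = 0" if "bad K" for K
      proof -
        have "(\<lambda>x. x () K) \<in> ?\<Phi>" using that by blast
        moreover have "(\<lambda>_. x) \<in> hom_coords (pluecker n (Bn n)) H" using x by (simp add: hom_coords_pluecker)
        ultimately show ?thesis using a by fastforce
      qed
      then show "H \<in> X" using iff[OF x] by blast
    qed
  qed
  moreover have "X \<subseteq> Bn n" by (auto simp: Xs_def)
  ultimately show ?thesis unfolding closed_subvariety_def by (intro exI[of _ ?\<Phi>]) auto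
qed

section \<open>The bijection\<close>

text \<open>A point of the product, completed by the constant summand \<open>Hphi\<close> to a
  family over all blocks.\<close>

definition fam :: "cvec set \<times> ((nat \<times> int) set \<Rightarrow> cvec set) \<Rightarrow> bool + (nat \<times> int) set \<Rightarrow> cvec set" where
  "fam p = case_sum (\<lambda>b. if b then fst p else Hphi n la mu) (snd p)"

definition join :: "cvec set \<times> ((nat \<times> int) set \<Rightarrow> cvec set) \<Rightarrow> cvec set" where
  "join p = cv.span (\<Union>i\<in>blocks. fam p i)"

abbreviation "source_space \<equiv> mp_prod (pluecker n (max_isotropic n (V0 n la mu)))
  (mp_Pi inner (\<lambda>d. pluecker n (max_isotropic n (Vd d))))"

definition source :: "(cvec set \<times> ((nat \<times> int) set \<Rightarrow> cvec set)) set" where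
  "source = {H0_part n la mu H | H. H \<in> X} \<times> (\<Pi>\<^sub>E d \<in> inner. {Hd_part d H | H. H \<in> X})"

definition split :: "cvec set \<Rightarrow> cvec set \<times> ((nat \<times> int) set \<Rightarrow> cvec set)" where
  "split H = (H0_part n la mu H, restrict (\<lambda>d. Hd_part d H) inner)"

lemma fam_simps [simp]: "fam p (Inl True) = fst p" "fam p (Inl False) = Hphi n la mu" "fam p (Inr d) = snd p d"
  by (simp_all add: fam_def)

lemma blocks_members [simp]: "Inl b \<in> blocks" "Inr d \<in> blocks \<longleftrightarrow> d \<in> inner"
  by (auto simp: blocks_def)

lemma join_eq: "join (H0, Hd) = cv.span (Hphi n la mu \<union> H0 \<union> (\<Union>d\<in>inner. Hd d))"
proof -
  have "blocks = insert (Inl False) (insert (Inl True) (Inr ` inner))"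
    by (auto simp: blocks_def UNIV_bool)
  then have "(\<Union>i\<in>blocks. fam (H0, Hd) i) = Hphi n la mu \<union> H0 \<union> (\<Union>d\<in>inner. Hd d)"
    by (simp only: UN_insert fam_simps image_image fst_conv snd_conv Un_assoc)
  then show ?thesis by (simp only: join_def)
qed

lemma source_points: "p \<in> points source_space \<longleftrightarrow> fst p \<in> max_isotropic n (supp C0) \<and>
    snd p \<in> (\<Pi>\<^sub>E d\<in>inner. max_isotropic n (supp (Cd d)))"
proof -
  have "(\<Pi>\<^sub>E d\<in>inner. max_isotropic n (Vd d)) = (\<Pi>\<^sub>E d\<in>inner. max_isotropic n (supp (Cd d)))"
    by (rule PiE_cong) (simp add: Vd_eq)
  then show ?thesis by (cases p) (simp add: mp_prod_def mp_Pi_def V0_eq)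
qed

lemma max_isotropicD:
  assumes "H \<in> max_isotropic n W"
  shows "cv.subspace H" "H \<subseteq> W" "isotropic n H"
    "cv.subspace G \<Longrightarrow> G \<subseteq> W \<Longrightarrow> isotropic n G \<Longrightarrow> H \<subseteq> G \<Longrightarrow> G = H"
  using assms unfolding max_isotropic_def by auto

lemma fam_props:
  assumes p: "p \<in> points source_space" and i: "i \<in> blocks"
  shows "cv.subspace (fam p i)" "fam p i \<subseteq> supp (block i)" "isotropic n (fam p i)"
proof -
  have phi: "Hphi n la mu \<subseteq> supp Cphi" unfolding Hphi_eq_supp by (rule supp_mono) (auto simp: Cphi_def)
  have d: "snd p d \<in> max_isotropic n (supp (Cd d))" if "d \<in> inner" for d
    using p that unfolding source_points by (auto simp: PiE_def Pi_def)
  have 0: "fst p \<in> max_isotropic n (supp C0)" using p unfolding source_points by blast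
  show "cv.subspace (fam p i)"
    using i by (rule blocks_cases) (auto simp: max_isotropicD[OF 0] max_isotropicD[OF d] Hphi_eq_supp subspace_supp)
  show "fam p i \<subseteq> supp (block i)"
    using i by (rule blocks_cases) (simp_all add: max_isotropicD[OF 0] max_isotropicD[OF d] phi)
  show "isotropic n (fam p i)"
    using i by (rule blocks_cases) (simp_all add: max_isotropicD[OF 0] max_isotropicD[OF d] Hphi_isotropic)
qed

lemma join_props:
  assumes p: "p \<in> points source_space"
  shows "cv.subspace (join p)" "join p \<subseteq> supp N" "isotropic n (join p)"
proof -
  have eq: "join p = {v \<in> supp N. \<forall>i\<in>blocks. trunc (block i) v \<in> fam p i}"
    unfolding join_def using fam_props[OF p]
    by (subst span_UN_supp[OF finite_blocks disjoint_blocks]) (simp_all add: UN_blocks)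
  show "cv.subspace (join p)" by (simp add: join_def)
  show "join p \<subseteq> supp N" by (auto simp: eq)
  show "isotropic n (join p)"
    unfolding isotropic_def
  proof (intro ballI)
    fix u v assume uv: "u \<in> join p" "v \<in> join p"
    show "beta n u v = 0"
      unfolding beta_blocks[of u v]
    proof (rule sum.neutral, rule ballI)
      fix i assume i: "i \<in> blocks"
      then have "trunc (block i) u \<in> fam p i" "trunc (block i) v \<in> fam p i" using uv by (auto simp: eq)
      then show "beta n (trunc (block i) u) (trunc (block i) v) = 0"
        using fam_props(3)[OF p i] unfolding isotropic_def by blast
    qed
  qed
qed

lemma part_maximal: "H \<in> X \<Longrightarrow> i \<in> blocks \<Longrightarrow> H \<inter> supp (block i) \<in> max_isotropic n (supp (block i))"
  using X_piece_maximal cut_set_block block_sym by blast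

lemma source_subset: "source \<subseteq> points source_space"
proof
  fix p assume p: "p \<in> source"
  have "fst p \<in> max_isotropic n (supp C0)"
    using p part_maximal[of _ "Inl True"] by (auto simp: source_def H0_part_eq)
  moreover have "snd p d \<in> max_isotropic n (supp (Cd d))" if d: "d \<in> inner" for d
  proof -
    obtain H where "H \<in> X" "snd p d = Hd_part d H" using p d by (auto simp: source_def PiE_def Pi_def)
    then show ?thesis using part_maximal[of H "Inr d"] d by (simp add: Hd_part_eq)
  qed
  ultimately show "p \<in> points source_space"
    using p unfolding source_points by (auto simp: source_def PiE_def)
qed

lemma join_X:
  assumes p: "p \<in> source"
  shows "join p \<in> X"
proof -
  obtain G0 where G0: "G0 \<in> X" "fst p = H0_part n la mu G0" using p by (auto simp: source_def)
  have "snd p \<in> (\<Pi>\<^sub>E d \<in> inner. {Hd_part d H | H. H \<in> X})" using p unfolding source_def mem_Times_iff by (rule conjunct2)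
  then have "\<forall>d\<in>inner. \<exists>H. H \<in> X \<and> snd p d = Hd_part d H" by (blast dest: PiE_mem)
  then obtain G where G: "\<And>d. d \<in> inner \<Longrightarrow> G d \<in> X" "\<And>d. d \<in> inner \<Longrightarrow> snd p d = Hd_part d (G d)" by metis
  \<comment> \<open>\<open>G0\<close> also represents the fixed block, since every member of
    \<open>X\<close> has the same part \<open>Hphi\<close> there.\<close>
  let ?Hs = "case_sum (\<lambda>_. G0) G"
  have "fam p i = ?Hs i \<inter> supp (block i)" if "i \<in> blocks" for i
    using that by (rule blocks_cases) (simp_all add: G0 G(2) H0_part_eq Hd_part_eq[OF G(1)] Hphi_eq[OF G0(1)])
  then have "join p = mix ?Hs" unfolding join_def mix_def by (metis (no_types, lifting) SUP_cong)
  moreover have "mix ?Hs \<in> X"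
  proof (rule mix_X)
    fix i assume "i \<in> blocks"
    then show "?Hs i \<in> X" by (rule blocks_cases) (use G0(1) G(1) in auto)
  qed
  ultimately show ?thesis by simp
qed

text \<open>\<open>p\<close> need not be in the source. Each of its factors lies in the
  corresponding part of \<open>join p\<close>, which is isotropic, and is equal to it by
  maximality.\<close>

lemma split_join:
  assumes p: "p \<in> points source_space" and X: "join p \<in> X"
  shows "split (join p) = p"
proof -
  have fam: "join p \<inter> supp (block i) = fam p i" if i: "i \<in> blocks" "fam p i \<in> max_isotropic n (supp (block i))" for i
  proof (rule max_isotropicD(4)[OF i(2)])
    show "cv.subspace (join p \<inter> supp (block i))" "isotropic n (join p \<inter> supp (block i))"
      "join p \<inter> supp (block i) \<subseteq> supp (block i)"
      using max_isotropicD[OF part_maximal[OF X i(1)]] by auto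
    show "fam p i \<subseteq> join p \<inter> supp (block i)"
      using fam_props(2)[OF p i(1)] i(1) by (auto simp: join_def intro!: cv.span_base)
  qed
  have "fst p \<in> max_isotropic n (supp C0)" using p unfolding source_points by blast
  then have "H0_part n la mu (join p) = fst p" using fam[of "Inl True"] by (simp add: H0_part_eq)
  moreover have "restrict (\<lambda>d. Hd_part d (join p)) inner = snd p"
  proof
    fix d
    show "restrict (\<lambda>d. Hd_part d (join p)) inner d = snd p d"
    proof (cases "d \<in> inner")
      case True
      then have "snd p d \<in> max_isotropic n (supp (Cd d))" using p unfolding source_points by (auto simp: PiE_def Pi_def)
      then show ?thesis using fam[of "Inr d"] True Hd_part_eq[OF X True] by simp
    next
      case False
      then show ?thesis using p unfolding source_points by (auto simp: PiE_def extensional_def)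
    qed
  qed
  ultimately show ?thesis by (simp add: split_def)
qed

lemma split_source: "H \<in> X \<Longrightarrow> split H \<in> source"
  by (auto simp: split_def source_def)

lemma fam_split:
  assumes H: "H \<in> X" and i: "i \<in> blocks"
  shows "fam (split H) i = H \<inter> supp (block i)"
  using i by (rule blocks_cases) (simp_all add: split_def H0_part_eq Hphi_eq[OF H] Hd_part_eq[OF H])

lemma join_split:
  assumes H: "H \<in> X"
  shows "join (split H) = H"
proof -
  have "join (split H) = mix (\<lambda>_. H)"
    unfolding join_def mix_def using fam_split[OF H] by (metis (no_types, lifting) SUP_cong)
  also have "\<dots> = {v \<in> supp N. \<forall>i\<in>blocks. trunc (block i) v \<in> H}" using X_D(2)[OF H] by (rule mix_eq)
  also have "\<dots> = H"
  proof
    show "H \<subseteq> {v \<in> supp N. \<forall>i\<in>blocks. trunc (block i) v \<in> H}"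
      using X_D(3)[OF H] X_trunc[OF H] cut_set_block by blast
    show "{v \<in> supp N. \<forall>i\<in>blocks. trunc (block i) v \<in> H} \<subseteq> H"
    proof
      fix v assume v: "v \<in> {v \<in> supp N. \<forall>i\<in>blocks. trunc (block i) v \<in> H}"
      have "v = trunc N v" using v by (intro trunc_supp[symmetric]) auto
      also have "\<dots> = (\<Sum>i\<in>blocks. trunc (block i) v)"
        using trunc_UN[OF finite_blocks disjoint_blocks, of v] unfolding UN_blocks .
      also have "\<dots> \<in> H" using v X_D(2)[OF H] by (intro cv.subspace_sum) auto
      finally show "v \<in> H" .
    qed
  qed
  finally show ?thesis .
qed

text \<open>If \<open>join p\<close> lies in \<open>X\<close>, then \<open>p\<close> equals
  \<open>split (join p)\<close>, which is in the source. This exhibits the source as a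
  preimage.\<close>

lemma source_iff: "p \<in> points source_space \<Longrightarrow> p \<in> source \<longleftrightarrow> join p \<in> X"
  using join_X split_join split_source by metis

lemma bij_join: "bij_betw join source X"
proof (rule bij_betw_byWitness[of _ split])
  show "\<forall>p\<in>source. split (join p) = p" using split_join join_X source_subset by blast
  show "\<forall>H\<in>X. join (split H) = H" using join_split by blast
qed (use join_X split_source in auto)

lemma inv_join: "H \<in> X \<Longrightarrow> inv_into source join H = split H"
  using bij_join join_split split_source by (metis bij_betw_inv_into_left)

section \<open>Forms for the map\<close>

lemma source_space_simps [simp]:
  "factors source_space = UNIV <+> Sigma inner (\<lambda>_. UNIV)"
  "indices source_space (Inl u) = Pow N" "indices source_space (Inr du) = Pow N"
  by (simp_all add: mp_prod_def mp_Pi_def split: prod.splits)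

lemma hom_coords_source:
  "h \<in> hom_coords source_space p \<longleftrightarrow>
     h (Inl ()) \<in> pluecker_coords (fst p) \<and> (\<forall>d\<in>inner. h (Inr (d, ())) \<in> pluecker_coords (snd p d))" (is "_ \<longleftrightarrow> ?R")
proof
  assume "h \<in> hom_coords source_space p"
  then show ?R by (cases p) (auto simp: mp_prod_def mp_Pi_def hom_coords_pluecker)
next
  assume R: ?R
  let ?x = "\<lambda>u. h (Inl u)" and ?y = "\<lambda>(d, u). h (Inr (d, u))"
  have "h = case_sum ?x ?y" by (auto simp: fun_eq_iff split: sum.split)
  moreover have "?x \<in> hom_coords (pluecker n (max_isotropic n (V0 n la mu))) (fst p)"
    using R by (simp add: hom_coords_pluecker)
  moreover have "?y \<in> hom_coords (mp_Pi inner (\<lambda>d. pluecker n (max_isotropic n (Vd d)))) (snd p)"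
  proof -
    have "\<forall>d\<in>inner. (\<lambda>u. h (Inr (d, u))) \<in> hom_coords (pluecker n (max_isotropic n (Vd d))) (snd p d)"
      using R by (simp add: hom_coords_pluecker)
    then show ?thesis unfolding mp_Pi_def by (auto intro: exI[of _ "\<lambda>d u. h (Inr (d, u))"])
  qed
  ultimately show "h \<in> hom_coords source_space p"
    by (cases p) (auto simp: mp_prod_def)
qed

lemma hom_coords_source_nonempty:
  assumes p: "p \<in> points source_space"
  obtains h where "h \<in> hom_coords source_space p"
proof -
  have "\<exists>x. x \<in> pluecker_coords (fam p i)" if i: "i \<in> blocks" for i
  proof -
    have "finite (block i)" using cut_set_block[OF i] finite_subset unfolding cut_set_def by blast
    then show ?thesis using pluecker_coords_nonempty fam_props(1,2)[OF p i] by metis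
  qed
  then obtain x where x: "\<And>i. i \<in> blocks \<Longrightarrow> x i \<in> pluecker_coords (fam p i)" by metis
  have "case_sum (\<lambda>_. x (Inl True)) (\<lambda>(d, _). x (Inr d)) \<in> hom_coords source_space p"
    unfolding hom_coords_source using x[of "Inl True"] x[of "Inr _"] by simp
  then show ?thesis by (rule that)
qed

text \<open>The shuffle factor and the coordinates of \<open>Hphi\<close> form a constant
  coefficient. Every projective factor contributes one variable, so all \<open>F K\<close> have the
  same multidegree.\<close>

lemma join_coords:
  obtains m F where "\<And>K. K \<subseteq> N \<Longrightarrow> form_on source_space m (F K)"
    "\<And>p h. p \<in> points source_space \<Longrightarrow> h \<in> hom_coords source_space p \<Longrightarrow>
       \<exists>z\<in>pluecker_coords (join p). \<forall>K\<subseteq>N. z K = F K h"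
proof -
  have finb: "finite (block i)" if "i \<in> blocks" for i
    using cut_set_block[OF that] finite_subset unfolding cut_set_def by blast
  have finb': "\<forall>i\<in>blocks. finite (block i)" using finb by blast
  have "finite Cphi" using finb[of "Inl False"] by simp
  moreover have "Hphi n la mu \<subseteq> supp Cphi" unfolding Hphi_eq_supp by (rule supp_mono) (auto simp: Cphi_def)
  moreover have "cv.subspace (Hphi n la mu)" unfolding Hphi_eq_supp by (rule subspace_supp)
  ultimately obtain z\<phi> where z\<phi>: "z\<phi> \<in> pluecker_coords (Hphi n la mu)"
    using pluecker_coords_nonempty by metis
  obtain \<epsilon> :: "int set \<Rightarrow> complex" where \<epsilon>:
    "\<forall>A x. (\<forall>i\<in>blocks. A i \<subseteq> supp (block i) \<and> x i \<in> pluecker_coords (A i)) \<longrightarrow>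
       (\<exists>z\<in>pluecker_coords (cv.span (\<Union>i\<in>blocks. A i)). \<forall>K\<subseteq>(\<Union>i\<in>blocks. block i). z K = \<epsilon> K * (\<Prod>i\<in>blocks. x i (K \<inter> block i)))"
    using pluecker_coords_UN[OF finite_blocks finb' disjoint_blocks] by (elim exE conjE) (rule that)
  define F :: "int set \<Rightarrow> (unit + (nat \<times> int) set \<times> unit \<Rightarrow> int set \<Rightarrow> complex) \<Rightarrow> complex" where
    "F = (\<lambda>K h. (\<epsilon> K * z\<phi> (K \<inter> Cphi)) * h (Inl ()) (K \<inter> C0) * (\<Prod>d\<in>inner. h (Inr (d, ())) (K \<inter> Cd d)))"
  \<comment> \<open>The value is \<open>1\<close> on every factor; the shape is the one produced by
    \<open>multiform.mult\<close> and \<open>multiform_prod\<close>.\<close>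
  let ?m = "\<lambda>j :: unit + (nat \<times> int) set \<times> unit.
    (0 + (if j = Inl () then 1 else 0)) + (\<Sum>d\<in>inner. if j = Inr (d, ()) then 1 else 0) :: nat"
  show ?thesis
  proof (rule that[of ?m F])
    fix K assume K: "K \<subseteq> N"
    show "form_on source_space ?m (F K)"
      unfolding F_def
    proof (intro multiform.mult multiform_prod finite_inner multiform.const multiform.var)
      show "K \<inter> C0 \<in> indices source_space (Inl ())" using K by auto
      show "Inl () \<in> factors source_space" unfolding source_space_simps(1) by (intro InlI UNIV_I)
      fix d assume d: "d \<in> inner"
      show "Inr (d, ()) \<in> factors source_space" unfolding source_space_simps(1) using d by (intro InrI SigmaI UNIV_I)
      show "K \<inter> Cd d \<in> indices source_space (Inr (d, ()))" using K by auto
    qed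
  next
    fix p h assume p: "p \<in> points source_space" and h: "h \<in> hom_coords source_space p"
    define x where "x = case_sum (\<lambda>b. if b then h (Inl ()) else z\<phi>) (\<lambda>d. h (Inr (d, ())))"
    have x_simps: "x (Inl True) = h (Inl ())" "x (Inl False) = z\<phi>" "x (Inr d) = h (Inr (d, ()))" for d
      by (simp_all add: x_def)
    have "x i \<in> pluecker_coords (fam p i)" if "i \<in> blocks" for i
      using that by (rule blocks_cases) (use h z\<phi> in \<open>simp_all add: x_simps hom_coords_source\<close>)
    then obtain z where z: "z \<in> pluecker_coords (join p)"
      "\<And>K. K \<subseteq> N \<Longrightarrow> z K = \<epsilon> K * (\<Prod>i\<in>blocks. x i (K \<inter> block i))"
      using \<epsilon>[rule_format, of "fam p" x] fam_props(2)[OF p] unfolding join_def UN_blocks by blast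
    have "(\<Prod>i\<in>blocks. x i (K \<inter> block i)) =
        z\<phi> (K \<inter> Cphi) * h (Inl ()) (K \<inter> C0) * (\<Prod>d\<in>inner. h (Inr (d, ())) (K \<inter> Cd d))" for K
      unfolding blocks_def by (simp add: prod.Plus finite_inner UNIV_bool x_simps)
    then have "\<forall>K\<subseteq>N. z K = F K h" using z(2) by (simp add: F_def mult.assoc)
    then show "\<exists>z\<in>pluecker_coords (join p). \<forall>K\<subseteq>N. z K = F K h" using z(1) by blast
  qed
qed

text \<open>The forms \<open>F K\<close> with \<open>bad K\<close> are the equations of
  \<open>X\<close> pulled back along \<open>join\<close>.\<close>

lemma closed_source: "closed_subvariety source_space source"
proof -
  obtain m F where F: "\<And>K. K \<subseteq> N \<Longrightarrow> form_on source_space m (F K)"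
    "\<And>p h. p \<in> points source_space \<Longrightarrow> h \<in> hom_coords source_space p \<Longrightarrow>
       \<exists>z\<in>pluecker_coords (join p). \<forall>K\<subseteq>N. z K = F K h"
    using join_coords by metis
  let ?\<Phi> = "{F K | K. bad K}"
  have iff: "p \<in> source \<longleftrightarrow> (\<forall>K. bad K \<longrightarrow> F K h = 0)"
    if p: "p \<in> points source_space" and h: "h \<in> hom_coords source_space p" for p h
  proof -
    obtain z where z: "z \<in> pluecker_coords (join p)" "\<And>K. K \<subseteq> N \<Longrightarrow> z K = F K h" using F(2)[OF p h] by blast
    have "p \<in> source \<longleftrightarrow> (\<forall>K. bad K \<longrightarrow> z K = 0)"
      using source_iff[OF p] X_iff_bad[OF join_props[OF p] z(1)] by simp
    moreover have "z K = F K h" if "bad K" for K using that z(2) by (simp add: bad_def)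
    ultimately show ?thesis by auto
  qed
  have "\<exists>m. form_on source_space m G" if "G \<in> ?\<Phi>" for G
    using that F(1) by (auto simp: bad_def)
  moreover have "source = {p \<in> points source_space. \<forall>G\<in>?\<Phi>. \<forall>h\<in>hom_coords source_space p. G h = 0}"
  proof (intro Set.set_eqI iffI)
    fix p assume p: "p \<in> source"
    then have "p \<in> points source_space" using source_subset by blast
    then show "p \<in> {p \<in> points source_space. \<forall>G\<in>?\<Phi>. \<forall>h\<in>hom_coords source_space p. G h = 0}"
      using iff p by blast
  next
    fix p assume p: "p \<in> {p \<in> points source_space. \<forall>G\<in>?\<Phi>. \<forall>h\<in>hom_coords source_space p. G h = 0}"
    then obtain h where "h \<in> hom_coords source_space p" using hom_coords_source_nonempty by blast
    then show "p \<in> source" using iff p by blast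
  qed
  ultimately show ?thesis unfolding closed_subvariety_def by blast
qed

text \<open>One system of forms serves at all points: its values are the coordinates of
  \<open>join p\<close>, which never vanish simultaneously.\<close>

lemma regular_join: "regular_map source_space source (pluecker n (Bn n)) X join"
  unfolding regular_map_def
proof (intro conjI ballI)
  show "join ` source \<subseteq> X" using join_X by blast
  fix p and j :: unit assume p: "p \<in> source"
  obtain m F where F: "\<And>K. K \<subseteq> N \<Longrightarrow> form_on source_space m (F K)"
    "\<And>p h. p \<in> points source_space \<Longrightarrow> h \<in> hom_coords source_space p \<Longrightarrow>
       \<exists>z\<in>pluecker_coords (join p). \<forall>K\<subseteq>N. z K = F K h"
    using join_coords by metis
  have nz: "\<exists>K\<in>Pow N. F K h \<noteq> 0" if h: "h \<in> hom_coords source_space p" for h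
  proof -
    have p': "p \<in> points source_space" using p source_subset by blast
    obtain z where z: "z \<in> pluecker_coords (join p)" "\<And>K. K \<subseteq> N \<Longrightarrow> z K = F K h" using F(2)[OF p' h] by blast
    obtain K where "K \<subseteq> N" "z K \<noteq> 0"
      using pluecker_coords_nonzero_exists[OF z(1) _ join_props(2)[OF p']] by auto
    then show ?thesis using z(2) by auto
  qed
  have coords: "\<exists>y\<in>hom_coords (pluecker n (Bn n)) (join q). \<forall>K\<in>Pow N. y j K = F K h"
    if q: "q \<in> source" and h: "h \<in> hom_coords source_space q" for q h
  proof -
    have q': "q \<in> points source_space" using q source_subset by blast
    obtain z where z: "z \<in> pluecker_coords (join q)" "\<And>K. K \<subseteq> N \<Longrightarrow> z K = F K h" using F(2)[OF q' h] by blast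
    then show ?thesis by (intro bexI[of _ "\<lambda>_. z"]) (auto simp: hom_coords_pluecker)
  qed
  show "\<exists>m F. (\<forall>K\<in>indices (pluecker n (Bn n)) j. form_on source_space m (F K)) \<and>
      (\<forall>h\<in>hom_coords source_space p. \<exists>K\<in>indices (pluecker n (Bn n)) j. F K h \<noteq> 0) \<and>
      (\<forall>q\<in>source. \<forall>h\<in>hom_coords source_space q. (\<exists>K\<in>indices (pluecker n (Bn n)) j. F K h \<noteq> 0) \<longrightarrow>
         (\<exists>y\<in>hom_coords (pluecker n (Bn n)) (join q). \<forall>K\<in>indices (pluecker n (Bn n)) j. y j K = F K h))"
    unfolding pluecker_simps using F(1) nz coords by (intro exI[of _ m] exI[of _ F] conjI) auto
qed

text \<open>Fixing the columns of a nonvanishing coordinate outside a block and varying those inside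
  recovers the coordinates of the part in that block up to a common factor.\<close>

lemma part_coords:
  assumes i: "i \<in> blocks"
  obtains \<epsilon> :: "int set \<Rightarrow> complex" where "\<And>K. \<epsilon> K \<noteq> 0"
    "\<And>H x K. H \<in> X \<Longrightarrow> x \<in> pluecker_coords H \<Longrightarrow> K \<subseteq> N \<Longrightarrow>
       \<exists>a\<in>pluecker_coords (H \<inter> supp (block i)). \<exists>\<gamma>. \<forall>L\<subseteq>N.
         (if L \<subseteq> block i then \<epsilon> (K - block i \<union> L) else 0) * x (K - block i \<union> L) = \<gamma> * a L"
proof -
  let ?C = "block i" and ?D = "N - block i"
  have CN: "?C \<subseteq> N" using cut_set_block[OF i] by (simp add: cut_set_def)
  have fin: "finite N" "finite ?C" "finite ?D" using finite_subset[OF CN] by auto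
  have disj: "?C \<inter> ?D = {}" by auto
  obtain \<epsilon> :: "int set \<Rightarrow> complex" where \<epsilon>: "\<And>K. \<epsilon> K \<noteq> 0"
    "\<And>A B x y. A \<subseteq> supp ?C \<Longrightarrow> B \<subseteq> supp ?D \<Longrightarrow> x \<in> pluecker_coords A \<Longrightarrow> y \<in> pluecker_coords B \<Longrightarrow>
       \<exists>z\<in>pluecker_coords (cv.span (A \<union> B)). \<forall>K\<subseteq>?C \<union> ?D. z K = \<epsilon> K * (x (K \<inter> ?C) * y (K \<inter> ?D))"
    using pluecker_coords_join[OF fin(2,3) disj] by metis
  show ?thesis
  proof (rule that[of "\<lambda>K. 1 / \<epsilon> K"])
    fix K show "1 / \<epsilon> K \<noteq> 0" using \<epsilon>(1) by simp
  next
    fix H x K assume H: "H \<in> X" and x: "x \<in> pluecker_coords H" and K: "K \<subseteq> N"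
    note HD = X_D[OF H]
    let ?A = "H \<inter> supp ?C" and ?B = "H \<inter> supp ?D"
    have sub: "cv.subspace (H \<inter> supp J)" for J using HD(2) subspace_supp by (rule cv.subspace_inter)
    obtain a where a: "a \<in> pluecker_coords ?A" using pluecker_coords_nonempty[OF fin(2) sub] by blast
    obtain b where b: "b \<in> pluecker_coords ?B" using pluecker_coords_nonempty[OF fin(3) sub] by blast
    have span: "cv.span (?A \<union> ?B) = H"
    proof
      show "cv.span (?A \<union> ?B) \<subseteq> H" using HD(2) by (intro cv.span_minimal) auto
      show "H \<subseteq> cv.span (?A \<union> ?B)"
      proof
        fix v assume v: "v \<in> H"
        have tv: "trunc ?C v \<in> H" using X_trunc[OF H cut_set_block[OF i] v] .
        then have "v - trunc ?C v \<in> H" using v HD(2) by (intro cv.subspace_diff)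
        moreover have "v - trunc ?C v \<in> supp ?D" using v HD(3) by (auto simp: supp_def)
        ultimately have "trunc ?C v + (v - trunc ?C v) \<in> cv.span (?A \<union> ?B)"
          using tv by (intro cv.span_add cv.span_base) auto
        then show "v \<in> cv.span (?A \<union> ?B)" by simp
      qed
    qed
    obtain z where z: "z \<in> pluecker_coords H" "\<And>K. K \<subseteq> ?C \<union> ?D \<Longrightarrow> z K = \<epsilon> K * (a (K \<inter> ?C) * b (K \<inter> ?D))"
      using \<epsilon>(2)[OF _ _ a b] unfolding span by blast
    obtain c where c: "\<And>K. x K = c * z K" using pluecker_coords_proportional[OF x z(1) fin(1) HD(3)] by metis
    \<comment> \<open>For \<open>L\<close> outside the block the value must be set to zero, as
      \<open>a L\<close> is: the set \<open>K - ?C \<union> L\<close> may then well have a nonzero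
      coordinate.\<close>
    have "(if L \<subseteq> ?C then 1 / \<epsilon> (K - ?C \<union> L) else 0) * x (K - ?C \<union> L) = (c * b (K \<inter> ?D)) * a L" if L: "L \<subseteq> N" for L
    proof (cases "L \<subseteq> ?C")
      case True
      have "(K - ?C \<union> L) \<inter> ?C = L" "(K - ?C \<union> L) \<inter> ?D = K \<inter> ?D" "K - ?C \<union> L \<subseteq> ?C \<union> ?D" using True K L by auto
      then have "x (K - ?C \<union> L) = c * (\<epsilon> (K - ?C \<union> L) * (a L * b (K \<inter> ?D)))" using c z(2) by simp
      then show ?thesis using True \<epsilon>(1) by simp
    next
      case False
      have "a L = 0" using False L finite_subset fin(1) by (intro pluecker_coords_outside[OF a, of ?C]) auto
      then show ?thesis using False by simp
    qed
    then show "\<exists>a\<in>pluecker_coords ?A. \<exists>\<gamma>. \<forall>L\<subseteq>N.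
         (if L \<subseteq> ?C then 1 / \<epsilon> (K - ?C \<union> L) else 0) * x (K - ?C \<union> L) = \<gamma> * a L"
      using a by blast
  qed
qed

section \<open>Forms for the inverse map\<close>

definition factor_block :: "unit + (nat \<times> int) set \<times> unit \<Rightarrow> bool + (nat \<times> int) set" where
  "factor_block = case_sum (\<lambda>_. Inl True) (\<lambda>(d, _). Inr d)"

text \<open>A regular map is tested one projective factor at a time, but the witness must be a
  choice of coordinates on all factors. Any choice can be overwritten at \<open>j\<close>, since the
  factors scale independently.\<close>

lemma hom_coords_update:
  assumes "h \<in> hom_coords source_space p" "j \<in> factors source_space" "a \<in> pluecker_coords (fam p (factor_block j))"
  shows "h(j := a) \<in> hom_coords source_space p"
  using assms unfolding hom_coords_source by (auto simp: factor_block_def)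

text \<open>\<open>K\<close> is a pivot set of the given point \<open>H\<close>. The forms replace
  the columns of \<open>K\<close> in the block by \<open>L\<close>; the choice
  \<open>L = K \<inter> block i\<close> gives back \<open>K\<close> and hence a nonzero value at
  \<open>H\<close>. At any other \<open>q\<close> they are \<open>\<gamma>\<close> times coordinates
  of the part of \<open>q\<close>, and if one of them is nonzero, so is
  \<open>\<gamma>\<close>.\<close>

lemma regular_split: "regular_map (pluecker n (Bn n)) X source_space source (inv_into source join)"
  unfolding regular_map_def
proof (intro conjI ballI)
  show "inv_into source join ` X \<subseteq> source" using inv_join split_source by auto
  fix H j assume H: "H \<in> X" and j: "j \<in> factors source_space"
  let ?A = "pluecker n (Bn n)"
  define i where "i = factor_block j"
  have i: "i \<in> blocks" using j by (auto simp: i_def factor_block_def)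
  have ind: "indices source_space j = Pow N" by (cases j) simp_all
  obtain \<epsilon> :: "int set \<Rightarrow> complex" where \<epsilon>: "\<And>K. \<epsilon> K \<noteq> 0"
    "\<And>H x K. H \<in> X \<Longrightarrow> x \<in> pluecker_coords H \<Longrightarrow> K \<subseteq> N \<Longrightarrow>
       \<exists>a\<in>pluecker_coords (H \<inter> supp (block i)). \<exists>\<gamma>. \<forall>L\<subseteq>N.
         (if L \<subseteq> block i then \<epsilon> (K - block i \<union> L) else 0) * x (K - block i \<union> L) = \<gamma> * a L"
    using part_coords[OF i] by metis
  obtain K where K: "K \<subseteq> N" "pivots H K" using pivots_exist[OF _ X_D(2,3)[OF H]] by auto
  have finK: "finite K" using K(2) by (simp add: pivots_def)
  let ?F = "\<lambda>L (h :: unit \<Rightarrow> int set \<Rightarrow> complex).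
    (if L \<subseteq> block i then \<epsilon> (K - block i \<union> L) else 0) * h () (K - block i \<union> L)"
  let ?m = "\<lambda>j. 0 + (if j = () then 1 else 0) :: nat"
  show "\<exists>m F. (\<forall>L\<in>indices source_space j. form_on ?A m (F L)) \<and>
      (\<forall>x\<in>hom_coords ?A H. \<exists>L\<in>indices source_space j. F L x \<noteq> 0) \<and>
      (\<forall>q\<in>X. \<forall>x\<in>hom_coords ?A q. (\<exists>L\<in>indices source_space j. F L x \<noteq> 0) \<longrightarrow>
         (\<exists>y\<in>hom_coords source_space (inv_into source join q). \<forall>L\<in>indices source_space j. y j L = F L x))"
    unfolding ind
  proof (intro exI[of _ ?m] exI[of _ ?F] conjI ballI impI)
    fix L assume L: "L \<in> Pow N"
    show "form_on ?A ?m (?F L)"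
      by (intro multiform.mult multiform.const multiform.var) (use L K(1) in auto)
  next
    fix h assume h: "h \<in> hom_coords ?A H"
    have "K - block i \<union> (K \<inter> block i) = K" by auto
    moreover have "h () K \<noteq> 0" using h K(2) finK pluecker_coords_nonzero_iff by (auto simp: hom_coords_pluecker)
    ultimately have "?F (K \<inter> block i) h \<noteq> 0" using \<epsilon>(1) by simp
    then show "\<exists>L\<in>Pow N. ?F L h \<noteq> 0" using K(1) by (intro bexI[of _ "K \<inter> block i"]) auto
  next
    fix q h assume q: "q \<in> X" and h: "h \<in> hom_coords ?A q" and nz: "\<exists>L\<in>Pow N. ?F L h \<noteq> 0"
    obtain a \<gamma> where a: "a \<in> pluecker_coords (q \<inter> supp (block i))" "\<And>L. L \<subseteq> N \<Longrightarrow> ?F L h = \<gamma> * a L"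
      using \<epsilon>(2)[OF q _ K(1)] h unfolding hom_coords_pluecker by blast
    have "\<gamma> \<noteq> 0" using nz a(2) by auto
    then have ga: "(\<lambda>L. \<gamma> * a L) \<in> pluecker_coords (fam (split q) (factor_block j))"
      using pluecker_coords_scale[OF a(1)] fam_split[OF q i] by (simp add: i_def)
    obtain h0 where h0: "h0 \<in> hom_coords source_space (split q)"
      using hom_coords_source_nonempty split_source[OF q] source_subset by blast
    have "h0(j := (\<lambda>L. \<gamma> * a L)) \<in> hom_coords source_space (split q)"
      by (rule hom_coords_update[OF h0 j ga])
    then show "\<exists>y\<in>hom_coords source_space (inv_into source join q). \<forall>L\<in>Pow N. y j L = ?F L h"
      unfolding inv_join[OF q] using a(2) by (intro bexI[of _ "h0(j := (\<lambda>L. \<gamma> * a L))"]) auto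
  qed
qed

end

theorem theorem2p4:
  fixes n :: nat and mu la :: "nat \<Rightarrow> int"
  assumes "mu \<in> SY n" and "la \<in> SY n" and "SY_le n mu la"
  shows "variety_isomorphism
    (mp_prod (pluecker n (max_isotropic n (V0 n la mu)))
             (mp_Pi (inner_components n la mu) (\<lambda>d. pluecker n (max_isotropic n (Vd d)))))
    ({H0_part n la mu H | H. H \<in> Xs n mu \<inter> Xs' n la} \<times>
       (\<Pi>\<^sub>E d \<in> inner_components n la mu. {Hd_part d H | H. H \<in> Xs n mu \<inter> Xs' n la}))
    (pluecker n (Bn n))
    (Xs n mu \<inter> Xs' n la)
    (\<lambda>(H0, Hd). cv.span (Hphi n la mu \<union> H0 \<union> (\<Union>d \<in> inner_components n la mu. Hd d)))"
proof -
  interpret sy_pair n mu la using assms by unfold_locales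
  have "join = (\<lambda>(H0, Hd). cv.span (Hphi n la mu \<union> H0 \<union> (\<Union>d \<in> inner. Hd d)))"
    by (intro ext) (simp only: join_eq split_paired_all prod.case)
  moreover have "variety_isomorphism source_space source (pluecker n (Bn n)) X join"
    unfolding variety_isomorphism_def
    using closed_source closed_X bij_join regular_join regular_split by blast
  ultimately show ?thesis by (simp only: source_def)
qed

end
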